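(* Let $b\ge2$ be an integer, let $\gamma\in(1/b,1)$ and let $\psi(x)=-2\pi\sin(2\pi x)$. Then the measure $\vartheta$ on $\mathbb{R}/\mathbb{Z}\times\mathbb{R}$ (the SRB measure of $T$) is absolutely continuous with respect to Lebesgue measure on $\mathbb{R}/\mathbb{Z}\times\mathbb{R}$ and has a square integrable density. In particular, for Lebesgue a.e. $x\in\mathbb{R}$, the measure $m_x$ is absolutely continuous with respect to Lebesgue measure on $\mathbb{R}$ with a square integrable density.
   Context: Let $\mathcal{A}=\{0,1,\dots,b-1\}$ and let $\mathbb{P}$ be the Bernoulli measure on $\mathcal{A}^{\mathbb{Z}^+}$ with uniform weights $1/b$. For $x\in\mathbb{R}$ and $\mathbf{i}=(i_n)_{n\ge1}\in\mathcal{A}^{\mathbb{Z}^+}$ let $S(x,\mathbf{i})=\sum_{n=1}^\infty\gamma^{n-1}\psi\big(\frac{x+i_1+i_2b+\cdots+i_nb^{n-1}}{b^n}\big)$. Let $m_x$ be the push-forward of $\mathbb{P}$ under $\mathbf{i}\mapsto S(x,\mathbf{i})$. Let $T:\mathbb{R}/\mathbb{Z}\times\mathbb{R}\to\mathbb{R}/\mathbb{Z}\times\mathbb{R}$, $T(x,y)=(bx \bmod 1,\ \gamma y+\psi(x))$. Identifying $\mathbb{R}/\mathbb{Z}$ with $[0,1)$, the SRB measure of $T$ is $\vartheta(B)=\int_0^1 m_x(B_x)\,dx$ for Borel $B$, where $B_x=\{y:(x,y)\in B\}$. *)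

theory Defs
  imports "HOL-Probability.Probability"
begin

definition psi :: "real \<Rightarrow> real" where
  "psi x = - 2 * pi * sin (2 * pi * x)"

text \<open>Bernoulli measure on digit sequences; the paper's index n \<ge> 1 corresponds to index n-1 here.\<close>
definition bern :: "nat \<Rightarrow> (nat \<Rightarrow> nat) measure" where
  "bern b = (\<Pi>\<^sub>M n\<in>(UNIV::nat set). measure_pmf (pmf_of_set {0..<b}))"

text \<open>S(x,i) = sum over n \<ge> 1 of gamma^(n-1) psi((x + i_1 + i_2 b + ... + i_n b^(n-1)) / b^n),
  written with 0-based indices.\<close>
definition Ssum :: "nat \<Rightarrow> real \<Rightarrow> (real \<Rightarrow> real) \<Rightarrow> real \<Rightarrow> (nat \<Rightarrow> nat) \<Rightarrow> real" where
  "Ssum b \<gamma> \<psi> x i =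
     (\<Sum>n. \<gamma> ^ n * \<psi> ((x + (\<Sum>k\<le>n. real (i k) * real b ^ k)) / real b ^ (Suc n)))"

definition mfib :: "nat \<Rightarrow> real \<Rightarrow> (real \<Rightarrow> real) \<Rightarrow> real \<Rightarrow> real measure" where
  "mfib b \<gamma> \<psi> x = distr (bern b) lborel (Ssum b \<gamma> \<psi> x)"

text \<open>SRB measure on R/Z x R, identifying R/Z with [0,1), as a measure on R x R
  supported on [0,1) x R.\<close>
definition srb :: "nat \<Rightarrow> real \<Rightarrow> (real \<Rightarrow> real) \<Rightarrow> (real \<times> real) measure" where
  "srb b \<gamma> \<psi> = measure_of UNIV (sets borel)
     (\<lambda>B. \<integral>\<^sup>+ x. indicator {0..<1} x * emeasure (mfib b \<gamma> \<psi> x) (Pair x -` B) \<partial>lborel)"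

end

theory Submission
  imports Defs
begin

text \<open>Following Tsujii, the \<open>L\<^sup>2\<close> norm of the density of the measure is controlled by the energy, that is the
  number of pairs of truncated sums at distance at most \<open>r\<close>, integrated over \<open>x\<close>. Splitting by the
  first digit, the diagonal pairs reproduce the energy one level below and at scale \<open>r / \<gamma>\<close> with a
  gain of \<open>1 / (\<gamma> b) < 1\<close>. A pair of different first digits \<open>k, l\<close> is harmless when the difference of
  the two sums, as a function of \<open>x\<close>, is never small together with its derivative: such pairs
  contribute \<open>O(r\<^sup>2)\<close>. The remaining, tangential, pairs are charged to the diagonal by
  Cauchy--Schwarz with weights, and a bounded function \<open>\<omega>\<close> averages the cost along backward orbits to
  a factor \<open>\<Lambda>\<close> per step, which is affordable if \<open>\<Lambda> < \<gamma> b\<close>. For the sine the difference and its derivative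
  are explicit trigonometric sums; estimating them shows that for each \<open>x\<close> and \<open>k\<close> there are so few
  tangential partners \<open>l\<close>, and these recur so rarely, that \<open>\<Lambda> < \<gamma> b\<close> can be achieved.\<close>

section \<open>Densities from \<open>L\<^sup>2\<close> bounds on approximations\<close>

text \<open>Two constraints compete. The cost \<Lambda> must stay below t = \<gamma> b, so close to
  t = 1 almost no tangency is affordable, while for larger t several partners are. On the other
  side, fixing m digits leaves an unknown tail of size \<gamma>^m / (1 - \<gamma>) in the
  difference, but only (\<gamma>/b)^m / (1 - \<gamma>/b) in its derivative. The first says little
  for \<gamma> near 1, the second is smaller by powers of b. Hence for large t tangency is
  controlled by the derivative alone: partners are digits whose cosines nearly agree, typically
  mirror images under y -> -y mod 1, and they are counted or shown to recur rarely. For t near 1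
  both components are confronted with their tails and tangency is excluded. Base 2 is the hardest:
  \<gamma> / (1 - \<gamma>) > 1 from the start, so up to five digits are followed there. The
  thresholds sqrt 2, golden ratio, plastic number and roots of 2 are the values of \<Lambda> that a
  given pattern of returns to tangency permits; the break points of the case distinctions are mostly
  such thresholds, rounded so that neighbouring cases meet.\<close>

lemma liminf_add_ge_ennreal:
  fixes u v :: "nat \<Rightarrow> ennreal"
  shows "liminf u + liminf v \<le> liminf (\<lambda>n. u n + v n)"
proof -
  have "liminf u + liminf v = (SUP n. (INF m\<in>{n..}. u m) + (INF m\<in>{n..}. v m))"
    unfolding liminf_SUP_INF
    by (rule ennreal_SUP_add[symmetric]) (auto simp: incseq_def intro!: INF_superset_mono)
  also have "\<dots> \<le> liminf (\<lambda>n. u n + v n)"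
    unfolding liminf_SUP_INF by (intro SUP_mono' INF_greatest add_mono INF_lower)
  finally show ?thesis .
qed

lemma liminf_cmult_ge_ennreal:
  fixes u :: "nat \<Rightarrow> ennreal"
  shows "c * liminf u \<le> liminf (\<lambda>n. c * u n)"
  unfolding liminf_SUP_INF SUP_mult_left_ennreal
  by (intro SUP_mono' INF_greatest mult_left_mono INF_lower) auto

lemma liminf_sum_cmult_ge_ennreal:
  fixes u :: "'i \<Rightarrow> nat \<Rightarrow> ennreal"
  assumes "finite I"
  shows "(\<Sum>i\<in>I. c i * liminf (u i)) \<le> liminf (\<lambda>n. \<Sum>i\<in>I. c i * u i n)"
  using assms
proof (induction I)
  case (insert i I)
  have "(\<Sum>i\<in>insert i I. c i * liminf (u i)) = c i * liminf (u i) + (\<Sum>i\<in>I. c i * liminf (u i))"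
    using insert by simp
  also have "\<dots> \<le> liminf (\<lambda>n. c i * u i n) + liminf (\<lambda>n. \<Sum>i\<in>I. c i * u i n)"
    by (intro add_mono insert liminf_cmult_ge_ennreal)
  also have "\<dots> \<le> liminf (\<lambda>n. c i * u i n + (\<Sum>i\<in>I. c i * u i n))"
    by (rule liminf_add_ge_ennreal)
  finally show ?case using insert by simp
qed simp

lemma two_mult_le_ennreal:
  "ennreal (2 * (a * b)) \<le> ennreal (a\<^sup>2) + ennreal (b\<^sup>2)"
proof -
  have "ennreal (2 * (a * b)) \<le> ennreal (a\<^sup>2 + b\<^sup>2)"
    using sum_squares_bound[of a b] by (intro ennreal_leI) (simp add: mult.assoc)
  then show ?thesis by simp
qed

text \<open>A weak form of weak compactness of balls in \<open>L\<^sup>2\<close>: the bound is carried over by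
  testing against step functions on open sets and \<open>2ab \<le> a\<^sup>2 + b\<^sup>2\<close>.\<close>
theorem density_of_L2_approximation:
  fixes \<mu> :: "'a::euclidean_space measure" and f :: "nat \<Rightarrow> 'a \<Rightarrow> real"
  assumes fin: "finite_measure \<mu>" and sets: "sets \<mu> = sets borel"
    and f[measurable]: "\<And>n. f n \<in> borel_measurable borel" and f0: "\<And>n x. 0 \<le> f n x"
    and C: "0 \<le> C" and L2: "\<And>n. (\<integral>\<^sup>+x. ennreal ((f n x)\<^sup>2) \<partial>lborel) \<le> ennreal C"
    and lim: "\<And>U. open U \<Longrightarrow> emeasure \<mu> U \<le> liminf (\<lambda>n. \<integral>\<^sup>+x. indicator U x * ennreal (f n x) \<partial>lborel)"
  shows "\<exists>g. g \<in> borel_measurable borel \<and> (\<forall>x. 0 \<le> g x) \<and>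
           (\<integral>\<^sup>+x. ennreal ((g x)\<^sup>2) \<partial>lborel) \<le> ennreal C \<and> \<mu> = density lborel (\<lambda>x. ennreal (g x))"
proof -
  interpret finite_measure \<mu> by fact
  have space: "space \<mu> = UNIV" using sets_eq_imp_space_eq[OF sets] by simp
  \<comment> \<open>Only open sets carry the hypothesis \<open>lim\<close>. Bounding the product 2
    \<phi> f_n by \<phi>^2 + f_n^2 leaves the constant \<open>C\<close> where the unknown limit
    would stand.\<close>
  have open_bound: "2 * (\<Sum>i\<in>I. ennreal (c i) * emeasure \<mu> (U i))
      \<le> (\<integral>\<^sup>+x. ennreal ((\<Sum>i\<in>I. c i * indicator (U i) x)\<^sup>2) \<partial>lborel) + ennreal C"
    if I: "finite I" and U: "\<And>i. i \<in> I \<Longrightarrow> open (U i)" and c: "\<And>i. i \<in> I \<Longrightarrow> 0 \<le> c i"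
    for I :: "'i set" and U c
  proof -
    define \<phi> where "\<phi> x = (\<Sum>i\<in>I. c i * indicator (U i) x)" for x :: 'a
    have Um[measurable]: "i \<in> I \<Longrightarrow> U i \<in> sets borel" for i using U by auto
    have \<phi>m[measurable]: "\<phi> \<in> borel_measurable borel" unfolding \<phi>_def
      by (intro borel_measurable_sum borel_measurable_times borel_measurable_const borel_measurable_indicator) auto
    have \<phi>0: "0 \<le> \<phi> x" for x unfolding \<phi>_def using c by (auto intro!: sum_nonneg)
    have "2 * (\<Sum>i\<in>I. ennreal (c i) * emeasure \<mu> (U i))
      \<le> 2 * (\<Sum>i\<in>I. ennreal (c i) * liminf (\<lambda>n. \<integral>\<^sup>+x. indicator (U i) x * ennreal (f n x) \<partial>lborel))"
      using lim U by (intro mult_left_mono sum_mono) auto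
    also have "\<dots> \<le> 2 * liminf (\<lambda>n. \<Sum>i\<in>I. ennreal (c i) * (\<integral>\<^sup>+x. indicator (U i) x * ennreal (f n x) \<partial>lborel))"
      by (intro mult_left_mono liminf_sum_cmult_ge_ennreal I) auto
    also have "(\<lambda>n. \<Sum>i\<in>I. ennreal (c i) * (\<integral>\<^sup>+x. indicator (U i) x * ennreal (f n x) \<partial>lborel))
       = (\<lambda>n. \<integral>\<^sup>+x. ennreal (\<phi> x * f n x) \<partial>lborel)"
    proof
      fix n
      have "(\<Sum>i\<in>I. ennreal (c i) * (\<integral>\<^sup>+x. indicator (U i) x * ennreal (f n x) \<partial>lborel))
         = (\<Sum>i\<in>I. \<integral>\<^sup>+x. ennreal (c i) * (indicator (U i) x * ennreal (f n x)) \<partial>lborel)"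
        by (intro sum.cong refl nn_integral_cmult[symmetric]) (auto intro!: borel_measurable_times_ennreal)
      also have "\<dots> = (\<integral>\<^sup>+x. (\<Sum>i\<in>I. ennreal (c i) * (indicator (U i) x * ennreal (f n x))) \<partial>lborel)"
        by (intro nn_integral_sum[symmetric]) auto
      also have "\<dots> = (\<integral>\<^sup>+x. ennreal (\<phi> x * f n x) \<partial>lborel)"
      proof (intro nn_integral_cong)
        fix x
        have "(\<Sum>i\<in>I. ennreal (c i) * (indicator (U i) x * ennreal (f n x)))
           = (\<Sum>i\<in>I. ennreal (c i * indicator (U i) x * f n x))"
          using c f0 by (intro sum.cong refl) (auto simp: indicator_def ennreal_mult)
        also have "\<dots> = ennreal (\<Sum>i\<in>I. c i * indicator (U i) x * f n x)"
          using c f0 by (intro sum_ennreal) auto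
        finally show "(\<Sum>i\<in>I. ennreal (c i) * (indicator (U i) x * ennreal (f n x))) = ennreal (\<phi> x * f n x)"
          by (simp add: \<phi>_def sum_distrib_right)
      qed
      finally show "(\<Sum>i\<in>I. ennreal (c i) * (\<integral>\<^sup>+x. indicator (U i) x * ennreal (f n x) \<partial>lborel))
         = (\<integral>\<^sup>+x. ennreal (\<phi> x * f n x) \<partial>lborel)" .
    qed
    also have "2 * liminf (\<lambda>n. \<integral>\<^sup>+x. ennreal (\<phi> x * f n x) \<partial>lborel)
       \<le> liminf (\<lambda>n. 2 * (\<integral>\<^sup>+x. ennreal (\<phi> x * f n x) \<partial>lborel))"
      by (rule liminf_cmult_ge_ennreal)
    also have "\<dots> \<le> liminf (\<lambda>n. (\<integral>\<^sup>+x. ennreal ((\<phi> x)\<^sup>2) \<partial>lborel) + ennreal C)"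
    proof (intro Liminf_mono always_eventually allI)
      fix n
      have "2 * (\<integral>\<^sup>+x. ennreal (\<phi> x * f n x) \<partial>lborel) = (\<integral>\<^sup>+x. 2 * ennreal (\<phi> x * f n x) \<partial>lborel)"
        by (rule nn_integral_cmult[symmetric]) simp
      also have "\<dots> = (\<integral>\<^sup>+x. ennreal (2 * (\<phi> x * f n x)) \<partial>lborel)"
        using \<phi>0 f0 by (intro nn_integral_cong) (simp add: ennreal_mult)
      also have "\<dots> \<le> (\<integral>\<^sup>+x. ennreal ((\<phi> x)\<^sup>2) + ennreal ((f n x)\<^sup>2) \<partial>lborel)"
        by (intro nn_integral_mono two_mult_le_ennreal)
      also have "\<dots> = (\<integral>\<^sup>+x. ennreal ((\<phi> x)\<^sup>2) \<partial>lborel) + (\<integral>\<^sup>+x. ennreal ((f n x)\<^sup>2) \<partial>lborel)"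
        by (rule nn_integral_add) auto
      also have "\<dots> \<le> (\<integral>\<^sup>+x. ennreal ((\<phi> x)\<^sup>2) \<partial>lborel) + ennreal C"
        by (intro add_mono L2 order_refl)
      finally show "2 * (\<integral>\<^sup>+x. ennreal (\<phi> x * f n x) \<partial>lborel) \<le> (\<integral>\<^sup>+x. ennreal ((\<phi> x)\<^sup>2) \<partial>lborel) + ennreal C" .
    qed
    also have "\<dots> = (\<integral>\<^sup>+x. ennreal ((\<phi> x)\<^sup>2) \<partial>lborel) + ennreal C"
      by (simp add: Liminf_const)
    finally show ?thesis by (simp add: \<phi>_def)
  qed

  \<comment> \<open>Outer regularity passes from open sets to Borel sets of finite Lebesgue measure;
    every overlap grows by at most \<open>2 * \<eta>\<close>, so \<open>s * \<eta>\<close> bounds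
    the total error.\<close>
  have meas_bound: "2 * (\<Sum>i\<in>I. c i * measure \<mu> (B i))
      \<le> (\<Sum>i\<in>I. \<Sum>j\<in>I. c i * c j * measure lborel (B i \<inter> B j)) + C"
    if I: "finite I" and B: "\<And>i. i \<in> I \<Longrightarrow> B i \<in> sets borel" and Bfin: "\<And>i. i \<in> I \<Longrightarrow> emeasure lborel (B i) < \<infinity>"
      and c: "\<And>i. i \<in> I \<Longrightarrow> 0 \<le> c i"
    for I :: "'i set" and B :: "'i \<Rightarrow> 'a set" and c :: "'i \<Rightarrow> real"
  proof (rule field_le_epsilon)
    fix e :: real assume e: "0 < e"
    define s where "s = (\<Sum>i\<in>I. \<Sum>j\<in>I. c i * c j * 2)"
    have s0: "0 \<le> s" unfolding s_def using c by (intro sum_nonneg) auto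
    define \<eta> where "\<eta> = e / (s + 1)"
    have \<eta>: "0 < \<eta>" using e s0 by (simp add: \<eta>_def)
    have "\<exists>U. open U \<and> B i \<subseteq> U \<and> emeasure lborel (U - B i) < ennreal \<eta>" if "i \<in> I" for i
      using outer_regular_lborel[OF B[OF that] \<eta>] by metis
    then obtain U where U: "\<And>i. i \<in> I \<Longrightarrow> open (U i)" "\<And>i. i \<in> I \<Longrightarrow> B i \<subseteq> U i"
       "\<And>i. i \<in> I \<Longrightarrow> emeasure lborel (U i - B i) < ennreal \<eta>" by metis
    have Ub: "U i \<in> sets borel" if "i \<in> I" for i using U(1)[OF that] by auto
    have Ud: "emeasure lborel (U i - B i) < \<top>" if "i \<in> I" for i
      using U(3)[OF that] by (rule less_trans) simp
    have Ufin: "emeasure lborel (U i) < \<infinity>" if "i \<in> I" for i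
    proof -
      have "emeasure lborel (U i) \<le> emeasure lborel (B i) + emeasure lborel (U i - B i)"
        using U(2)[OF that] B[OF that] Ub[OF that]
        by (intro order_trans[OF emeasure_mono emeasure_subadditive]) auto
      also have "\<dots> < \<infinity>" using Bfin[OF that] U(3)[OF that] by (simp add: less_top order_less_trans[OF _ ennreal_less_top])
      finally show ?thesis .
    qed
    have inter: "measure lborel (U i \<inter> U j) \<le> measure lborel (B i \<inter> B j) + 2 * \<eta>" if ij: "i \<in> I" "j \<in> I" for i j
    proof -
      have fm: "B i \<inter> B j \<in> fmeasurable lborel" "U i - B i \<in> fmeasurable lborel" "U j - B j \<in> fmeasurable lborel"
        using B ij Ub Bfin Ud unfolding fmeasurable_def
        by (auto intro: le_less_trans[OF emeasure_mono])
      have d: "measure lborel (U i - B i) \<le> \<eta>" if "i \<in> I" for i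
        using U(3)[OF that] \<eta> unfolding measure_def by (metis enn2real_leI less_imp_le)
      have "measure lborel (U i \<inter> U j) \<le> measure lborel ((B i \<inter> B j) \<union> ((U i - B i) \<union> (U j - B j)))"
        using fm Ub ij by (intro measure_mono_fmeasurable) (auto intro!: fmeasurable.Un)
      also have "\<dots> \<le> measure lborel (B i \<inter> B j) + measure lborel ((U i - B i) \<union> (U j - B j))"
        using fm(1) fm(2,3)[THEN fmeasurableD] by (intro measure_Un_le) auto
      also have "measure lborel ((U i - B i) \<union> (U j - B j)) \<le> measure lborel (U i - B i) + measure lborel (U j - B j)"
        using fm(1) fm(2,3)[THEN fmeasurableD] by (intro measure_Un_le) auto
      finally show ?thesis using d[OF ij(1)] d[OF ij(2)] by linarith
    qed
    have sq: "(\<integral>\<^sup>+x. ennreal ((\<Sum>i\<in>I. c i * indicator (U i) x)\<^sup>2) \<partial>lborel)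
        = ennreal (\<Sum>i\<in>I. \<Sum>j\<in>I. c i * c j * measure lborel (U i \<inter> U j))"
    proof -
      have "(\<integral>\<^sup>+x. ennreal ((\<Sum>i\<in>I. c i * indicator (U i) x)\<^sup>2) \<partial>lborel)
         = (\<integral>\<^sup>+x. (\<Sum>i\<in>I. \<Sum>j\<in>I. ennreal (c i * c j) * indicator (U i \<inter> U j) x) \<partial>lborel)"
      proof (intro nn_integral_cong)
        fix x :: 'a
        have "(\<Sum>i\<in>I. c i * indicator (U i) x)\<^sup>2 = (\<Sum>i\<in>I. \<Sum>j\<in>I. c i * c j * indicator (U i \<inter> U j) x)"
          unfolding power2_eq_square sum_product by (intro sum.cong refl) (auto simp: indicator_def)
        also have "ennreal \<dots> = (\<Sum>i\<in>I. \<Sum>j\<in>I. ennreal (c i * c j * indicator (U i \<inter> U j) x))"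
          using c by (subst sum_ennreal[symmetric] | intro sum.cong refl sum_nonneg mult_nonneg_nonneg)+ auto
        also have "\<dots> = (\<Sum>i\<in>I. \<Sum>j\<in>I. ennreal (c i * c j) * indicator (U i \<inter> U j) x)"
          using c by (intro sum.cong refl) (auto simp: indicator_def)
        finally show "ennreal ((\<Sum>i\<in>I. c i * indicator (U i) x)\<^sup>2) = (\<Sum>i\<in>I. \<Sum>j\<in>I. ennreal (c i * c j) * indicator (U i \<inter> U j) x)" .
      qed
      also have "\<dots> = (\<Sum>i\<in>I. \<Sum>j\<in>I. ennreal (c i * c j) * emeasure lborel (U i \<inter> U j))"
        using Ub by (simp add: nn_integral_sum nn_integral_cmult_indicator sets.Int)
      also have "\<dots> = (\<Sum>i\<in>I. \<Sum>j\<in>I. ennreal (c i * c j * measure lborel (U i \<inter> U j)))"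
      proof (intro sum.cong refl)
        fix i j assume ij: "i \<in> I" "j \<in> I"
        have "emeasure lborel (U i \<inter> U j) \<noteq> \<infinity>"
          using Ufin[OF ij(1)] emeasure_mono[of "U i \<inter> U j" "U i" lborel] Ub ij by (auto simp: top_unique)
        then show "ennreal (c i * c j) * emeasure lborel (U i \<inter> U j) = ennreal (c i * c j * measure lborel (U i \<inter> U j))"
          using c ij by (simp add: emeasure_eq_ennreal_measure ennreal_mult)
      qed
      also have "\<dots> = ennreal (\<Sum>i\<in>I. \<Sum>j\<in>I. c i * c j * measure lborel (U i \<inter> U j))"
        using c by (subst sum_ennreal[symmetric] | intro sum.cong refl sum_nonneg mult_nonneg_nonneg)+ auto
      finally show ?thesis .
    qed
    have "ennreal (2 * (\<Sum>i\<in>I. c i * measure \<mu> (U i))) = 2 * (\<Sum>i\<in>I. ennreal (c i) * emeasure \<mu> (U i))"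
    proof -
      have "(\<Sum>i\<in>I. ennreal (c i) * emeasure \<mu> (U i)) = ennreal (\<Sum>i\<in>I. c i * measure \<mu> (U i))"
        using c by (subst sum_ennreal[symmetric]) (auto simp: emeasure_eq_measure ennreal_mult intro!: sum.cong)
      then show ?thesis using c by (simp add: ennreal_mult sum_nonneg)
    qed
    also have "\<dots> \<le> ennreal (\<Sum>i\<in>I. \<Sum>j\<in>I. c i * c j * measure lborel (U i \<inter> U j)) + ennreal (C)"
      using open_bound[of I U c, OF I] U(1) c sq by simp
    also have "\<dots> = ennreal ((\<Sum>i\<in>I. \<Sum>j\<in>I. c i * c j * measure lborel (U i \<inter> U j)) + C)"
      using c C by (intro ennreal_plus[symmetric] sum_nonneg mult_nonneg_nonneg) auto
    finally have "2 * (\<Sum>i\<in>I. c i * measure \<mu> (U i)) \<le> (\<Sum>i\<in>I. \<Sum>j\<in>I. c i * c j * measure lborel (U i \<inter> U j)) + C"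
      using c C by (subst (asm) ennreal_le_iff) (auto intro!: add_nonneg_nonneg sum_nonneg)
    moreover have "(\<Sum>i\<in>I. c i * measure \<mu> (B i)) \<le> (\<Sum>i\<in>I. c i * measure \<mu> (U i))"
      using c U(2) Ub by (intro sum_mono mult_left_mono finite_measure_mono) (auto simp: sets)
    moreover have "(\<Sum>i\<in>I. \<Sum>j\<in>I. c i * c j * measure lborel (U i \<inter> U j))
       \<le> (\<Sum>i\<in>I. \<Sum>j\<in>I. c i * c j * (measure lborel (B i \<inter> B j) + 2 * \<eta>))"
      using c inter by (intro sum_mono mult_left_mono) auto
    moreover have "\<dots> = (\<Sum>i\<in>I. \<Sum>j\<in>I. c i * c j * measure lborel (B i \<inter> B j)) + s * \<eta>"
      by (simp add: s_def distrib_left sum.distrib sum_distrib_right mult.assoc)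
    moreover have "s * \<eta> \<le> e" using s0 e by (simp add: \<eta>_def field_simps)
    ultimately show "2 * (\<Sum>i\<in>I. c i * measure \<mu> (B i))
      \<le> (\<Sum>i\<in>I. \<Sum>j\<in>I. c i * c j * measure lborel (B i \<inter> B j)) + C + e" by linarith
  qed

  have ac: "absolutely_continuous lborel \<mu>"
    unfolding absolutely_continuous_def
  proof
    fix N :: "'a set" assume N: "N \<in> null_sets lborel"
    \<comment> \<open>On a null set the quadratic term vanishes while \<open>c\<close> is arbitrary,
      which forces \<open>measure \<mu> N\<close> to be 0.\<close>
    have le: "2 * (c * measure \<mu> N) \<le> C" if "0 \<le> c" for c
      using meas_bound[of "{()}" "\<lambda>_. N" "\<lambda>_. c"] N that by (auto simp: null_sets_def measure_def)
    have "measure \<mu> N \<le> 0"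
    proof (rule ccontr)
      assume "\<not> measure \<mu> N \<le> 0"
      then have "C + 1 \<le> 0 + C" using C le[of "(C + 1) / (2 * measure \<mu> N)"] by (simp add: field_simps)
      then show False by simp
    qed
    then have "emeasure \<mu> N = 0" by (simp add: emeasure_eq_measure measure_le_0_iff)
    then show "N \<in> null_sets \<mu>" using N sets by (auto simp: null_sets_def)
  qed
  have "\<exists>h\<in>borel_measurable lborel. density lborel h = \<mu>"
    using sigma_finite_measure.Radon_Nikodym[OF sigma_finite_lborel ac] sets by auto
  then obtain h where h[measurable]: "h \<in> borel_measurable borel" and dens: "density lborel h = \<mu>" by auto
  have h_fin: "AE x in lborel. h x \<noteq> \<infinity>"
  proof (rule nn_integral_PInf_AE)
    have "(\<integral>\<^sup>+x. h x \<partial>lborel) = emeasure (density lborel h) UNIV" by (subst emeasure_density) auto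
    then show "(\<integral>\<^sup>+x. h x \<partial>lborel) \<noteq> \<infinity>" unfolding dens by simp
  qed simp
  define g where "g x = enn2real (h x)" for x
  have g[measurable]: "g \<in> borel_measurable borel" unfolding g_def by measurable
  have g0: "0 \<le> g x" for x by (simp add: g_def)
  have dens': "\<mu> = density lborel (\<lambda>x. ennreal (g x))"
    unfolding dens[symmetric] using h_fin
    by (intro density_cong) (auto simp: g_def elim!: eventually_mono intro!: ennreal_enn2real[symmetric] simp: less_top)
  obtain u where u: "incseq u" "\<And>i x. u i x < top" "\<And>i. simple_function borel (u i)"
     "\<And>x. (SUP i. u i x) = ennreal (g x)"
    by (rule borel_measurable_implies_simple_function_sequence'[of "\<lambda>x. ennreal (g x)" borel]) auto
  define v where "v i x = enn2real (u i x)" for i x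
  have um[measurable]: "u i \<in> borel_measurable borel" for i by (rule borel_measurable_simple_function[OF u(3)])
  have v0: "0 \<le> v i x" for i x by (simp add: v_def)
  have v_le: "v i x \<le> g x" for i x
  proof -
    have "u i x \<le> ennreal (g x)" unfolding u(4)[of x, symmetric] by (rule SUP_upper) simp
    then show ?thesis unfolding v_def using g0 by (simp add: enn2real_leI)
  qed
  have v_u: "ennreal (v i x) = u i x" for i x using u(2)[of i x] by (simp add: v_def)
  \<comment> \<open>Truncation to a ball gives the level sets of \<open>w i\<close> finite Lebesgue
    measure, as \<open>meas_bound\<close> demands.\<close>
  define w where "w i x = v i x * indicator (ball 0 (real i)) x" for i x
  have wm[measurable]: "w i \<in> borel_measurable borel" for i
  proof -
    have "v i \<in> borel_measurable borel" unfolding v_def by measurable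
    then show ?thesis unfolding w_def by (intro borel_measurable_times borel_measurable_indicator) auto
  qed
  have w_bound: "(\<integral>\<^sup>+x. ennreal ((w i x)\<^sup>2) \<partial>lborel) \<le> ennreal C" for i
  proof -
    define I where "I = range (v i)"
    have I: "finite I"
    proof -
      have "I = enn2real ` (u i ` UNIV)" by (auto simp: I_def v_def)
      then show ?thesis using simple_functionD(1)[OF u(3)[of i]] by simp
    qed
    define B where "B y = {x. v i x = y} \<inter> ball 0 (real i)" for y
    have Bm: "B y \<in> sets borel" for y
    proof -
      have "v i \<in> borel_measurable borel" unfolding v_def by measurable
      then have "v i -` {y} \<inter> space borel \<in> sets borel" by (rule measurable_sets) simp
      moreover have "B y = (v i -` {y} \<inter> space borel) \<inter> ball 0 (real i)" by (auto simp: B_def)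
      ultimately show ?thesis by auto
    qed
    have Bf: "emeasure lborel (B y) < \<infinity>" for y
      by (rule le_less_trans[OF emeasure_mono[of _ "ball 0 (real i)"]])
         (auto simp: B_def emeasure_lborel_ball_finite[unfolded infinity_ennreal_def])
    have w_sum: "w i x = (\<Sum>y\<in>I. y * indicator (B y) x)" for x
    proof -
      have "(\<Sum>y\<in>I. y * indicator (B y) x) = (\<Sum>y\<in>{v i x}. y * indicator (B y) x)"
        using I by (intro sum.mono_neutral_right) (auto simp: I_def B_def)
      then show ?thesis by (simp add: w_def B_def indicator_def)
    qed
    have int_sum: "(\<integral>\<^sup>+x. ennreal (w i x) * indicator (A) x \<partial>M) = ennreal (\<Sum>y\<in>I. y * measure M (B y \<inter> A))"
      if "sets M = sets borel" "\<And>y. emeasure M (B y) < \<infinity>" "A \<in> sets borel" for M A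
    proof -
      have "(\<integral>\<^sup>+x. ennreal (w i x) * indicator A x \<partial>M) = (\<integral>\<^sup>+x. (\<Sum>y\<in>I. ennreal y * indicator (B y \<inter> A) x) \<partial>M)"
      proof (intro nn_integral_cong)
        fix x
        have "ennreal (w i x) = (\<Sum>y\<in>I. ennreal (y * indicator (B y) x))"
          unfolding w_sum by (intro sum_ennreal[symmetric]) (auto simp: I_def v0)
        then show "ennreal (w i x) * indicator A x = (\<Sum>y\<in>I. ennreal y * indicator (B y \<inter> A) x)"
          by (auto simp: sum_distrib_right indicator_def intro!: sum.cong)
      qed
      also have "\<dots> = (\<Sum>y\<in>I. ennreal y * emeasure M (B y \<inter> A))"
        using Bm that by (subst nn_integral_sum) (auto simp: nn_integral_cmult_indicator)
      also have "\<dots> = (\<Sum>y\<in>I. ennreal (y * measure M (B y \<inter> A)))"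
      proof (intro sum.cong refl)
        fix y assume y: "y \<in> I"
        have "emeasure M (B y \<inter> A) \<noteq> \<infinity>"
          using le_less_trans[OF emeasure_mono[of "B y \<inter> A" "B y" M] that(2)[of y]] Bm[of y] that(1) by simp
        then show "ennreal y * emeasure M (B y \<inter> A) = ennreal (y * measure M (B y \<inter> A))"
          using y v0 by (auto simp: emeasure_eq_ennreal_measure ennreal_mult I_def)
      qed
      also have "\<dots> = ennreal (\<Sum>y\<in>I. y * measure M (B y \<inter> A))"
        by (intro sum_ennreal) (auto simp: I_def v0)
      finally show ?thesis .
    qed
    define q where "q = (\<Sum>y\<in>I. \<Sum>z\<in>I. y * z * measure lborel (B y \<inter> B z))"
    have q_sq: "(\<integral>\<^sup>+x. ennreal ((w i x)\<^sup>2) \<partial>lborel) = ennreal q"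
    proof -
      have "(\<integral>\<^sup>+x. ennreal ((w i x)\<^sup>2) \<partial>lborel) = (\<integral>\<^sup>+x. (\<Sum>z\<in>I. ennreal z * (ennreal (w i x) * indicator (B z) x)) \<partial>lborel)"
      proof (intro nn_integral_cong)
        fix x :: 'a
        have "(w i x)\<^sup>2 = (\<Sum>z\<in>I. z * (w i x * indicator (B z) x))"
          unfolding power2_eq_square by (subst (1) w_sum) (simp add: sum_distrib_left sum_distrib_right mult_ac)
        also have "ennreal \<dots> = (\<Sum>z\<in>I. ennreal (z * (w i x * indicator (B z) x)))"
          by (intro sum_ennreal[symmetric]) (auto simp: I_def v0 w_def)
        also have "\<dots> = (\<Sum>z\<in>I. ennreal z * (ennreal (w i x) * indicator (B z) x))"
          by (intro sum.cong refl) (auto simp: ennreal_mult I_def v0 w_def indicator_def)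
        finally show "ennreal ((w i x)\<^sup>2) = (\<Sum>z\<in>I. ennreal z * (ennreal (w i x) * indicator (B z) x))" .
      qed
      also have "\<dots> = (\<Sum>z\<in>I. ennreal z * (\<integral>\<^sup>+x. ennreal (w i x) * indicator (B z) x \<partial>lborel))"
        using Bm by (subst nn_integral_sum) (auto simp: nn_integral_cmult)
      also have "\<dots> = (\<Sum>z\<in>I. ennreal z * ennreal (\<Sum>y\<in>I. y * measure lborel (B y \<inter> B z)))"
        using Bf Bm by (subst int_sum) auto
      also have "\<dots> = (\<Sum>z\<in>I. ennreal (z * (\<Sum>y\<in>I. y * measure lborel (B y \<inter> B z))))"
        by (intro sum.cong refl ennreal_mult[symmetric] sum_nonneg) (auto simp: I_def v0)
      also have "\<dots> = ennreal (\<Sum>z\<in>I. z * (\<Sum>y\<in>I. y * measure lborel (B y \<inter> B z)))"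
        by (intro sum_ennreal mult_nonneg_nonneg sum_nonneg) (auto simp: I_def v0)
      also have "(\<Sum>z\<in>I. z * (\<Sum>y\<in>I. y * measure lborel (B y \<inter> B z))) = q"
        unfolding q_def sum_distrib_left by (subst sum.swap) (simp add: mult_ac)
      finally show ?thesis .
    qed
    have q0: "0 \<le> q" unfolding q_def by (intro sum_nonneg mult_nonneg_nonneg) (auto simp: I_def v0)
    define p where "p = (\<Sum>y\<in>I. y * measure \<mu> (B y))"
    \<comment> \<open>\<open>q\<close> is the integral of the square of \<open>w i\<close>,
      \<open>p\<close> its integral against \<mu>. From w \<le> g follows q \<le> p, and
      \<open>meas_bound\<close> gives 2 p \<le> q + C; together q \<le> C, without knowing
      beforehand that g is square integrable.\<close>
    have "ennreal q \<le> (\<integral>\<^sup>+x. ennreal (g x) * ennreal (w i x) \<partial>lborel)"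
      unfolding q_sq[symmetric]
    proof (intro nn_integral_mono)
      fix x
      have "w i x \<le> g x" using v_le[of i x] g0[of x] by (auto simp: w_def indicator_def)
      then have "(w i x)\<^sup>2 \<le> g x * w i x" unfolding power2_eq_square
        by (intro mult_right_mono) (auto simp: w_def v0)
      then show "ennreal ((w i x)\<^sup>2) \<le> ennreal (g x) * ennreal (w i x)"
        using g0 by (simp add: ennreal_mult[symmetric] w_def v0 ennreal_leI)
    qed
    also have "\<dots> = (\<integral>\<^sup>+x. ennreal (w i x) * indicator UNIV x \<partial>\<mu>)"
      unfolding dens' by (subst nn_integral_density) auto
    also have "\<dots> = ennreal p"
      using int_sum[of \<mu> UNIV] sets by (simp add: p_def less_top[symmetric])
    finally have "ennreal q \<le> ennreal p" .
    moreover have "0 \<le> p" unfolding p_def by (intro sum_nonneg mult_nonneg_nonneg) (auto simp: I_def v0)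
    ultimately have "q \<le> p" by (simp add: ennreal_le_iff)
    moreover have "2 * p \<le> q + C" unfolding p_def q_def
      by (rule meas_bound[OF I Bm Bf]) (auto simp: I_def v0)
    ultimately have "q \<le> C" by simp
    then have "ennreal q \<le> ennreal (C)" by (rule ennreal_leI)
    then show ?thesis unfolding q_sq .
  qed
  have "(\<integral>\<^sup>+x. ennreal ((g x)\<^sup>2) \<partial>lborel) \<le> (\<integral>\<^sup>+x. liminf (\<lambda>i. ennreal ((w i x)\<^sup>2)) \<partial>lborel)"
  proof (intro nn_integral_mono)
    fix x :: 'a
    have "(\<lambda>i. u i x) \<longlonglongrightarrow> (SUP i. u i x)"
      using u(1) by (intro LIMSEQ_SUP) (auto simp: incseq_def le_fun_def)
    then have "(\<lambda>i. ennreal (v i x)) \<longlonglongrightarrow> ennreal (g x)" by (simp add: v_u u(4))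
    then have "(\<lambda>i. v i x) \<longlonglongrightarrow> g x" using v0 g0 by (simp add: tendsto_ennreal_iff)
    moreover have "\<forall>\<^sub>F i in sequentially. v i x = w i x"
    proof -
      obtain k :: nat where "norm x < real k" using reals_Archimedean2 by blast
      then show ?thesis unfolding eventually_sequentially
        by (intro exI[of _ k]) (auto simp: w_def)
    qed
    ultimately have "(\<lambda>i. w i x) \<longlonglongrightarrow> g x" by (rule Lim_transform_eventually)
    then have "(\<lambda>i. ennreal ((w i x)\<^sup>2)) \<longlonglongrightarrow> ennreal ((g x)\<^sup>2)"
      by (intro tendsto_ennrealI tendsto_power)
    then show "ennreal ((g x)\<^sup>2) \<le> liminf (\<lambda>i. ennreal ((w i x)\<^sup>2))"
      using lim_imp_Liminf[of sequentially] by fastforce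
  qed
  also have "\<dots> \<le> liminf (\<lambda>i. \<integral>\<^sup>+x. ennreal ((w i x)\<^sup>2) \<partial>lborel)"
    by (intro nn_integral_liminf) simp
  also have "\<dots> \<le> liminf (\<lambda>i. ennreal C)"
    by (intro Liminf_mono always_eventually allI w_bound)
  also have "\<dots> = ennreal C" by (simp add: Liminf_const)
  finally have "(\<integral>\<^sup>+x. ennreal ((g x)\<^sup>2) \<partial>lborel) \<le> ennreal C" .
  then show ?thesis using g g0 dens' by blast
qed

section \<open>The energy estimate\<close>

text \<open>The digits \<open>i\<^sub>1, i\<^sub>2, \<dots>\<close> are encoded in the single number \<open>j = i\<^sub>1 + i\<^sub>2 b + \<dots>\<close>.\<close>
definition Sfin :: "nat \<Rightarrow> real \<Rightarrow> nat \<Rightarrow> real \<Rightarrow> nat \<Rightarrow> real" where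
  "Sfin b \<gamma> N x j = (\<Sum>n<N. \<gamma> ^ n * psi ((x + real j) / real b ^ Suc n))"

text \<open>The point masses at \<open>s j\<close> are smeared over intervals of length
  \<open>r\<close>; for finite nonempty \<open>A\<close>, division by \<open>r\<close> times the
  number of points gives a probability density.\<close>

definition cover :: "(nat \<Rightarrow> real) \<Rightarrow> real \<Rightarrow> nat set \<Rightarrow> real \<Rightarrow> real" where
  "cover s r A y = (\<Sum>j\<in>A. indicator {s j..s j + r} y)"

text \<open>For \<open>A = B\<close> this is the squared L2 norm of \<open>cover\<close>; the mixed
  terms allow a split by first digits.\<close>

definition energy :: "(nat \<Rightarrow> real) \<Rightarrow> real \<Rightarrow> nat set \<Rightarrow> nat set \<Rightarrow> ennreal" where
  "energy s r A B = (\<integral>\<^sup>+y. ennreal (cover s r A y * cover s r B y) \<partial>lborel)"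

text \<open>Up to constant factors these are the difference of two truncated sums (lemma \<open>Sfin_diff\<close>) and its
  derivative in \<open>x\<close>, with the sines and cosines combined by the sum-to-product formulas.\<close>
definition sine_diff :: "nat \<Rightarrow> real \<Rightarrow> nat \<Rightarrow> real \<Rightarrow> nat \<Rightarrow> nat \<Rightarrow> real" where
  "sine_diff b \<gamma> N x j j' = (\<Sum>n<N. \<gamma> ^ n *
     (cos (pi * (2 * x + real j + real j') / real b ^ Suc n) * sin (pi * (real j - real j') / real b ^ Suc n)))"

definition cosine_diff :: "nat \<Rightarrow> real \<Rightarrow> nat \<Rightarrow> real \<Rightarrow> nat \<Rightarrow> nat \<Rightarrow> real" where
  "cosine_diff b \<gamma> N x j j' = (\<Sum>n<N. (\<gamma> / real b) ^ n *
     (sin (pi * (2 * x + real j + real j') / real b ^ Suc n) * sin (pi * (real j - real j') / real b ^ Suc n)))"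

lemma psi_periodic: "psi (y + real n) = psi y"
proof -
  have "sin (2 * pi * (y + real n)) = sin (2 * pi * y + 2 * pi * real n)" by (simp add: algebra_simps)
  moreover have "sin (2 * pi * real n) = 0" "cos (2 * pi * real n) = 1"
    using sin_2npi[of n] cos_2npi[of n] by (simp_all add: mult_ac)
  ultimately show ?thesis by (simp add: psi_def sin_add)
qed

section \<open>Splitting, bounding and rescaling the energy\<close>

lemma cover_nonneg: "0 \<le> cover s r A y"
  by (simp add: cover_def sum_nonneg)

lemma cover_measurable[measurable]: "cover s r A \<in> borel_measurable borel"
  unfolding cover_def by (intro borel_measurable_sum borel_measurable_indicator) auto

lemma energy_sum:
  assumes "finite K" "finite L" "A = (\<Union>k\<in>K. A' k)" "B = (\<Union>l\<in>L. B' l)"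
    and "disjoint_family_on A' K" "disjoint_family_on B' L"
    and "\<And>k. k \<in> K \<Longrightarrow> finite (A' k)" "\<And>l. l \<in> L \<Longrightarrow> finite (B' l)"
  shows "energy s r A B = (\<Sum>k\<in>K. \<Sum>l\<in>L. energy s r (A' k) (B' l))"
proof -
  have A: "cover s r A y = (\<Sum>k\<in>K. cover s r (A' k) y)" for y
    unfolding cover_def assms(3) using assms
    by (intro sum.UNION_disjoint) (auto simp: disjoint_family_on_def)
  have B: "cover s r B y = (\<Sum>l\<in>L. cover s r (B' l) y)" for y
    unfolding cover_def assms(4) using assms
    by (intro sum.UNION_disjoint) (auto simp: disjoint_family_on_def)
  have "energy s r A B = (\<integral>\<^sup>+y. (\<Sum>k\<in>K. \<Sum>l\<in>L. ennreal (cover s r (A' k) y * cover s r (B' l) y)) \<partial>lborel)"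
    unfolding energy_def A B sum_product
    by (simp add: sum_ennreal cover_nonneg sum_nonneg)
  also have "\<dots> = (\<Sum>k\<in>K. \<Sum>l\<in>L. energy s r (A' k) (B' l))"
    unfolding energy_def by (simp add: nn_integral_sum)
  finally show ?thesis .
qed

lemma energy_singleton_le:
  assumes "0 \<le> r"
  shows "energy s r {i} {j} \<le> ennreal r * indicator {d. \<bar>d\<bar> \<le> r} (s i - s j)"
proof -
  have c: "cover s r {i} = indicator {s i..s i + r}" for i by (simp add: cover_def fun_eq_iff)
  have "energy s r {i} {j} \<le> (\<integral>\<^sup>+y. indicator {d. \<bar>d\<bar> \<le> r} (s i - s j) * indicator {s i..s i + r} y \<partial>lborel)"
    unfolding energy_def c by (intro nn_integral_mono) (auto simp: indicator_def)
  also have "\<dots> = ennreal r * indicator {d. \<bar>d\<bar> \<le> r} (s i - s j)"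
    using assms by (subst nn_integral_cmult) (auto simp: mult.commute)
  finally show ?thesis .
qed

lemma energy_le_pairs:
  assumes "0 \<le> r" "finite A" "finite B"
  shows "energy s r A B \<le> (\<Sum>i\<in>A. \<Sum>j\<in>B. ennreal r * indicator {d. \<bar>d\<bar> \<le> r} (s i - s j))"
proof -
  have "energy s r A B = (\<Sum>i\<in>A. \<Sum>j\<in>B. energy s r {i} {j})"
    using assms by (intro energy_sum) (auto simp: disjoint_family_on_def)
  then show ?thesis using energy_singleton_le[OF assms(1)] by (simp add: sum_mono)
qed

text \<open>Pointwise this is the inequality between arithmetic and geometric mean. Unequal weights
  shift the cost of a mixed term from one diagonal term to the other.\<close>

lemma energy_Cauchy_Schwarz:
  assumes "0 \<le> w" "0 \<le> w'" "1 \<le> w * w'"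
  shows "energy s r A B \<le> ennreal (w / 2) * energy s r A A + ennreal (w' / 2) * energy s r B B"
proof -
  have pt: "a * c \<le> w / 2 * (a * a) + w' / 2 * (c * c)" if "0 \<le> a" "0 \<le> c" for a c :: real
  proof -
    have "0 \<le> (sqrt w * a - sqrt w' * c)\<^sup>2" by simp
    also have "\<dots> = w * (a * a) + w' * (c * c) - 2 * (sqrt w * sqrt w') * (a * c)"
      using assms by (simp add: power2_eq_square algebra_simps)
    finally have 1: "2 * (sqrt (w * w')) * (a * c) \<le> w * (a * a) + w' * (c * c)"
      by (simp add: real_sqrt_mult)
    have "1 * (a * c) \<le> sqrt (w * w') * (a * c)"
      using assms that by (intro mult_right_mono) auto
    with 1 show ?thesis by simp
  qed
  have "energy s r A B \<le> (\<integral>\<^sup>+y. ennreal (w / 2) * ennreal (cover s r A y * cover s r A y)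
       + ennreal (w' / 2) * ennreal (cover s r B y * cover s r B y) \<partial>lborel)"
    unfolding energy_def
  proof (intro nn_integral_mono)
    fix y
    have "ennreal (cover s r A y * cover s r B y) \<le> ennreal (w / 2 * (cover s r A y * cover s r A y) + w' / 2 * (cover s r B y * cover s r B y))"
      by (intro ennreal_leI pt cover_nonneg)
    also have "\<dots> = ennreal (w / 2) * ennreal (cover s r A y * cover s r A y)
       + ennreal (w' / 2) * ennreal (cover s r B y * cover s r B y)"
      using assms cover_nonneg ennreal_mult[of "w / 2" "cover s r A y * cover s r A y"]
        ennreal_mult[of "w' / 2" "cover s r B y * cover s r B y"]
      by (subst ennreal_plus) simp_all
    finally show "ennreal (cover s r A y * cover s r B y) \<le> ennreal (w / 2) * ennreal (cover s r A y * cover s r A y)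
       + ennreal (w' / 2) * ennreal (cover s r B y * cover s r B y)" .
  qed
  also have "\<dots> = ennreal (w / 2) * energy s r A A + ennreal (w' / 2) * energy s r B B"
    unfolding energy_def by (subst nn_integral_add) (auto simp: nn_integral_cmult)
  finally show ?thesis .
qed

text \<open>The substitution \<open>a + \<gamma> * y\<close> carries intervals of length
  \<open>r / \<gamma>\<close> to intervals of length \<open>r\<close>; its Jacobian is the factor in
  front.\<close>

lemma energy_affine:
  assumes \<gamma>: "0 < \<gamma>" and inj: "inj_on \<tau> A" and s: "\<And>i. i \<in> A \<Longrightarrow> s (\<tau> i) = a + \<gamma> * s' i"
  shows "energy s r (\<tau> ` A) (\<tau> ` A) = ennreal \<gamma> * energy s' (r / \<gamma>) A A"
proof -
  have c: "cover s r (\<tau> ` A) (a + \<gamma> * y) = cover s' (r / \<gamma>) A y" for y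
    unfolding cover_def sum.reindex[OF inj] o_def
  proof (intro sum.cong refl)
    fix i assume "i \<in> A"
    then show "indicator {s (\<tau> i)..s (\<tau> i) + r} (a + \<gamma> * y) = (indicator {s' i..s' i + r / \<gamma>} y :: real)"
      using \<gamma> by (auto simp: s indicator_def field_simps)
  qed
  have "energy s r (\<tau> ` A) (\<tau> ` A)
     = ennreal \<bar>\<gamma>\<bar> * (\<integral>\<^sup>+y. ennreal (cover s r (\<tau> ` A) (a + \<gamma> * y) * cover s r (\<tau> ` A) (a + \<gamma> * y)) \<partial>lborel)"
    unfolding energy_def using \<gamma> by (intro nn_integral_real_affine) auto
  then show ?thesis using \<gamma> by (simp add: c energy_def)
qed

text \<open>Self-similarity: once the first digit \<open>k\<close> is removed, the remaining digits
  \<open>i\<close> are summed at the preimage \<open>(x + real k) / real b\<close> of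
  \<open>x\<close>. By periodicity the leading term forgets \<open>i\<close>.\<close>

lemma Sfin_Suc:
  assumes b: "0 < b"
  shows "Sfin b \<gamma> (Suc N) x (k + b * i) = psi ((x + real k) / real b) + \<gamma> * Sfin b \<gamma> N ((x + real k) / real b) i"
proof -
  have e: "(x + real (k + b * i)) / real b = (x + real k) / real b + real i" using b by (simp add: field_simps)
  have "Sfin b \<gamma> (Suc N) x (k + b * i) = psi ((x + real (k + b * i)) / real b)
      + (\<Sum>n<N. \<gamma> ^ Suc n * psi ((x + real (k + b * i)) / real b ^ Suc (Suc n)))"
    unfolding Sfin_def by (subst sum.lessThan_Suc_shift) simp
  also have "\<dots> = psi ((x + real k) / real b) + (\<Sum>n<N. \<gamma> * (\<gamma> ^ n * psi (((x + real k) / real b + real i) / real b ^ Suc n)))"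
    unfolding e psi_periodic
  proof (intro arg_cong2[of _ _ _ _ "(+)"] refl sum.cong)
    fix n
    have "(x + real (k + b * i)) / real b ^ Suc (Suc n) = ((x + real k) / real b + real i) / real b ^ Suc n"
      unfolding e[symmetric] by simp
    then show "\<gamma> ^ Suc n * psi ((x + real (k + b * i)) / real b ^ Suc (Suc n)) = \<gamma> * (\<gamma> ^ n * psi (((x + real k) / real b + real i) / real b ^ Suc n))"
      by simp
  qed
  finally show ?thesis by (simp add: Sfin_def sum_distrib_left)
qed

section \<open>Transversality: the difference of two truncated sums and its derivative\<close>

lemma Sfin_diff: "Sfin b \<gamma> N x j - Sfin b \<gamma> N x j' = - 4 * pi * sine_diff b \<gamma> N x j j'"
proof -
  have "\<gamma> ^ n * psi ((x + real j) / real b ^ Suc n) - \<gamma> ^ n * psi ((x + real j') / real b ^ Suc n)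
     = - 4 * pi * (\<gamma> ^ n * (cos (pi * (2 * x + real j + real j') / real b ^ Suc n) * sin (pi * (real j - real j') / real b ^ Suc n)))" for n
  proof -
    define M H where "M = pi * (2 * x + real j + real j') / real b ^ Suc n" and "H = pi * (real j - real j') / real b ^ Suc n"
    have e: "2 * pi * ((x + real j) / real b ^ Suc n) = M + H" "2 * pi * ((x + real j') / real b ^ Suc n) = M - H"
      by (simp_all add: M_def H_def add_divide_distrib diff_divide_distrib algebra_simps)
    show ?thesis unfolding psi_def e M_def[symmetric] H_def[symmetric] by (simp add: sin_add sin_diff algebra_simps)
  qed
  then show ?thesis unfolding Sfin_def sine_diff_def sum_subtractf[symmetric] sum_distrib_left by simp
qed

lemma sine_diff_has_derivative:
  assumes b: "0 < b"
  shows "((\<lambda>x. sine_diff b \<gamma> N x j j') has_real_derivative - (2 * pi / real b) * cosine_diff b \<gamma> N x j j') (at x)"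
proof -
  have t: "((\<lambda>x. \<gamma> ^ n * (cos (pi * (2 * x + real j + real j') / real b ^ Suc n) * H)) has_real_derivative
      - (2 * pi / real b) * ((\<gamma> / real b) ^ n * (sin (pi * (2 * x + real j + real j') / real b ^ Suc n) * H))) (at x)" for n H
    using b by (auto intro!: derivative_eq_intros simp: power_divide)
  show ?thesis unfolding sine_diff_def cosine_diff_def sum_distrib_left by (intro DERIV_sum t)
qed

lemma geometric_sum_le:
  fixes q :: real
  assumes "0 \<le> q" "q < 1"
  shows "(\<Sum>n<N. q ^ n) \<le> 1 / (1 - q)"
  using sum_le_suminf[of "\<lambda>n. q ^ n" "{..<N}"] assms by (simp add: suminf_geometric)

text \<open>The point is uniformity in \<open>N\<close>, \<open>j\<close> and \<open>j'\<close>; the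
  rate \<open>\<gamma> / real b\<close> is generously replaced by \<open>\<gamma>\<close> in the
  geometric series.\<close>

lemma cosine_diff_lipschitz:
  assumes b: "1 \<le> b" and \<gamma>: "0 < \<gamma>" "\<gamma> < 1"
  shows "\<bar>cosine_diff b \<gamma> N x j j' - cosine_diff b \<gamma> N y j j'\<bar> \<le> 2 * pi / (1 - \<gamma>) * \<bar>x - y\<bar>"
proof -
  have t: "\<bar>(\<gamma> / real b) ^ n * (sin (pi * (2 * x + real j + real j') / real b ^ Suc n) * sin (pi * (real j - real j') / real b ^ Suc n))
      - (\<gamma> / real b) ^ n * (sin (pi * (2 * y + real j + real j') / real b ^ Suc n) * sin (pi * (real j - real j') / real b ^ Suc n))\<bar>
      \<le> \<gamma> ^ n * (2 * pi * \<bar>x - y\<bar>)" for n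
  proof -
    define H where "H = sin (pi * (real j - real j') / real b ^ Suc n)"
    define u v where "u = pi * (2 * x + real j + real j') / real b ^ Suc n" and "v = pi * (2 * y + real j + real j') / real b ^ Suc n"
    have bn: "1 \<le> real b ^ m" for m using b by simp
    have "\<bar>sin u - sin v\<bar> \<le> \<bar>u - v\<bar>"
    proof -
      have "sin u - sin v = 2 * sin ((u - v) / 2) * cos ((u + v) / 2)" by (rule sin_diff_sin)
      then have "\<bar>sin u - sin v\<bar> = 2 * \<bar>sin ((u - v) / 2)\<bar> * \<bar>cos ((u + v) / 2)\<bar>" by (simp add: abs_mult)
      also have "\<dots> \<le> 2 * \<bar>(u - v) / 2\<bar> * 1" by (intro mult_mono abs_sin_x_le_abs_x) auto
      finally show ?thesis by simp
    qed
    also have "u - v = 2 * pi * (x - y) / real b ^ Suc n" by (simp add: u_def v_def diff_divide_distrib[symmetric] algebra_simps)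
    also have "\<bar>2 * pi * (x - y) / real b ^ Suc n\<bar> \<le> 2 * pi * \<bar>x - y\<bar>"
    proof -
      have "\<bar>2 * pi * (x - y) / real b ^ Suc n\<bar> = 2 * pi * \<bar>x - y\<bar> / real b ^ Suc n"
        by (simp add: abs_mult)
      also have "\<dots> \<le> 2 * pi * \<bar>x - y\<bar> / 1" using bn[of "Suc n"] by (intro frac_le) auto
      finally show ?thesis by simp
    qed
    finally have 1: "\<bar>sin u - sin v\<bar> \<le> 2 * pi * \<bar>x - y\<bar>" .
    have 2: "(\<gamma> / real b) ^ n \<le> \<gamma> ^ n" using b \<gamma> by (intro power_mono) (auto simp: field_simps)
    have 3: "0 \<le> (\<gamma> / real b) ^ n" using b \<gamma> by simp
    have "\<bar>(\<gamma> / real b) ^ n * (sin u * H) - (\<gamma> / real b) ^ n * (sin v * H)\<bar> = (\<gamma> / real b) ^ n * (\<bar>sin u - sin v\<bar> * \<bar>H\<bar>)"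
      using 3 by (simp add: abs_mult right_diff_distrib[symmetric] left_diff_distrib[symmetric])
    also have "\<dots> \<le> \<gamma> ^ n * (2 * pi * \<bar>x - y\<bar> * 1)"
      using 1 2 3 \<gamma> by (intro mult_mono) (auto simp: H_def)
    finally show ?thesis by (simp add: H_def u_def v_def)
  qed
  have "\<bar>cosine_diff b \<gamma> N x j j' - cosine_diff b \<gamma> N y j j'\<bar> \<le> (\<Sum>n<N. \<gamma> ^ n * (2 * pi * \<bar>x - y\<bar>))"
    unfolding cosine_diff_def sum_subtractf[symmetric] by (intro order_trans[OF sum_abs] sum_mono t)
  also have "\<dots> = (\<Sum>n<N. \<gamma> ^ n) * (2 * pi * \<bar>x - y\<bar>)" by (simp add: sum_distrib_right)
  also have "\<dots> \<le> 1 / (1 - \<gamma>) * (2 * pi * \<bar>x - y\<bar>)" using \<gamma> by (intro mult_right_mono geometric_sum_le) auto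
  finally show ?thesis by (simp add: mult_ac)
qed

text \<open>The interval is cut into \<open>m\<close> cells so short that the derivative varies by
  at most \<open>\<delta> / 2\<close> on each. On a cell that meets \<open>Z\<close> the slope is
  then at least \<open>\<delta> / 2\<close> throughout, and the mean value theorem bounds the
  diameter of \<open>Z\<close> there by \<open>4 * e / \<delta>\<close>.\<close>

lemma emeasure_small_values_le:
  fixes P P' :: "real \<Rightarrow> real"
  assumes der: "\<And>x. (P has_real_derivative P' x) (at x)"
    and lip: "\<And>x y. \<bar>P' x - P' y\<bar> \<le> L * \<bar>x - y\<bar>" and \<delta>: "0 < \<delta>" and m: "0 < m" "2 * L \<le> \<delta> * real m" and L: "0 \<le> L"
    and Z: "Z \<in> sets borel" "Z \<subseteq> {0..<1}" "\<And>x. x \<in> Z \<Longrightarrow> \<bar>P x\<bar> \<le> e" "\<And>x. x \<in> Z \<Longrightarrow> \<delta> \<le> \<bar>P' x\<bar>" and e: "0 \<le> e"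
  shows "emeasure lborel Z \<le> ennreal (real m * (8 * e / \<delta>))"
proof -
  define J where "J q = {real q / real m..<(real q + 1) / real m}" for q
  have cell: "emeasure lborel (Z \<inter> J q) \<le> ennreal (8 * e / \<delta>)" for q
  proof (cases "Z \<inter> J q = {}")
    case False
    then obtain x where x: "x \<in> Z" "x \<in> J q" by auto
    have "\<bar>x - y\<bar> \<le> 4 * e / \<delta>" if y: "y \<in> Z" "y \<in> J q" for y
    proof (cases "x = y")
      case True then show ?thesis using e \<delta> by simp
    next
      case False
      define lo hi where "lo = min x y" and "hi = max x y"
      have lh: "lo < hi" using False by (auto simp: lo_def hi_def)
      obtain z where z: "lo < z" "z < hi" "P hi - P lo = (hi - lo) * P' z"
        using MVT2[OF lh, of P P'] der by auto
      have "hi - lo \<le> 1 / real m" using x y unfolding J_def lo_def hi_def by (auto simp: add_divide_distrib min_def max_def)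
      then have "\<bar>z - lo\<bar> \<le> 1 / real m" using z by auto
      then have "L * \<bar>lo - z\<bar> \<le> L * (1 / real m)" using L by (intro mult_left_mono) auto
      with lip[of lo z] have "\<bar>P' lo - P' z\<bar> \<le> L * (1 / real m)" by linarith
      moreover have "L * (1 / real m) \<le> \<delta> / 2" using m by (simp add: field_simps)
      moreover have "\<delta> \<le> \<bar>P' lo\<bar>" using Z(4) x y by (auto simp: lo_def min_def)
      ultimately have Pz: "\<delta> / 2 \<le> \<bar>P' z\<bar>" by linarith
      have "(hi - lo) * (\<delta> / 2) \<le> (hi - lo) * \<bar>P' z\<bar>" using lh Pz by (intro mult_left_mono) auto
      also have "\<dots> = \<bar>P hi - P lo\<bar>" using lh by (simp add: z(3) abs_mult)
      also have "\<dots> \<le> 2 * e" using Z(3)[OF x(1)] Z(3)[OF y(1)] by (auto simp: lo_def hi_def min_def max_def)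
      finally have "hi - lo \<le> 4 * e / \<delta>" using \<delta> by (simp add: field_simps)
      then show ?thesis by (cases "x \<le> y") (auto simp: lo_def hi_def)
    qed
    then have "Z \<inter> J q \<subseteq> {x - 4 * e / \<delta>..x + 4 * e / \<delta>}" by (fastforce simp: abs_le_iff)
    then have "emeasure lborel (Z \<inter> J q) \<le> emeasure lborel {x - 4 * e / \<delta>..x + 4 * e / \<delta>}"
      by (intro emeasure_mono) auto
    also have "\<dots> = ennreal (8 * e / \<delta>)" using e \<delta> by simp
    finally show ?thesis .
  qed simp
  have "Z \<subseteq> (\<Union>q<m. Z \<inter> J q)"
  proof
    fix x assume x: "x \<in> Z"
    then have x01: "0 \<le> x" "x < 1" using Z(2) by auto
    define q where "q = nat \<lfloor>x * real m\<rfloor>"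
    have q: "real q = of_int \<lfloor>x * real m\<rfloor>" using x01 m by (simp add: q_def)
    have "x \<in> J q" using m q unfolding J_def by (auto simp: field_simps) linarith+
    moreover have "q < m"
    proof -
      have "real q \<le> x * real m" using q by linarith
      also have "\<dots> < 1 * real m" using x01 m by (intro mult_strict_right_mono) auto
      finally show ?thesis by simp
    qed
    ultimately show "x \<in> (\<Union>q<m. Z \<inter> J q)" using x by auto
  qed
  then have "emeasure lborel Z \<le> emeasure lborel (\<Union>q<m. Z \<inter> J q)"
    using Z(1) by (intro emeasure_mono) (auto simp: J_def)
  also have "\<dots> \<le> (\<Sum>q<m. emeasure lborel (Z \<inter> J q))"
    using Z(1) by (intro emeasure_subadditive_finite) (auto simp: J_def)
  also have "\<dots> \<le> (\<Sum>q<m. ennreal (8 * e / \<delta>))" by (intro sum_mono cell)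
  also have "\<dots> = ennreal (real m) * ennreal (8 * e / \<delta>)" by (simp add: ennreal_of_nat_eq_real_of_nat)
  also have "\<dots> = ennreal (real m * (8 * e / \<delta>))" using e \<delta> by (intro ennreal_mult[symmetric]) auto
  finally show ?thesis .
qed


text \<open>Transversality of the first digits \<open>k\<close> and \<open>l\<close> at
  \<open>x\<close>, uniform over all continuations and all levels from \<open>N0\<close> on; a
  tangential pair is one that violates it.\<close>

definition separated :: "nat \<Rightarrow> real \<Rightarrow> real \<Rightarrow> nat \<Rightarrow> real \<Rightarrow> nat \<Rightarrow> nat \<Rightarrow> bool" where
  "separated b \<gamma> \<eta> N0 x k l \<longleftrightarrow> (\<forall>N\<ge>N0. \<forall>j j'. j mod b = k \<longrightarrow> j' mod b = l \<longrightarrow>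
     \<eta> \<le> \<bar>sine_diff b \<gamma> N x j j'\<bar> \<or> \<eta> \<le> \<bar>cosine_diff b \<gamma> N x j j'\<bar>)"

text \<open>The factor squared on the right is the total mass of \<open>cover\<close>, so this is a
  uniform L2 bound for the normalised densities. The scale shrinks by \<open>\<gamma>\<close> per
  level because removing a digit rescales by \<open>\<gamma>\<close>.\<close>

definition L2_bounded :: "nat \<Rightarrow> real \<Rightarrow> bool" where
  "L2_bounded b \<gamma> \<longleftrightarrow> (\<exists>C r N0. 0 \<le> C \<and> 0 < r \<and> (\<forall>n.
     (\<integral>\<^sup>+x. indicator {0..<1} x * energy (Sfin b \<gamma> (N0 + n) x) (r * \<gamma> ^ n) {..<b ^ (N0 + n)} {..<b ^ (N0 + n)} \<partial>lborel)
       \<le> ennreal (C * (r * \<gamma> ^ n * real (b ^ (N0 + n)))\<^sup>2)))"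

lemma Sfin_measurable[measurable]: "(\<lambda>x. Sfin b \<gamma> N x j) \<in> borel_measurable borel"
  unfolding Sfin_def psi_def by measurable

lemma energy_Sfin_measurable[measurable]: "(\<lambda>x. energy (Sfin b \<gamma> N x) r A B) \<in> borel_measurable borel"
proof -
  have [measurable]: "(\<lambda>p. cover (Sfin b \<gamma> N (fst p)) r A (snd p)) \<in> borel_measurable (borel \<Otimes>\<^sub>M lborel)" for A
  proof -
    have "(\<lambda>p. cover (Sfin b \<gamma> N (fst p)) r A (snd p)) =
      (\<lambda>p. \<Sum>j\<in>A. if Sfin b \<gamma> N (fst p) j \<le> snd p \<and> snd p \<le> Sfin b \<gamma> N (fst p) j + r then 1 else 0)"
      by (auto simp: cover_def indicator_def fun_eq_iff intro!: sum.cong)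
    also have "\<dots> \<in> borel_measurable (borel \<Otimes>\<^sub>M lborel)" by measurable
    finally show ?thesis .
  qed
  have "(\<lambda>x. \<integral>\<^sup>+y. (\<lambda>p. ennreal (cover (Sfin b \<gamma> N (fst p)) r A (snd p) * cover (Sfin b \<gamma> N (fst p)) r B (snd p))) (x, y) \<partial>lborel)
     \<in> borel_measurable borel"
    by (rule lborel.borel_measurable_nn_integral_fst) measurable
  then show ?thesis by (simp add: energy_def)
qed

text \<open>The \<open>b\<close> inverse branches of multiplication by \<open>b\<close> map the unit
  interval onto the cells of a partition of it, each with Jacobian 1 / b.\<close>

lemma nn_integral_digits:
  fixes f :: "real \<Rightarrow> ennreal"
  assumes b: "0 < b" and f[measurable]: "f \<in> borel_measurable borel"
  shows "(\<Sum>k<b. \<integral>\<^sup>+x. indicator {0..<1} x * f ((x + real k) / real b) \<partial>lborel)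
     = ennreal (real b) * (\<integral>\<^sup>+x. indicator {0..<1} x * f x \<partial>lborel)"
proof -
  define g where "g k y = indicator {real k / real b..<(real k + 1) / real b} y * f y" for k y
  have gm[measurable]: "g k \<in> borel_measurable borel" for k unfolding g_def by measurable
  have part: "(\<integral>\<^sup>+x. indicator {0..<1} x * f ((x + real k) / real b) \<partial>lborel) = ennreal (real b) * (\<integral>\<^sup>+y. g k y \<partial>lborel)" for k
  proof -
    have "(\<integral>\<^sup>+y. g k y \<partial>lborel) = ennreal \<bar>1 / real b\<bar> * (\<integral>\<^sup>+x. g k (real k / real b + 1 / real b * x) \<partial>lborel)"
      using b by (intro nn_integral_real_affine) auto
    also have "(\<lambda>x. g k (real k / real b + 1 / real b * x)) = (\<lambda>x. indicator {0..<1} x * f ((x + real k) / real b))"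
    proof
      fix x
      have e: "real k / real b + 1 / real b * x = (x + real k) / real b" by (simp add: add_divide_distrib)
      show "g k (real k / real b + 1 / real b * x) = indicator {0..<1} x * f ((x + real k) / real b)"
        unfolding g_def e using b by (auto simp: indicator_def divide_le_cancel divide_less_cancel)
    qed
    finally have "ennreal (real b) * (\<integral>\<^sup>+y. g k y \<partial>lborel)
      = (ennreal (real b) * ennreal \<bar>1 / real b\<bar>) * (\<integral>\<^sup>+x. indicator {0..<1} x * f ((x + real k) / real b) \<partial>lborel)"
      by (simp add: mult.assoc)
    moreover have "ennreal (real b) * ennreal \<bar>1 / real b\<bar> = 1"
      using b by (simp add: ennreal_mult[symmetric])
    ultimately show ?thesis by simp
  qed
  have "(\<Sum>k<b. g k y) = indicator {0..<1} y * f y" for y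
  proof (cases "y \<in> {0..<1}")
    case True
    define q where "q = nat \<lfloor>y * real b\<rfloor>"
    have q: "real q = of_int \<lfloor>y * real b\<rfloor>" using True by (simp add: q_def)
    have "real q \<le> y * real b" using q by linarith
    also have "\<dots> < 1 * real b" using True b by (intro mult_strict_right_mono) auto
    finally have qb: "q < b" by simp
    have iff: "y \<in> {real k / real b..<(real k + 1) / real b} \<longleftrightarrow> k = q" for k
    proof -
      have "y \<in> {real k / real b..<(real k + 1) / real b} \<longleftrightarrow> real k \<le> y * real b \<and> y * real b < real k + 1"
        using b by (auto simp: field_simps)
      also have "\<dots> \<longleftrightarrow> int k = \<lfloor>y * real b\<rfloor>" by linarith
      also have "\<dots> \<longleftrightarrow> k = q" using q by linarith
      finally show ?thesis .
    qed
    have "(\<Sum>k<b. g k y) = (\<Sum>k\<in>{q}. g k y)"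
      using qb iff by (intro sum.mono_neutral_right) (auto simp: g_def indicator_def)
    also have "\<dots> = f y" using iff[of q] by (auto simp: g_def indicator_def)
    finally show ?thesis using True by simp
  next
    case False
    have "g k y = 0" if "k < b" for k
    proof -
      have "real k + 1 \<le> real b" using that by simp
      then have "(real k + 1) / real b \<le> 1" using b by auto
      moreover have "real k / real b \<le> y \<Longrightarrow> 0 \<le> y" by (rule order_trans[rotated]) auto
      ultimately show ?thesis using False by (auto simp: g_def indicator_def)
    qed
    then show ?thesis using False by simp
  qed
  then have "(\<integral>\<^sup>+x. indicator {0..<1} x * f x \<partial>lborel) = (\<Sum>k<b. \<integral>\<^sup>+y. g k y \<partial>lborel)"
    by (subst nn_integral_sum[symmetric]) auto
  then show ?thesis by (simp add: part sum_distrib_left)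
qed

text \<open>One factor \<open>r\<close> is the overlap of the two intervals, the other the measure
  of the set of \<open>x\<close> at which they meet. There \<open>r \<le> \<eta>\<close> makes the
  difference too small to witness \<open>separated\<close>, so the derivative does. \<open>K\<close>
  is uniform in level and digits.\<close>

lemma transversal_pair_bound:
  assumes b: "2 \<le> b" and \<gamma>: "0 < \<gamma>" "\<gamma> < 1" and \<eta>: "0 < \<eta>"
  shows "\<exists>K\<ge>0. \<forall>N\<ge>N0. \<forall>j j' D r. 0 \<le> r \<longrightarrow> r \<le> \<eta> \<longrightarrow> D \<in> sets borel \<longrightarrow> D \<subseteq> {0..<1} \<longrightarrow>
     (\<forall>x\<in>D. separated b \<gamma> \<eta> N0 x (j mod b) (j' mod b)) \<longrightarrow>
     (\<integral>\<^sup>+x. indicator D x * (ennreal r * indicator {d. \<bar>d\<bar> \<le> r} (Sfin b \<gamma> N x j - Sfin b \<gamma> N x j')) \<partial>lborel) \<le> ennreal (K * r\<^sup>2)"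
proof -
  define \<delta> L where "\<delta> = 2 * pi / real b * \<eta>" and "L = 2 * pi / real b * (2 * pi / (1 - \<gamma>))"
  define m where "m = nat \<lceil>2 * L / \<delta>\<rceil> + 1"
  have \<delta>: "0 < \<delta>" and L: "0 \<le> L" using b \<gamma> \<eta> by (auto simp: \<delta>_def L_def)
  have m: "0 < m" "2 * L \<le> \<delta> * real m"
  proof -
    have "2 * L / \<delta> \<le> real m" unfolding m_def by linarith
    then show "2 * L \<le> \<delta> * real m" using \<delta> by (simp add: field_simps)
  qed (simp add: m_def)
  show ?thesis
  proof (intro exI[of _ "real m * (8 / \<delta>)"] conjI allI impI)
    show "0 \<le> real m * (8 / \<delta>)" using \<delta> by simp
    fix N j j' D and r :: real
    assume N: "N0 \<le> N" and r: "0 \<le> r" "r \<le> \<eta>" and D: "D \<in> sets borel" "D \<subseteq> {0..<1::real}"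
      and sep: "\<forall>x\<in>D. separated b \<gamma> \<eta> N0 x (j mod b) (j' mod b)"
    define Z where "Z = D \<inter> {x. \<bar>Sfin b \<gamma> N x j - Sfin b \<gamma> N x j'\<bar> \<le> r}"
    have "{x \<in> space borel. \<bar>Sfin b \<gamma> N x j - Sfin b \<gamma> N x j'\<bar> \<le> r} \<in> sets borel" by measurable
    then have Zm: "Z \<in> sets borel" unfolding Z_def using D by auto
    define P where "P x = sine_diff b \<gamma> N x j j'" for x
    define P' where "P' x = - (2 * pi / real b) * cosine_diff b \<gamma> N x j j'" for x
    have small: "\<bar>P x\<bar> \<le> r / (4 * pi)" if "x \<in> Z" for x
      using that unfolding Z_def Sfin_diff P_def by (auto simp: abs_mult field_simps)
    have e\<eta>: "r / (4 * pi) < \<eta>"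
    proof (cases "r = 0")
      case False
      have "r / (4 * pi) < r / 1" using False r pi_gt3 by (intro divide_strict_left_mono) auto
      then show ?thesis using r by simp
    qed (use \<eta> in simp)
    have big: "\<delta> \<le> \<bar>P' x\<bar>" if x: "x \<in> Z" for x
    proof -
      have "separated b \<gamma> \<eta> N0 x (j mod b) (j' mod b)" using sep x by (auto simp: Z_def)
      then have "\<eta> \<le> \<bar>P x\<bar> \<or> \<eta> \<le> \<bar>cosine_diff b \<gamma> N x j j'\<bar>" using N by (auto simp: separated_def P_def)
      then have "\<eta> \<le> \<bar>cosine_diff b \<gamma> N x j j'\<bar>" using small[OF x] e\<eta> by linarith
      then show ?thesis using b unfolding \<delta>_def P'_def by (simp add: abs_mult mult_left_mono divide_right_mono)
    qed
    have "emeasure lborel Z \<le> ennreal (real m * (8 * (r / (4 * pi)) / \<delta>))"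
    proof (rule emeasure_small_values_le[of P P' L])
      show "(P has_real_derivative P' x) (at x)" for x
        unfolding P_def P'_def using b by (intro sine_diff_has_derivative) simp
      show "\<bar>P' x - P' y\<bar> \<le> L * \<bar>x - y\<bar>" for x y
      proof -
        have "P' x - P' y = - (2 * pi / real b) * (cosine_diff b \<gamma> N x j j' - cosine_diff b \<gamma> N y j j')"
          by (simp add: P'_def algebra_simps)
        then have "\<bar>P' x - P' y\<bar> = 2 * pi / real b * \<bar>cosine_diff b \<gamma> N x j j' - cosine_diff b \<gamma> N y j j'\<bar>"
          by (simp add: abs_mult)
        also have "\<dots> \<le> 2 * pi / real b * (2 * pi / (1 - \<gamma>) * \<bar>x - y\<bar>)"
          using b \<gamma> by (intro mult_left_mono cosine_diff_lipschitz) auto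
        finally show ?thesis by (simp add: L_def mult_ac)
      qed
    qed (use \<delta> m L Zm D small big r in \<open>auto simp: Z_def\<close>)
    also have "\<dots> \<le> ennreal (real m * (8 / \<delta>) * r)"
    proof (intro ennreal_leI)
      have "r / (4 * pi) \<le> r / 1" using r pi_gt3 by (intro divide_left_mono) auto
      then have "real m * (8 * (r / (4 * pi)) / \<delta>) \<le> real m * (8 * r / \<delta>)"
        using \<delta> by (intro mult_left_mono divide_right_mono) auto
      then show "real m * (8 * (r / (4 * pi)) / \<delta>) \<le> real m * (8 / \<delta>) * r" by simp
    qed
    finally have Z: "emeasure lborel Z \<le> ennreal (real m * (8 / \<delta>) * r)" .
    have "(\<integral>\<^sup>+x. indicator D x * (ennreal r * indicator {d. \<bar>d\<bar> \<le> r} (Sfin b \<gamma> N x j - Sfin b \<gamma> N x j')) \<partial>lborel)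
       = (\<integral>\<^sup>+x. ennreal r * indicator Z x \<partial>lborel)"
      by (intro nn_integral_cong) (auto simp: Z_def indicator_def)
    also have "\<dots> = ennreal r * emeasure lborel Z" using Zm by (simp add: nn_integral_cmult_indicator)
    also have "\<dots> \<le> ennreal r * ennreal (real m * (8 / \<delta>) * r)" by (intro mult_left_mono Z) auto
    also have "\<dots> = ennreal (real m * (8 / \<delta>) * r\<^sup>2)"
      using r \<delta> by (subst ennreal_mult[symmetric]) (auto simp: power2_eq_square mult_ac)
    finally show "(\<integral>\<^sup>+x. indicator D x * (ennreal r * indicator {d. \<bar>d\<bar> \<le> r} (Sfin b \<gamma> N x j - Sfin b \<gamma> N x j')) \<partial>lborel)
       \<le> ennreal (real m * (8 / \<delta>) * r\<^sup>2)" .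
  qed
qed


section \<open>The recursion for the energy\<close>

lemma lessThan_power_Suc_residues:
  assumes "0 < b"
  shows "{..<b ^ Suc N} = (\<Union>k<b. (\<lambda>i. k + b * i) ` {..<b ^ N :: nat})"
proof (intro equalityI subsetI)
  fix j assume j: "j \<in> {..<b ^ Suc N}"
  have "j = j mod b + b * (j div b)" by simp
  moreover have "j div b < b ^ N" using j assms by (simp add: less_mult_imp_div_less mult.commute)
  moreover have "j mod b < b" using assms by simp
  ultimately show "j \<in> (\<Union>k<b. (\<lambda>i. k + b * i) ` {..<b ^ N})" by blast
next
  fix j assume "j \<in> (\<Union>k<b. (\<lambda>i. k + b * i) ` {..<b ^ N})"
  then obtain k i where k: "k < b" "i < b ^ N" "j = k + b * i" by auto
  have "j < b * (i + 1)" using k by simp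
  also have "\<dots> \<le> b * b ^ N" using k by (intro mult_le_mono) auto
  finally show "j \<in> {..<b ^ Suc N}" by simp
qed

text \<open>A block with \<open>W k l * W l k \<ge> 1\<close> goes to the diagonal by
  \<open>energy_Cauchy_Schwarz\<close>; summed over ordered pairs, the halves of the weights collect
  to the row sums of \<open>W\<close>. The other blocks stay as bare counts of close pairs, to be
  integrated over \<open>x\<close> later.\<close>

lemma energy_step:
  fixes A :: "nat \<Rightarrow> nat set" and N :: nat
  assumes b: "0 < b" and \<gamma>: "0 < \<gamma>" and r: "0 \<le> r"
    and W: "\<And>k l. k < b \<Longrightarrow> l < b \<Longrightarrow> 0 \<le> W k l"
    and A_def: "\<And>k. A k = (\<lambda>i. k + b * i) ` {..<b ^ N}"
  shows "energy (Sfin b \<gamma> (Suc N) x) r {..<b ^ Suc N} {..<b ^ Suc N}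
    \<le> (\<Sum>k<b. ennreal (\<Sum>l<b. W k l) * (ennreal \<gamma> * energy (Sfin b \<gamma> N ((x + real k) / real b)) (r / \<gamma>) {..<b ^ N} {..<b ^ N}))
     + (\<Sum>k<b. \<Sum>l<b. \<Sum>i\<in>A k. \<Sum>j\<in>A l. of_bool (W k l * W l k < 1) *
          (ennreal r * indicator {d. \<bar>d\<bar> \<le> r} (Sfin b \<gamma> (Suc N) x i - Sfin b \<gamma> (Suc N) x j)))"
proof -
  let ?s = "Sfin b \<gamma> (Suc N) x"
  have diag: "energy ?s r (A k) (A k) = ennreal \<gamma> * energy (Sfin b \<gamma> N ((x + real k) / real b)) (r / \<gamma>) {..<b ^ N} {..<b ^ N}" for k
    unfolding A_def using b
    by (intro energy_affine[where a = "psi ((x + real k) / real b)"] \<gamma> Sfin_Suc) (auto simp: inj_on_def)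
  have A: "disjoint_family_on A {..<b}" "finite (A k)" for k
    by (auto simp: A_def disjoint_family_on_def) (metis mod_less mod_mult_self2)
  have "energy ?s r {..<b ^ Suc N} {..<b ^ Suc N} = (\<Sum>k<b. \<Sum>l<b. energy ?s r (A k) (A l))"
    using lessThan_power_Suc_residues[OF b, of N] by (intro energy_sum[OF _ _ _ _ A(1) A(1)]) (auto simp: A_def)
  also have "\<dots> \<le> (\<Sum>k<b. \<Sum>l<b. (ennreal (W k l / 2) * energy ?s r (A k) (A k) + ennreal (W l k / 2) * energy ?s r (A l) (A l))
      + (\<Sum>i\<in>A k. \<Sum>j\<in>A l. of_bool (W k l * W l k < 1) * (ennreal r * indicator {d. \<bar>d\<bar> \<le> r} (?s i - ?s j))))"
  proof (intro sum_mono)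
    fix k l assume kl: "k \<in> {..<b}" "l \<in> {..<b}"
    show "energy ?s r (A k) (A l) \<le> (ennreal (W k l / 2) * energy ?s r (A k) (A k) + ennreal (W l k / 2) * energy ?s r (A l) (A l))
      + (\<Sum>i\<in>A k. \<Sum>j\<in>A l. of_bool (W k l * W l k < 1) * (ennreal r * indicator {d. \<bar>d\<bar> \<le> r} (?s i - ?s j)))"
    proof (cases "W k l * W l k < 1")
      case True
      then show ?thesis using energy_le_pairs[OF r A(2) A(2), of ?s k l] by (simp add: add_increasing)
    next
      case False
      then show ?thesis using energy_Cauchy_Schwarz[of "W k l" "W l k" ?s r "A k" "A l"] W kl by simp
    qed
  qed
  also have "\<dots> = (\<Sum>k<b. \<Sum>l<b. ennreal (W k l / 2) * energy ?s r (A k) (A k)) + (\<Sum>k<b. \<Sum>l<b. ennreal (W l k / 2) * energy ?s r (A l) (A l))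
     + (\<Sum>k<b. \<Sum>l<b. \<Sum>i\<in>A k. \<Sum>j\<in>A l. of_bool (W k l * W l k < 1) * (ennreal r * indicator {d. \<bar>d\<bar> \<le> r} (?s i - ?s j)))"
    by (simp add: sum.distrib)
  also have "(\<Sum>k<b. \<Sum>l<b. ennreal (W l k / 2) * energy ?s r (A l) (A l)) = (\<Sum>k<b. \<Sum>l<b. ennreal (W k l / 2) * energy ?s r (A k) (A k))"
    by (rule sum.swap)
  also have "(\<Sum>k<b. \<Sum>l<b. ennreal (W k l / 2) * energy ?s r (A k) (A k)) + (\<Sum>k<b. \<Sum>l<b. ennreal (W k l / 2) * energy ?s r (A k) (A k))
     = (\<Sum>k<b. ennreal (\<Sum>l<b. W k l) * energy ?s r (A k) (A k))"
  proof -
    have "(\<Sum>l<b. ennreal (W k l / 2) * e) + (\<Sum>l<b. ennreal (W k l / 2) * e) = ennreal (\<Sum>l<b. W k l) * e" if "k < b" for k e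
    proof -
      have "ennreal (\<Sum>l<b. W k l) = (\<Sum>l<b. ennreal (W k l / 2) + ennreal (W k l / 2))"
        using W that by (subst sum_ennreal[symmetric]) (auto simp: ennreal_plus[symmetric] simp del: ennreal_plus intro!: sum.cong)
      then show ?thesis by (simp add: sum.distrib distrib_right sum_distrib_right)
    qed
    then show ?thesis by (simp add: sum.distrib[symmetric])
  qed
  finally show ?thesis by (simp add: diag)
qed

text \<open>Pairs with \<open>W x k l * W x l k \<ge> 1\<close> are paid for by Cauchy--Schwarz with weights \<open>W x k l\<close> and \<open>W x l k\<close>; on the diagonal \<open>W x k k \<ge> 1\<close> is forced, since \<open>j = j'\<close> is never separated.\<close>
theorem L2_boundedI:
  fixes W :: "real \<Rightarrow> nat \<Rightarrow> nat \<Rightarrow> real" and \<omega> :: "real \<Rightarrow> real"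
  assumes b: "2 \<le> b" and \<gamma>: "0 < \<gamma>" "\<gamma> < 1" and \<eta>: "0 < \<eta>" and \<Lambda>: "\<Lambda> < \<gamma> * real b"
    and W0: "\<And>x k l. 0 \<le> W x k l" and Wm[measurable]: "\<And>k l. (\<lambda>x. W x k l) \<in> borel_measurable borel"
    and \<omega>m[measurable]: "\<omega> \<in> borel_measurable borel" and \<omega>1: "\<And>x. 1 \<le> \<omega> x" and \<omega>2: "\<And>x. \<omega> x \<le> \<Omega>"
    and sep: "\<And>x k l. \<lbrakk>0 \<le> x; x < 1; k < b; l < b; W x k l * W x l k < 1\<rbrakk> \<Longrightarrow> separated b \<gamma> \<eta> N0 x k l"
    and cost: "\<And>x k. \<lbrakk>0 \<le> x; x < 1; k < b\<rbrakk> \<Longrightarrow> \<omega> x * (\<Sum>l<b. W x k l) \<le> \<Lambda> * \<omega> ((x + real k) / real b)"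
  shows "L2_bounded b \<gamma>"
proof -
  obtain K where K0: "0 \<le> K" and K: "\<And>N j j' D r. \<lbrakk>N0 \<le> N; 0 \<le> r; r \<le> \<eta>; D \<in> sets borel; D \<subseteq> {0..<1};
     \<forall>x\<in>D. separated b \<gamma> \<eta> N0 x (j mod b) (j' mod b)\<rbrakk> \<Longrightarrow>
     (\<integral>\<^sup>+x. indicator D x * (ennreal r * indicator {d. \<bar>d\<bar> \<le> r} (Sfin b \<gamma> N x j - Sfin b \<gamma> N x j')) \<partial>lborel) \<le> ennreal (K * r\<^sup>2)"
    using transversal_pair_bound[OF b \<gamma> \<eta>, of N0] by blast
  have b0: "0 < b" using b by simp
  have \<Omega>: "1 \<le> \<Omega>" using \<omega>1[of 0] \<omega>2[of 0] by linarith
  have \<Lambda>0: "0 \<le> \<Lambda>"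
  proof -
    have "0 \<le> \<omega> 0 * (\<Sum>l<b. W 0 0 l)" using \<omega>1[of 0] W0 by (intro mult_nonneg_nonneg sum_nonneg) auto
    also have "\<dots> \<le> \<Lambda> * \<omega> 0" using cost[of 0 0] b0 by simp
    finally show ?thesis using \<omega>1[of 0] by (simp add: zero_le_mult_iff)
  qed
  define EN where "EN N r x = energy (Sfin b \<gamma> N x) r {..<b ^ N} {..<b ^ N}" for N r x
  have ENm[measurable]: "EN N r \<in> borel_measurable borel" for N r unfolding EN_def by measurable
  \<comment> \<open>With \<omega> inside the integral the row sum at \<open>x\<close> is charged to
    the value of \<omega> at the preimage, so \<Lambda> is a rate along backward orbits and not the
    worst cost at a point.\<close>
  define I where "I N r = (\<integral>\<^sup>+x. indicator {0..<1} x * (ennreal (\<omega> x) * EN N r x) \<partial>lborel)" for N r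
  define A where "A N k = (\<lambda>i. k + b * i) ` {..<b ^ N}" for N k
  \<comment> \<open>The factor \<open>\<gamma>\<close> comes from rescaling the energy,
    \<open>real b\<close> from summing over the preimages, \<Lambda> from the assumption
    \<open>cost\<close>.\<close>
  have step: "I (Suc N) r \<le> ennreal (\<Lambda> * \<gamma> * real b) * I N (r / \<gamma>) + ennreal (\<Omega> * K * (r * real (b ^ Suc N))\<^sup>2)"
    if N: "N0 \<le> Suc N" and r: "0 \<le> r" "r \<le> \<eta>" for N r
  proof -
    define T where "T x = (\<Sum>k<b. \<Sum>l<b. \<Sum>i\<in>A N k. \<Sum>j\<in>A N l. of_bool (W x k l * W x l k < 1) *
          (ennreal r * indicator {d. \<bar>d\<bar> \<le> r} (Sfin b \<gamma> (Suc N) x i - Sfin b \<gamma> (Suc N) x j)))" for x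
    define D where "D k l = {x. 0 \<le> x \<and> x < 1 \<and> W x k l * W x l k < 1}" for k l
    have Dm: "D k l \<in> sets borel" for k l
    proof -
      have "{x \<in> space borel. 0 \<le> x \<and> x < 1 \<and> W x k l * W x l k < 1} \<in> sets borel" by measurable
      then show ?thesis by (simp add: D_def)
    qed
    have Tm[measurable]: "T \<in> borel_measurable borel" unfolding T_def by measurable
    have T_int: "(\<integral>\<^sup>+x. indicator {0..<1} x * T x \<partial>lborel) \<le> ennreal (K * (r * real (b ^ Suc N))\<^sup>2)"
    proof -
      have "(\<integral>\<^sup>+x. indicator {0..<1} x * T x \<partial>lborel) = (\<integral>\<^sup>+x. (\<Sum>k<b. \<Sum>l<b. \<Sum>i\<in>A N k. \<Sum>j\<in>A N l. indicator (D k l) x *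
          (ennreal r * indicator {d. \<bar>d\<bar> \<le> r} (Sfin b \<gamma> (Suc N) x i - Sfin b \<gamma> (Suc N) x j))) \<partial>lborel)"
        unfolding T_def sum_distrib_left
        by (intro nn_integral_cong sum.cong refl) (auto simp: D_def indicator_def)
      also have "\<dots> = (\<Sum>k<b. \<Sum>l<b. \<Sum>i\<in>A N k. \<Sum>j\<in>A N l. (\<integral>\<^sup>+x. indicator (D k l) x *
          (ennreal r * indicator {d. \<bar>d\<bar> \<le> r} (Sfin b \<gamma> (Suc N) x i - Sfin b \<gamma> (Suc N) x j)) \<partial>lborel))"
        using Dm by (simp add: nn_integral_sum)
      also have "\<dots> \<le> (\<Sum>k<b. \<Sum>l<b. \<Sum>i\<in>A N k. \<Sum>j\<in>A N l. ennreal (K * r\<^sup>2))"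
      proof (intro sum_mono)
        fix k l i j assume kl: "k \<in> {..<b}" "l \<in> {..<b}" "i \<in> A N k" "j \<in> A N l"
        have m: "i mod b = k" "j mod b = l" using kl by (auto simp: A_def)
        show "(\<integral>\<^sup>+x. indicator (D k l) x * (ennreal r * indicator {d. \<bar>d\<bar> \<le> r} (Sfin b \<gamma> (Suc N) x i - Sfin b \<gamma> (Suc N) x j)) \<partial>lborel)
           \<le> ennreal (K * r\<^sup>2)"
          by (rule K[OF N r Dm]) (use sep kl m in \<open>auto simp: D_def\<close>)
      qed
      also have "\<dots> = ennreal (K * (r * real (b ^ Suc N))\<^sup>2)"
      proof -
        have "card (A N k) = b ^ N" for k unfolding A_def using b0 by (subst card_image) (auto simp: inj_on_def)
        then have "(\<Sum>k<b. \<Sum>l<b. \<Sum>i\<in>A N k. \<Sum>j\<in>A N l. ennreal (K * r\<^sup>2)) = of_nat ((b ^ Suc N)\<^sup>2) * ennreal (K * r\<^sup>2)"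
          by (simp add: power2_eq_square algebra_simps)
        also have "\<dots> = ennreal (real ((b ^ Suc N)\<^sup>2) * (K * r\<^sup>2))"
          using K0 by (subst ennreal_mult) (auto simp: ennreal_of_nat_eq_real_of_nat)
        finally show ?thesis by (simp add: power_mult_distrib mult_ac)
      qed
      finally show ?thesis .
    qed
    have "I (Suc N) r \<le> (\<integral>\<^sup>+x. (\<Sum>k<b. ennreal (\<Lambda> * \<gamma>) * (indicator {0..<1} x * (ennreal (\<omega> ((x + real k) / real b)) * EN N (r / \<gamma>) ((x + real k) / real b))))
        + ennreal \<Omega> * (indicator {0..<1} x * T x) \<partial>lborel)"
      unfolding I_def
    proof (intro nn_integral_mono)
      fix x :: real
      show "indicator {0..<1} x * (ennreal (\<omega> x) * EN (Suc N) r x) \<le> (\<Sum>k<b. ennreal (\<Lambda> * \<gamma>) * (indicator {0..<1} x * (ennreal (\<omega> ((x + real k) / real b)) * EN N (r / \<gamma>) ((x + real k) / real b))))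
        + ennreal \<Omega> * (indicator {0..<1} x * T x)"
      proof (cases "x \<in> {0..<1}")
        case True
        have "ennreal (\<omega> x) * EN (Suc N) r x \<le> ennreal (\<omega> x) * ((\<Sum>k<b. ennreal (\<Sum>l<b. W x k l) * (ennreal \<gamma> * EN N (r / \<gamma>) ((x + real k) / real b))) + T x)"
          unfolding EN_def T_def A_def
          by (intro mult_left_mono energy_step b0 \<gamma> r W0 refl) auto
        also have "\<dots> = (\<Sum>k<b. ennreal (\<omega> x) * (ennreal (\<Sum>l<b. W x k l) * (ennreal \<gamma> * EN N (r / \<gamma>) ((x + real k) / real b)))) + ennreal (\<omega> x) * T x"
          by (simp add: distrib_left sum_distrib_left)
        also have "\<dots> \<le> (\<Sum>k<b. ennreal (\<Lambda> * \<gamma>) * (ennreal (\<omega> ((x + real k) / real b)) * EN N (r / \<gamma>) ((x + real k) / real b))) + ennreal \<Omega> * T x"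
        proof (intro add_mono sum_mono mult_right_mono ennreal_leI \<omega>2)
          fix k assume k: "k \<in> {..<b}"
          have "ennreal (\<omega> x) * (ennreal (\<Sum>l<b. W x k l) * (ennreal \<gamma> * e)) = ennreal (\<omega> x * (\<Sum>l<b. W x k l) * \<gamma>) * e" for e
            using \<omega>1[of x] W0 \<gamma> by (simp add: ennreal_mult sum_nonneg mult.assoc)
          moreover have "ennreal (\<Lambda> * \<gamma>) * (ennreal (\<omega> ((x + real k) / real b)) * e) = ennreal (\<Lambda> * \<omega> ((x + real k) / real b) * \<gamma>) * e" for e
            using \<omega>1[of "(x + real k) / real b"] \<Lambda>0 \<gamma> by (simp add: ennreal_mult mult_ac)
          moreover have "\<omega> x * (\<Sum>l<b. W x k l) * \<gamma> \<le> \<Lambda> * \<omega> ((x + real k) / real b) * \<gamma>"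
            using cost[of x k] k True \<gamma> by (intro mult_right_mono) auto
          ultimately show "ennreal (\<omega> x) * (ennreal (\<Sum>l<b. W x k l) * (ennreal \<gamma> * EN N (r / \<gamma>) ((x + real k) / real b)))
            \<le> ennreal (\<Lambda> * \<gamma>) * (ennreal (\<omega> ((x + real k) / real b)) * EN N (r / \<gamma>) ((x + real k) / real b))"
            by (simp add: mult_right_mono ennreal_leI)
        qed auto
        finally show ?thesis using True by simp
      qed simp
    qed
    also have "\<dots> = (\<Sum>k<b. ennreal (\<Lambda> * \<gamma>) * (\<integral>\<^sup>+x. indicator {0..<1} x * (ennreal (\<omega> ((x + real k) / real b)) * EN N (r / \<gamma>) ((x + real k) / real b)) \<partial>lborel))
        + ennreal \<Omega> * (\<integral>\<^sup>+x. indicator {0..<1} x * T x \<partial>lborel)"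
      by (simp add: nn_integral_add nn_integral_sum nn_integral_cmult)
    also have "(\<Sum>k<b. ennreal (\<Lambda> * \<gamma>) * (\<integral>\<^sup>+x. indicator {0..<1} x * (ennreal (\<omega> ((x + real k) / real b)) * EN N (r / \<gamma>) ((x + real k) / real b)) \<partial>lborel))
       = ennreal (\<Lambda> * \<gamma>) * (ennreal (real b) * I N (r / \<gamma>))"
      unfolding sum_distrib_left[symmetric] I_def
      by (subst nn_integral_digits[OF b0, of "\<lambda>x. ennreal (\<omega> x) * EN N (r / \<gamma>) x"]) auto
    also have "\<dots> = ennreal (\<Lambda> * \<gamma> * real b) * I N (r / \<gamma>)"
      using \<Lambda>0 \<gamma> by (simp add: ennreal_mult mult.assoc)
    also have "ennreal (\<Lambda> * \<gamma> * real b) * I N (r / \<gamma>) + ennreal \<Omega> * (\<integral>\<^sup>+x. indicator {0..<1} x * T x \<partial>lborel)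
       \<le> ennreal (\<Lambda> * \<gamma> * real b) * I N (r / \<gamma>) + ennreal \<Omega> * ennreal (K * (r * real (b ^ Suc N))\<^sup>2)"
      by (intro add_mono mult_left_mono T_int) auto
    also have "ennreal \<Omega> * ennreal (K * (r * real (b ^ Suc N))\<^sup>2) = ennreal (\<Omega> * K * (r * real (b ^ Suc N))\<^sup>2)"
      using \<Omega> K0 by (subst ennreal_mult[symmetric]) (auto simp: mult.assoc)
    finally show ?thesis .
  qed
  \<comment> \<open>Per level the square of \<open>r * real (b ^ N)\<close> grows by
    \<open>(\<gamma> * real b)\<^sup>2\<close> while the energy grows by
    \<open>\<Lambda> * \<gamma> * real b\<close>; \<theta> is the quotient.\<close>
  define \<theta> where "\<theta> = \<Lambda> / (\<gamma> * real b)"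
  have \<theta>: "0 \<le> \<theta>" "\<theta> < 1" using \<Lambda> \<Lambda>0 \<gamma> b0 by (auto simp: \<theta>_def)
  \<comment> \<open>The first entry covers the initial level, the second makes
    \<open>\<theta> * C + \<Omega> * K \<le> C\<close>, so that the bound reproduces itself.\<close>
  define C where "C = max (\<Omega> / \<eta>) (\<Omega> * K / (1 - \<theta>))"
  have C0: "0 \<le> C" using \<Omega> \<eta> by (auto simp: C_def le_max_iff_disj)
  have "\<Omega> * K / (1 - \<theta>) \<le> C" by (simp add: C_def)
  then have C1: "\<theta> * C + \<Omega> * K \<le> C" using \<theta> by (simp add: field_simps)
  have bound: "I (N0 + n) (\<eta> * \<gamma> ^ n) \<le> ennreal (C * (\<eta> * \<gamma> ^ n * real (b ^ (N0 + n)))\<^sup>2)" for n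
  proof (induction n)
    case 0
    have "I N0 \<eta> \<le> (\<integral>\<^sup>+x. ennreal (\<Omega> * \<eta> * (real (b ^ N0))\<^sup>2) * indicator {0..<1::real} x \<partial>lborel)"
      unfolding I_def
    proof (intro nn_integral_mono)
      fix x :: real
      have "EN N0 \<eta> x \<le> (\<Sum>i<b ^ N0. \<Sum>j<b ^ N0. ennreal \<eta> * indicator {d. \<bar>d\<bar> \<le> \<eta>} (Sfin b \<gamma> N0 x i - Sfin b \<gamma> N0 x j))"
        unfolding EN_def using \<eta> by (intro energy_le_pairs) auto
      also have "\<dots> \<le> (\<Sum>i<b ^ N0. \<Sum>j<b ^ N0. ennreal \<eta> * 1)"
        by (intro sum_mono mult_left_mono) (auto simp: indicator_def)
      also have "\<dots> = of_nat ((b ^ N0)\<^sup>2) * ennreal \<eta>" by (simp add: power2_eq_square algebra_simps)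
      also have "\<dots> = ennreal (\<eta> * (real (b ^ N0))\<^sup>2)"
        using \<eta> by (simp add: ennreal_mult ennreal_of_nat_eq_real_of_nat[symmetric] mult.commute power2_eq_square ennreal_of_nat_eq_real_of_nat)
      finally have "ennreal (\<omega> x) * EN N0 \<eta> x \<le> ennreal \<Omega> * ennreal (\<eta> * (real (b ^ N0))\<^sup>2)"
        by (intro mult_mono ennreal_leI \<omega>2) auto
      also have "\<dots> = ennreal (\<Omega> * \<eta> * (real (b ^ N0))\<^sup>2)"
        using \<Omega> \<eta> by (subst ennreal_mult[symmetric]) (auto simp: mult.assoc)
      finally show "indicator {0..<1} x * (ennreal (\<omega> x) * EN N0 \<eta> x) \<le> ennreal (\<Omega> * \<eta> * (real (b ^ N0))\<^sup>2) * indicator {0..<1} x"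
        by (auto simp: indicator_def)
    qed
    also have "\<dots> = ennreal (\<Omega> * \<eta> * (real (b ^ N0))\<^sup>2)" by (subst nn_integral_cmult_indicator) auto
    also have "\<dots> \<le> ennreal (C * (\<eta> * real (b ^ N0))\<^sup>2)"
    proof (intro ennreal_leI)
      have "\<Omega> / \<eta> * (\<eta> * real (b ^ N0))\<^sup>2 \<le> C * (\<eta> * real (b ^ N0))\<^sup>2" by (intro mult_right_mono) (auto simp: C_def)
      moreover have "\<Omega> / \<eta> * (\<eta> * real (b ^ N0))\<^sup>2 = \<Omega> * \<eta> * (real (b ^ N0))\<^sup>2"
        using \<eta> by (simp add: power2_eq_square)
      ultimately show "\<Omega> * \<eta> * (real (b ^ N0))\<^sup>2 \<le> C * (\<eta> * real (b ^ N0))\<^sup>2" by simp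
    qed
    finally show ?case by simp
  next
    case (Suc n)
    let ?r = "\<eta> * \<gamma> ^ Suc n"
    have "\<gamma> ^ Suc n \<le> 1" using \<gamma> by (intro power_le_one) auto
    then have r: "0 \<le> ?r" "?r \<le> \<eta>" using \<eta> \<gamma> by (simp, metis mult.right_neutral mult_left_mono less_imp_le)
    define X where "X = (\<eta> * \<gamma> ^ n * real (b ^ (N0 + n)))\<^sup>2"
    have X: "(?r * real (b ^ Suc (N0 + n)))\<^sup>2 = (\<gamma> * real b)\<^sup>2 * X" by (simp add: X_def power2_eq_square mult_ac)
    have X0: "0 \<le> X" by (simp add: X_def)
    have "?r / \<gamma> = \<eta> * \<gamma> ^ n" using \<gamma> by simp
    then have "I (Suc (N0 + n)) ?r \<le> ennreal (\<Lambda> * \<gamma> * real b) * I (N0 + n) (\<eta> * \<gamma> ^ n) + ennreal (\<Omega> * K * (?r * real (b ^ Suc (N0 + n)))\<^sup>2)"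
      using step[of "N0 + n" ?r] r by simp
    also have "\<dots> \<le> ennreal (\<Lambda> * \<gamma> * real b) * ennreal (C * X) + ennreal (\<Omega> * K * ((\<gamma> * real b)\<^sup>2 * X))"
      unfolding X using Suc.IH by (intro add_mono mult_left_mono) (auto simp: X_def)
    also have "\<dots> = ennreal (\<Lambda> * \<gamma> * real b * (C * X) + \<Omega> * K * ((\<gamma> * real b)\<^sup>2 * X))"
      using \<Lambda>0 \<gamma> C0 X0 \<Omega> K0 by (simp add: ennreal_mult)
    also have "\<dots> \<le> ennreal (C * ((\<gamma> * real b)\<^sup>2 * X))"
    proof (intro ennreal_leI)
      have "\<Lambda> = \<theta> * (\<gamma> * real b)" using \<gamma> b0 by (simp add: \<theta>_def)
      then have "\<Lambda> * \<gamma> * real b * (C * X) + \<Omega> * K * ((\<gamma> * real b)\<^sup>2 * X) = (\<theta> * C + \<Omega> * K) * ((\<gamma> * real b)\<^sup>2 * X)"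
        by (simp add: power2_eq_square algebra_simps)
      also have "\<dots> \<le> C * ((\<gamma> * real b)\<^sup>2 * X)" using C1 X0 by (intro mult_right_mono) auto
      finally show "\<Lambda> * \<gamma> * real b * (C * X) + \<Omega> * K * ((\<gamma> * real b)\<^sup>2 * X) \<le> C * ((\<gamma> * real b)\<^sup>2 * X)" .
    qed
    also have "C * ((\<gamma> * real b)\<^sup>2 * X) = C * (?r * real (b ^ (N0 + Suc n)))\<^sup>2" using X by simp
    finally show ?case by simp
  qed
  have "(\<integral>\<^sup>+x. indicator {0..<1} x * EN (N0 + n) (\<eta> * \<gamma> ^ n) x \<partial>lborel) \<le> I (N0 + n) (\<eta> * \<gamma> ^ n)" for n
    unfolding I_def
  proof (intro nn_integral_mono mult_left_mono)
    fix x
    have "1 * EN (N0 + n) (\<eta> * \<gamma> ^ n) x \<le> ennreal (\<omega> x) * EN (N0 + n) (\<eta> * \<gamma> ^ n) x"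
      using \<omega>1[of x] by (intro mult_right_mono) auto
    then show "EN (N0 + n) (\<eta> * \<gamma> ^ n) x \<le> ennreal (\<omega> x) * EN (N0 + n) (\<eta> * \<gamma> ^ n) x" by simp
  qed auto
  then show ?thesis unfolding L2_bounded_def EN_def
    using bound C0 \<eta> by (intro exI[of _ C] exI[of _ \<eta>] exI[of _ N0]) (auto simp: EN_def intro: order_trans)
qed

section \<open>From the energy to the measures\<close>

definition code :: "nat \<Rightarrow> nat \<Rightarrow> (nat \<Rightarrow> nat) \<Rightarrow> nat" where
  "code b N i = (\<Sum>k<N. i k * b ^ k)"

lemma digit_sum_eq_mod:
  fixes b j :: nat
  shows "(\<Sum>k<N. (j div b ^ k mod b) * b ^ k) = j mod b ^ N"
proof (induction N)
  case (Suc N)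
  have "j mod b ^ Suc N = b ^ N * (j div b ^ N mod b) + j mod b ^ N"
    using mod_mult2_eq[of j "b ^ N" b] by (simp add: mult.commute)
  then show ?case using Suc by simp
qed simp

section \<open>Random digit sequences and their truncations\<close>

lemma sets_bern: "sets (bern b) = sets (\<Pi>\<^sub>M n\<in>(UNIV::nat set). count_space (UNIV::nat set))"
  unfolding bern_def by (intro sets_PiM_cong) auto

lemma space_bern [simp]: "space (bern b) = UNIV"
  unfolding bern_def by (simp add: space_PiM)

lemma measurable_bern_component [measurable]: "(\<lambda>i. i k) \<in> bern b \<rightarrow>\<^sub>M count_space UNIV"
proof -
  have "(\<lambda>i. i k) \<in> (\<Pi>\<^sub>M n\<in>(UNIV::nat set). count_space (UNIV::nat set)) \<rightarrow>\<^sub>M count_space UNIV" by simp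
  then show ?thesis by (simp add: measurable_cong_sets[OF sets_bern refl])
qed

lemma code_measurable [measurable]: "code b N \<in> bern b \<rightarrow>\<^sub>M count_space UNIV"
  unfolding code_def by measurable

lemma prob_space_bern: "prob_space (bern b)"
  unfolding bern_def by (intro prob_space_PiM measure_pmf.prob_space_axioms)

lemma AE_code_digits:
  assumes b: "0 < b"
  shows "emeasure (bern b) {i. \<forall>k<N. i k = j div b ^ k mod b} = ennreal (1 / real (b ^ N))"
proof -
  interpret product_prob_space "\<lambda>_. measure_pmf (pmf_of_set {0..<b})" "UNIV :: nat set"
    by standard
  have "emeasure (bern b) {i \<in> space (bern b). \<forall>k\<in>{..<N}. i k \<in> {j div b ^ k mod b}}
     = (\<Prod>k\<in>{..<N}. emeasure (measure_pmf (pmf_of_set {0..<b})) {j div b ^ k mod b})"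
    unfolding bern_def by (intro emeasure_PiM_Collect) auto
  also have "\<dots> = (\<Prod>k\<in>{..<N}. ennreal (1 / real b))"
    using b by (intro prod.cong refl) (simp add: emeasure_pmf_single)
  also have "\<dots> = ennreal (1 / real (b ^ N))"
    using b by (simp add: ennreal_power power_divide)
  also have "{i \<in> space (bern b). \<forall>k\<in>{..<N}. i k \<in> {j div b ^ k mod b}} = {i. \<forall>k<N. i k = j div b ^ k mod b}"
    by auto
  finally show ?thesis .
qed

text \<open>The numbers below \<open>b ^ N\<close> give disjoint cylinders of equal probability that
  exhaust the space up to a null set. Sequences with entries outside \<open>{0..<b}\<close> belong
  to the space too, hence the detour through \<open>AE\<close>.\<close>

lemma distr_code:
  assumes b: "0 < b"
  shows "distr (bern b) (count_space UNIV) (code b N) = measure_pmf (pmf_of_set {..<b ^ N})"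
proof (rule measure_eqI)
  interpret prob_space "bern b" by (rule prob_space_bern)
  fix A :: "nat set" assume "A \<in> sets (distr (bern b) (count_space UNIV) (code b N))"
  define Cyl where "Cyl j = {i. \<forall>k<N. i k = j div b ^ k mod b}" for j
  have Cm: "Cyl j \<in> sets (bern b)" for j
  proof -
    have "{i \<in> space (bern b). \<forall>k<N. i k = j div b ^ k mod b} \<in> sets (bern b)" by measurable
    then show ?thesis by (simp add: Cyl_def)
  qed
  have Ce: "emeasure (bern b) (Cyl j) = ennreal (1 / real (b ^ N))" for j
    unfolding Cyl_def by (rule AE_code_digits[OF b])
  have code_Cyl: "code b N i = j" if "i \<in> Cyl j" "j < b ^ N" for i j
    using that digit_sum_eq_mod[of j b N] by (simp add: code_def Cyl_def)
  have disj: "disjoint_family_on Cyl {..<b ^ N}"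
    unfolding disjoint_family_on_def by (auto dest!: code_Cyl)
  have Un: "emeasure (bern b) (\<Union>j\<in>B. Cyl j) = ennreal (real (card B) / real (b ^ N))" if "B \<subseteq> {..<b ^ N}" for B
  proof -
    have "finite B" using that finite_subset by blast
    then have "emeasure (bern b) (\<Union>j\<in>B. Cyl j) = (\<Sum>j\<in>B. emeasure (bern b) (Cyl j))"
      using Cm disj that by (intro sum_emeasure[symmetric]) (auto intro: disjoint_family_on_mono)
    also have "\<dots> = of_nat (card B) * ennreal (1 / real (b ^ N))" by (simp add: Ce)
    also have "\<dots> = ennreal (real (card B) * (1 / real (b ^ N)))"
      by (subst ennreal_mult) (auto simp: ennreal_of_nat_eq_real_of_nat)
    finally show ?thesis by simp
  qed
  have "emeasure (bern b) (\<Union>j<b ^ N. Cyl j) = 1" using Un[of "{..<b ^ N}"] b by simp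
  then have AE: "AE i in bern b. i \<in> (\<Union>j<b ^ N. Cyl j)"
    using Cm by (intro AE_in_set_eq_1[THEN iffD2]) (auto simp: emeasure_eq_measure)
  have "emeasure (distr (bern b) (count_space UNIV) (code b N)) A = emeasure (bern b) (code b N -` A \<inter> space (bern b))"
    by (rule emeasure_distr) auto
  also have "\<dots> = emeasure (bern b) (\<Union>j\<in>{..<b ^ N} \<inter> A. Cyl j)"
  proof (rule emeasure_eq_AE)
    show "AE i in bern b. (i \<in> code b N -` A \<inter> space (bern b)) = (i \<in> (\<Union>j\<in>{..<b ^ N} \<inter> A. Cyl j))"
      using AE by eventually_elim (auto dest: code_Cyl)
    have "code b N -` A \<inter> space (bern b) \<in> sets (bern b)" by (rule measurable_sets[OF code_measurable]) simp
    then show "code b N -` A \<inter> space (bern b) \<in> sets (bern b)" .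
    show "(\<Union>j\<in>{..<b ^ N} \<inter> A. Cyl j) \<in> sets (bern b)" using Cm by auto
  qed
  also have "\<dots> = ennreal (real (card ({..<b ^ N} \<inter> A)) / real (b ^ N))" by (rule Un) auto
  also have "\<dots> = emeasure (measure_pmf (pmf_of_set {..<b ^ N})) A"
    using b by (subst emeasure_pmf_of_set) (auto simp: lessThan_empty_iff)
  finally show "emeasure (distr (bern b) (count_space UNIV) (code b N)) A = emeasure (measure_pmf (pmf_of_set {..<b ^ N})) A" .
qed simp

lemma nn_integral_code:
  assumes b: "0 < b"
  shows "(\<integral>\<^sup>+i. g (code b N i) \<partial>bern b) = (\<Sum>j<b ^ N. g j) / real (b ^ N)"
proof -
  have "(\<integral>\<^sup>+i. g (code b N i) \<partial>bern b) = (\<integral>\<^sup>+j. g j \<partial>distr (bern b) (count_space UNIV) (code b N))"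
    by (rule nn_integral_distr[symmetric]) auto
  also have "\<dots> = (\<Sum>j<b ^ N. g j) / real (b ^ N)"
    unfolding distr_code[OF b] using b by (subst nn_integral_pmf_of_set) (auto simp: lessThan_empty_iff ennreal_of_nat_eq_real_of_nat)
  finally show ?thesis .
qed

text \<open>The complex version serves the characteristic functions in
  \<open>mfib_add_1\<close>.\<close>

lemma integral_code:
  fixes g :: "nat \<Rightarrow> complex"
  assumes b: "0 < b"
  shows "(\<integral>i. g (code b N i) \<partial>bern b) = (\<Sum>j<b ^ N. g j) / real (b ^ N)"
proof -
  have "(\<integral>i. g (code b N i) \<partial>bern b) = (\<integral>j. g j \<partial>distr (bern b) (count_space UNIV) (code b N))"
    by (rule integral_distr[symmetric]) auto
  also have "\<dots> = (\<Sum>j<b ^ N. g j) / real (b ^ N)"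
    unfolding distr_code[OF b] using b
    by (subst integral_measure_pmf[of "{..<b ^ N}"])
       (auto simp: lessThan_empty_iff scaleR_conv_of_real sum_divide_distrib intro!: sum.cong)
  finally show ?thesis .
qed

text \<open>Digits after the position of a term change its argument by an integer, so
  \<open>Sfin\<close> at \<open>code b N i\<close> is exactly a partial sum of
  \<open>Ssum\<close>.\<close>

lemma Sfin_code_tendsto:
  assumes b: "0 < b" and \<gamma>: "0 < \<gamma>" "\<gamma> < 1"
  shows "(\<lambda>N. Sfin b \<gamma> N x (code b N i)) \<longlonglongrightarrow> Ssum b \<gamma> psi x i"
proof -
  define t where "t n = \<gamma> ^ n * psi ((x + (\<Sum>k\<le>n. real (i k) * real b ^ k)) / real b ^ Suc n)" for n
  have Sf: "Sfin b \<gamma> N x (code b N i) = (\<Sum>n<N. t n)" for N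
    unfolding Sfin_def
  proof (intro sum.cong refl)
    fix n assume n: "n \<in> {..<N}"
    have "(\<Sum>k<N. i k * b ^ k) = (\<Sum>k<Suc n. i k * b ^ k) + (\<Sum>k\<in>{Suc n..<N}. i k * b ^ k)"
      using n by (subst sum.atLeastLessThan_concat[symmetric, of 0 "Suc n" N, unfolded atLeast0LessThan]) auto
    also have "(\<Sum>k\<in>{Suc n..<N}. i k * b ^ k) = b ^ Suc n * (\<Sum>k\<in>{Suc n..<N}. i k * b ^ (k - Suc n))"
      unfolding sum_distrib_left by (intro sum.cong refl) (simp add: power_add[symmetric] del: power_Suc)
    finally have "code b N i = (\<Sum>k\<le>n. i k * b ^ k) + b ^ Suc n * (\<Sum>k\<in>{Suc n..<N}. i k * b ^ (k - Suc n))"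
      by (simp add: code_def lessThan_Suc_atMost)
    then have "(x + real (code b N i)) / real b ^ Suc n
       = (x + (\<Sum>k\<le>n. real (i k) * real b ^ k)) / real b ^ Suc n + real (\<Sum>k\<in>{Suc n..<N}. i k * b ^ (k - Suc n))"
      using b by (simp add: field_simps)
    then show "\<gamma> ^ n * psi ((x + real (code b N i)) / real b ^ Suc n) = t n"
      unfolding t_def by (simp only: psi_periodic)
  qed
  have "norm (t n) \<le> 2 * pi * \<gamma> ^ n" for n
  proof -
    have "\<bar>psi y\<bar> \<le> 2 * pi * 1" for y unfolding psi_def abs_mult by (intro mult_mono) auto
    then have "\<gamma> ^ n * \<bar>psi y\<bar> \<le> \<gamma> ^ n * (2 * pi)" for y using \<gamma> by (intro mult_left_mono) auto
    then show ?thesis unfolding t_def using \<gamma> by (simp add: abs_mult mult.commute)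
  qed
  moreover have "summable (\<lambda>n. 2 * pi * \<gamma> ^ n)" using \<gamma> by (intro summable_mult summable_geometric) auto
  ultimately have "summable t" by (intro summable_comparison_test'[of "\<lambda>n. 2 * pi * \<gamma> ^ n" 0 t])
  then have "(\<lambda>N. \<Sum>n<N. t n) \<longlonglongrightarrow> suminf t" by (rule summable_LIMSEQ)
  moreover have "suminf t = Ssum b \<gamma> psi x i" by (simp add: Ssum_def t_def[abs_def])
  ultimately show ?thesis by (simp add: Sf)
qed

section \<open>Measurability and periodicity of the fibre measures\<close>

lemma Ssum_measurable_pair:
  assumes b: "0 < b" and \<gamma>: "0 < \<gamma>" "\<gamma> < 1"
  shows "(\<lambda>p. Ssum b \<gamma> psi (fst p) (snd p)) \<in> borel_measurable (borel \<Otimes>\<^sub>M bern b)"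
proof (rule borel_measurable_LIMSEQ_real)
  show "(\<lambda>N. Sfin b \<gamma> N (fst p) (code b N (snd p))) \<longlonglongrightarrow> Ssum b \<gamma> psi (fst p) (snd p)" for p :: "real \<times> (nat \<Rightarrow> nat)"
    by (rule Sfin_code_tendsto[OF assms])
  show "(\<lambda>p. Sfin b \<gamma> N (fst p) (code b N (snd p))) \<in> borel_measurable (borel \<Otimes>\<^sub>M bern b)" for N
    unfolding Sfin_def psi_def by measurable
qed

lemma Ssum_measurable:
  assumes b: "0 < b" and \<gamma>: "0 < \<gamma>" "\<gamma> < 1"
  shows "Ssum b \<gamma> psi x \<in> borel_measurable (bern b)"
proof -
  have "(\<lambda>i. Ssum b \<gamma> psi (fst (x, i)) (snd (x, i))) \<in> borel_measurable (bern b)"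
    by (rule measurable_compose[OF measurable_Pair1' Ssum_measurable_pair[OF assms]]) simp
  then show ?thesis by simp
qed

lemma prob_space_mfib:
  assumes b: "0 < b" and \<gamma>: "0 < \<gamma>" "\<gamma> < 1"
  shows "prob_space (mfib b \<gamma> psi x)"
  unfolding mfib_def using Ssum_measurable[OF assms]
  by (intro prob_space.prob_space_distr prob_space_bern) simp

lemma sets_mfib [simp]: "sets (mfib b \<gamma> \<psi> x) = sets borel"
  by (simp add: mfib_def)

lemma emeasure_mfib:
  assumes b: "0 < b" and \<gamma>: "0 < \<gamma>" "\<gamma> < 1" and B: "B \<in> sets borel"
  shows "emeasure (mfib b \<gamma> psi x) B = emeasure (bern b) {i. Ssum b \<gamma> psi x i \<in> B}"
  unfolding mfib_def using Ssum_measurable[OF b \<gamma>] B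
  by (subst emeasure_distr) (auto simp: vimage_def)

text \<open>Adding 1 to \<open>x\<close> turns \<open>j\<close> into \<open>j + 1\<close>, and by
  periodicity \<open>b ^ N\<close> acts like 0.\<close>

lemma Sfin_shift:
  assumes "0 < b"
  shows "(\<Sum>j<b ^ N. g (Sfin b \<gamma> N (x + 1) j)) = (\<Sum>j<b ^ N. (g (Sfin b \<gamma> N x j) :: complex))"
proof -
  have s: "Sfin b \<gamma> N (x + 1) j = Sfin b \<gamma> N x (Suc j)" for j by (simp add: Sfin_def algebra_simps)
  have p: "Sfin b \<gamma> N x (b ^ N) = Sfin b \<gamma> N x 0"
    unfolding Sfin_def
  proof (intro sum.cong refl)
    fix n assume n: "n \<in> {..<N}"
    then obtain m where m: "N = Suc n + m" by (auto simp: less_iff_Suc_add)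
    have "(x + real (b ^ N)) / real b ^ Suc n = (x + real 0) / real b ^ Suc n + real (b ^ m)"
      using assms by (simp add: m power_add field_simps)
    then show "\<gamma> ^ n * psi ((x + real (b ^ N)) / real b ^ Suc n) = \<gamma> ^ n * psi ((x + real 0) / real b ^ Suc n)"
      by (simp only: psi_periodic)
  qed
  have "(\<Sum>j<b ^ N. g (Sfin b \<gamma> N (x + 1) j)) + g (Sfin b \<gamma> N x 0) = (\<Sum>j<Suc (b ^ N). g (Sfin b \<gamma> N x j))"
    unfolding s by (subst sum.lessThan_Suc_shift) simp
  also have "\<dots> = (\<Sum>j<b ^ N. g (Sfin b \<gamma> N x j)) + g (Sfin b \<gamma> N x 0)" by (simp add: p)
  finally show ?thesis by simp
qed

text \<open>The truncated sums at \<open>x + 1\<close> are those at \<open>x\<close> permuted cyclically (the odometer).\<close>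
lemma mfib_add_1:
  assumes b: "0 < b" and \<gamma>: "0 < \<gamma>" "\<gamma> < 1"
  shows "mfib b \<gamma> psi (x + 1) = mfib b \<gamma> psi x"
proof (rule Levy_uniqueness)
  have rd: "real_distribution (mfib b \<gamma> psi x)" for x
    unfolding real_distribution_def real_distribution_axioms_def
    using prob_space_mfib[OF assms] sets_eq_imp_space_eq[OF sets_mfib] by auto
  show "real_distribution (mfib b \<gamma> psi (x + 1))" "real_distribution (mfib b \<gamma> psi x)" by (rule rd)+
  \<comment> \<open>Averages over all codes at \<open>x + 1\<close> and at \<open>x\<close> agree
    for every \<open>N\<close>; characteristic functions carry this to the limit without any map
    between digit sequences.\<close>
  have lim: "(\<lambda>N. (\<Sum>j<b ^ N. iexp (t * Sfin b \<gamma> N x j)) / of_real (real (b ^ N))) \<longlonglongrightarrow> char (mfib b \<gamma> psi x) t" for x t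
  proof -
    interpret prob_space "bern b" by (rule prob_space_bern)
    have "(\<lambda>N. \<integral>i. iexp (t * Sfin b \<gamma> N x (code b N i)) \<partial>bern b) \<longlonglongrightarrow> (\<integral>i. iexp (t * Ssum b \<gamma> psi x i) \<partial>bern b)"
    proof (rule integral_dominated_convergence[where w = "\<lambda>_. 1"])
      show "(\<lambda>i. iexp (t * Ssum b \<gamma> psi x i)) \<in> borel_measurable (bern b)"
        using Ssum_measurable[OF assms, of x] by measurable
      show "AE i in bern b. (\<lambda>N. iexp (t * Sfin b \<gamma> N x (code b N i))) \<longlonglongrightarrow> iexp (t * Ssum b \<gamma> psi x i)"
        by (intro AE_I2 tendsto_intros Sfin_code_tendsto[OF assms])
    qed auto
    moreover have "(\<integral>i. iexp (t * Sfin b \<gamma> N x (code b N i)) \<partial>bern b) = (\<Sum>j<b ^ N. iexp (t * Sfin b \<gamma> N x j)) / of_real (real (b ^ N))" for N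
      using integral_code[OF b, of "\<lambda>j. iexp (t * Sfin b \<gamma> N x j)" N] by simp
    moreover have "char (mfib b \<gamma> psi x) t = (\<integral>i. iexp (t * Ssum b \<gamma> psi x i) \<partial>bern b)"
      unfolding char_def mfib_def using Ssum_measurable[OF assms, of x]
      by (subst integral_distr) auto
    ultimately show ?thesis by simp
  qed
  show "char (mfib b \<gamma> psi (x + 1)) = char (mfib b \<gamma> psi x)"
  proof
    fix t
    show "char (mfib b \<gamma> psi (x + 1)) t = char (mfib b \<gamma> psi x) t"
      using lim[of t "x + 1"] lim[of t x] Sfin_shift[OF b, of "\<lambda>s. iexp (t * s)" \<gamma> _ x]
      by (auto intro: LIMSEQ_unique)
  qed
qed

lemma mfib_add_int:
  assumes b: "0 < b" and \<gamma>: "0 < \<gamma>" "\<gamma> < 1"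
  shows "mfib b \<gamma> psi (x + of_int n) = mfib b \<gamma> psi x"
proof (induction n rule: int_induct[of _ 0])
  case (step1 i)
  then show ?case using mfib_add_1[OF assms, of "x + of_int i"] by (simp add: add.assoc)
next
  case (step2 i)
  then show ?case using mfib_add_1[OF assms, of "x + of_int (i - 1)"] by (simp add: add.assoc)
qed simp


section \<open>The SRB measure as an image measure, and its density\<close>

definition base_measure :: "nat \<Rightarrow> (real \<times> (nat \<Rightarrow> nat)) measure" where
  "base_measure b = density lborel (indicator {0..<1}) \<Otimes>\<^sub>M bern b"

lemma nn_integral_base_measure:
  assumes f[measurable]: "f \<in> borel_measurable (borel \<Otimes>\<^sub>M bern b)"
  shows "(\<integral>\<^sup>+p. f p \<partial>base_measure b) = (\<integral>\<^sup>+x. indicator {0..<1} x * (\<integral>\<^sup>+i. f (x, i) \<partial>bern b) \<partial>lborel)"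
proof -
  interpret prob_space "bern b" by (rule prob_space_bern)
  have "sets (density lborel (indicator {0..<1::real}) \<Otimes>\<^sub>M bern b) = sets (borel \<Otimes>\<^sub>M bern b)"
    by (intro sets_pair_measure_cong) auto
  then have f': "f \<in> borel_measurable (density lborel (indicator {0..<1}) \<Otimes>\<^sub>M bern b)"
    using f measurable_cong_sets by blast
  have "(\<integral>\<^sup>+p. f p \<partial>base_measure b) = (\<integral>\<^sup>+x. \<integral>\<^sup>+i. f (x, i) \<partial>bern b \<partial>density lborel (indicator {0..<1}))"
    unfolding base_measure_def by (rule nn_integral_fst[symmetric, OF f'])
  also have "\<dots> = (\<integral>\<^sup>+x. indicator {0..<1} x * (\<integral>\<^sup>+i. f (x, i) \<partial>bern b) \<partial>lborel)"
    by (rule nn_integral_density) measurable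
  finally show ?thesis .
qed

text \<open>\<open>measure_of\<close> has the intended values only if these are countably additive;
  agreement with an image measure supplies that.\<close>

lemma srb_eq_distr:
  assumes b: "0 < b" and \<gamma>: "0 < \<gamma>" "\<gamma> < 1"
  shows "srb b \<gamma> psi = distr (base_measure b) borel (\<lambda>p. (fst p, Ssum b \<gamma> psi (fst p) (snd p)))"
proof -
  let ?F = "\<lambda>p. (fst p, Ssum b \<gamma> psi (fst p) (snd p))"
  let ?D = "distr (base_measure b) borel ?F"
  have sets: "sets (base_measure b) = sets (borel \<Otimes>\<^sub>M bern b)"
    unfolding base_measure_def by (intro sets_pair_measure_cong) auto
  have F: "?F \<in> (borel \<Otimes>\<^sub>M bern b) \<rightarrow>\<^sub>M borel"
    using Ssum_measurable_pair[OF assms] by (simp add: borel_prod[symmetric])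
  then have F': "?F \<in> base_measure b \<rightarrow>\<^sub>M borel" using measurable_cong_sets[OF sets refl] by blast
  have em: "emeasure ?D B = (\<integral>\<^sup>+x. indicator {0..<1} x * emeasure (mfib b \<gamma> psi x) (Pair x -` B) \<partial>lborel)"
    if B: "B \<in> sets borel" for B
  proof -
    have "emeasure ?D B = (\<integral>\<^sup>+z. indicator B z \<partial>?D)" using B by simp
    also have "\<dots> = (\<integral>\<^sup>+p. indicator B (?F p) \<partial>base_measure b)"
      using B by (intro nn_integral_distr[OF F']) auto
    also have "\<dots> = (\<integral>\<^sup>+x. indicator {0..<1} x * (\<integral>\<^sup>+i. indicator B (?F (x, i)) \<partial>bern b) \<partial>lborel)"
      using B by (intro nn_integral_base_measure measurable_compose[OF F]) auto
    also have "\<dots> = (\<integral>\<^sup>+x. indicator {0..<1} x * emeasure (mfib b \<gamma> psi x) (Pair x -` B) \<partial>lborel)"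
    proof (intro nn_integral_cong arg_cong2[of _ _ _ _ "(*)"] refl)
      fix x
      have Bx: "Pair x -` B \<in> sets borel"
      proof -
        have "B \<in> sets (borel \<Otimes>\<^sub>M borel)" using B unfolding borel_prod .
        then show ?thesis by (rule sets_Pair1)
      qed
      have m: "{i. Ssum b \<gamma> psi x i \<in> Pair x -` B} \<in> sets (bern b)"
        using measurable_sets[OF Ssum_measurable[OF assms, of x] Bx] by (simp add: vimage_def)
      have "(\<integral>\<^sup>+i. indicator B (?F (x, i)) \<partial>bern b) = (\<integral>\<^sup>+i. indicator {i. Ssum b \<gamma> psi x i \<in> Pair x -` B} i \<partial>bern b)"
        by (intro nn_integral_cong) (auto simp: indicator_def)
      also have "\<dots> = emeasure (mfib b \<gamma> psi x) (Pair x -` B)"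
        using m by (simp add: emeasure_mfib[OF assms Bx])
      finally show "(\<integral>\<^sup>+i. indicator B (?F (x, i)) \<partial>bern b) = emeasure (mfib b \<gamma> psi x) (Pair x -` B)" .
    qed
    finally show ?thesis .
  qed
  have "srb b \<gamma> psi = measure_of UNIV (sets borel) (emeasure ?D)"
    unfolding srb_def by (rule measure_of_eq) (auto simp: em sets.sigma_sets_eq[of borel, simplified])
  also have "\<dots> = measure_of (space ?D) (sets ?D) (emeasure ?D)" by simp
  also have "\<dots> = ?D" by (rule measure_of_of_measure)
  finally show ?thesis .
qed

lemma sets_srb [simp]: "sets (srb b \<gamma> \<psi>) = sets borel"
  unfolding srb_def by (simp add: sets.sigma_sets_eq[of borel, simplified])

lemma emeasure_srb:
  assumes b: "0 < b" and \<gamma>: "0 < \<gamma>" "\<gamma> < 1" and A: "A \<in> sets borel"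
  shows "emeasure (srb b \<gamma> psi) A = (\<integral>\<^sup>+x. indicator {0..<1} x * (\<integral>\<^sup>+i. indicator A (x, Ssum b \<gamma> psi x i) \<partial>bern b) \<partial>lborel)"
proof -
  let ?F = "\<lambda>p. (fst p, Ssum b \<gamma> psi (fst p) (snd p))"
  have sets: "sets (base_measure b) = sets (borel \<Otimes>\<^sub>M bern b)"
    unfolding base_measure_def by (intro sets_pair_measure_cong) auto
  have F: "?F \<in> (borel \<Otimes>\<^sub>M bern b) \<rightarrow>\<^sub>M borel"
    using Ssum_measurable_pair[OF b \<gamma>] by (simp add: borel_prod[symmetric])
  then have F': "?F \<in> base_measure b \<rightarrow>\<^sub>M borel" using measurable_cong_sets[OF sets refl] by blast
  have "emeasure (srb b \<gamma> psi) A = (\<integral>\<^sup>+z. indicator A z \<partial>srb b \<gamma> psi)"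
    using A by simp
  also have "\<dots> = (\<integral>\<^sup>+p. indicator A (?F p) \<partial>base_measure b)"
    unfolding srb_eq_distr[OF b \<gamma>] using A by (intro nn_integral_distr[OF F']) auto
  also have "\<dots> = (\<integral>\<^sup>+x. indicator {0..<1} x * (\<integral>\<^sup>+i. indicator A (?F (x, i)) \<partial>bern b) \<partial>lborel)"
    using A by (intro nn_integral_base_measure measurable_compose[OF F]) auto
  finally show ?thesis by simp
qed

lemma finite_measure_srb:
  assumes b: "0 < b" and \<gamma>: "0 < \<gamma>" "\<gamma> < 1"
  shows "finite_measure (srb b \<gamma> psi)"
proof -
  have "emeasure (srb b \<gamma> psi) UNIV = 1"
    using emeasure_srb[OF assms, of UNIV] prob_space.emeasure_space_1[OF prob_space_bern, of b] by simp
  then show ?thesis using sets_eq_imp_space_eq[OF sets_srb, of b \<gamma> psi] by (intro finite_measureI) simp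
qed

text \<open>The approximating densities are the equally weighted truncated sums smeared over length
  \<open>r n\<close>. \<open>L2_bounded\<close> bounds them in L2, and the lower bound on open sets
  is Fatou's lemma.\<close>

lemma srb_has_L2_density:
  assumes b: "0 < b" and \<gamma>: "0 < \<gamma>" "\<gamma> < 1" and bdd: "L2_bounded b \<gamma>"
  shows "\<exists>f C. f \<in> borel_measurable borel \<and> (\<forall>z. 0 \<le> f z) \<and> (\<integral>\<^sup>+z. ennreal ((f z)\<^sup>2) \<partial>lborel) \<le> ennreal C
     \<and> srb b \<gamma> psi = density lborel (\<lambda>z. ennreal (f z))"
proof -
  obtain C r0 N0 where C: "0 \<le> C" and r0: "0 < r0" and bound: "\<And>n.
     (\<integral>\<^sup>+x. indicator {0..<1} x * energy (Sfin b \<gamma> (N0 + n) x) (r0 * \<gamma> ^ n) {..<b ^ (N0 + n)} {..<b ^ (N0 + n)} \<partial>lborel)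
       \<le> ennreal (C * (r0 * \<gamma> ^ n * real (b ^ (N0 + n)))\<^sup>2)"
    using bdd unfolding L2_bounded_def by blast
  define r where "r n = r0 * \<gamma> ^ n" for n
  have r: "0 < r n" for n using r0 \<gamma> by (simp add: r_def)
  have r_lim: "r \<longlonglongrightarrow> 0"
  proof -
    have "(\<lambda>n. r0 * \<gamma> ^ n) \<longlonglongrightarrow> r0 * 0" using \<gamma> by (intro tendsto_mult tendsto_const LIMSEQ_power_zero) auto
    then show ?thesis by (simp add: r_def[abs_def])
  qed
  define Z where "Z n = r n * real (b ^ (N0 + n))" for n
  have Z: "0 < Z n" for n using r b by (simp add: Z_def)
  define cov where "cov n x = cover (Sfin b \<gamma> (N0 + n) x) (r n) {..<b ^ (N0 + n)}" for n x
  define f where "f n z = indicator {0..<1} (fst z) * (cov n (fst z) (snd z) / Z n)" for n and z :: "real \<times> real"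
  have covm[measurable]: "(\<lambda>p. cov n (fst p) (snd p)) \<in> borel_measurable (borel \<Otimes>\<^sub>M borel)" for n
  proof -
    have "(\<lambda>p. cov n (fst p) (snd p)) =
      (\<lambda>p. \<Sum>j<b ^ (N0 + n). if Sfin b \<gamma> (N0 + n) (fst p) j \<le> snd p \<and> snd p \<le> Sfin b \<gamma> (N0 + n) (fst p) j + r n then 1 else 0)"
      unfolding cov_def cover_def by (intro ext sum.cong refl) (auto simp: indicator_def)
    also have "\<dots> \<in> borel_measurable (borel \<Otimes>\<^sub>M borel)" by measurable
    finally show ?thesis .
  qed
  have fm[measurable]: "f n \<in> borel_measurable borel" for n
  proof -
    have "f n \<in> borel_measurable (borel \<Otimes>\<^sub>M borel)" unfolding f_def by measurable
    then show ?thesis by (simp add: borel_prod)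
  qed
  have cov0: "0 \<le> cov n x y" for n x y by (simp add: cov_def cover_nonneg)
  have f0: "0 \<le> f n z" for n z using Z[of n] cov0 by (simp add: f_def)
  have fubini: "(\<integral>\<^sup>+z. g z \<partial>lborel) = (\<integral>\<^sup>+x. \<integral>\<^sup>+y. g (x, y) \<partial>lborel \<partial>lborel)"
    if "g \<in> borel_measurable borel" for g :: "real \<times> real \<Rightarrow> ennreal"
    unfolding lborel_prod[symmetric] using that
    by (intro lborel.nn_integral_fst[symmetric]) (simp add: lborel_prod)
  have L2: "(\<integral>\<^sup>+z. ennreal ((f n z)\<^sup>2) \<partial>lborel) \<le> ennreal C" for n
  proof -
    have "(\<integral>\<^sup>+z. ennreal ((f n z)\<^sup>2) \<partial>lborel) = (\<integral>\<^sup>+x. \<integral>\<^sup>+y. ennreal ((f n (x, y))\<^sup>2) \<partial>lborel \<partial>lborel)"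
      by (rule fubini) measurable
    also have "\<dots> = (\<integral>\<^sup>+x. ennreal (1 / (Z n)\<^sup>2) * (indicator {0..<1} x * energy (Sfin b \<gamma> (N0 + n) x) (r n) {..<b ^ (N0 + n)} {..<b ^ (N0 + n)}) \<partial>lborel)"
    proof (intro nn_integral_cong)
      fix x :: real
      have "(\<integral>\<^sup>+y. ennreal ((f n (x, y))\<^sup>2) \<partial>lborel) = (\<integral>\<^sup>+y. (ennreal (1 / (Z n)\<^sup>2) * indicator {0..<1} x) * ennreal (cov n x y * cov n x y) \<partial>lborel)"
        by (intro nn_integral_cong) (auto simp: f_def indicator_def power2_eq_square ennreal_mult[symmetric] cov0)
      also have "\<dots> = (ennreal (1 / (Z n)\<^sup>2) * indicator {0..<1} x) * energy (Sfin b \<gamma> (N0 + n) x) (r n) {..<b ^ (N0 + n)} {..<b ^ (N0 + n)}"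
        unfolding energy_def cov_def by (rule nn_integral_cmult) measurable
      finally show "(\<integral>\<^sup>+y. ennreal ((f n (x, y))\<^sup>2) \<partial>lborel) = ennreal (1 / (Z n)\<^sup>2) * (indicator {0..<1} x * energy (Sfin b \<gamma> (N0 + n) x) (r n) {..<b ^ (N0 + n)} {..<b ^ (N0 + n)})"
        by (simp add: mult.assoc)
    qed
    also have "\<dots> = ennreal (1 / (Z n)\<^sup>2) * (\<integral>\<^sup>+x. indicator {0..<1} x * energy (Sfin b \<gamma> (N0 + n) x) (r n) {..<b ^ (N0 + n)} {..<b ^ (N0 + n)} \<partial>lborel)"
      by (rule nn_integral_cmult) measurable
    also have "\<dots> \<le> ennreal (1 / (Z n)\<^sup>2) * ennreal (C * (Z n)\<^sup>2)"
      using bound[of n] by (intro mult_left_mono) (simp_all add: r_def Z_def)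
    also have "\<dots> = ennreal C" using Z[of n] C by (simp add: ennreal_mult[symmetric])
    finally show ?thesis .
  qed
  have lim: "emeasure (srb b \<gamma> psi) U \<le> liminf (\<lambda>n. \<integral>\<^sup>+z. indicator U z * ennreal (f n z) \<partial>lborel)" if U: "open U" for U
  proof -
    have Um[measurable]: "U \<in> sets borel" using U by auto
    have Ux: "(\<lambda>y. indicator U (x, y) :: ennreal) \<in> borel_measurable borel" for x
      by (rule measurable_compose[OF _ borel_measurable_indicator[OF Um]]) (auto simp: borel_prod[symmetric])
    \<comment> \<open>The proportion of the interval above
      \<open>Sfin b \<gamma> (N0 + n) x j\<close> that lies in the fibre of \<open>U\<close>; it is
      eventually 1 whenever the limit point lies in the open set \<open>U\<close>.\<close>
    define g where "g n x j = (\<integral>\<^sup>+y. indicator U (x, y) * indicator {Sfin b \<gamma> (N0 + n) x j..Sfin b \<gamma> (N0 + n) x j + r n} y \<partial>lborel) / ennreal (r n)" for n x j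
    have gm[measurable]: "(\<lambda>x. g n x j) \<in> borel_measurable borel" for n j
    proof -
      have "(\<lambda>p. indicator U p * (if Sfin b \<gamma> (N0 + n) (fst p) j \<le> snd p \<and> snd p \<le> Sfin b \<gamma> (N0 + n) (fst p) j + r n then 1 else 0 :: ennreal)) \<in> borel_measurable (borel \<Otimes>\<^sub>M lborel)"
      proof -
        have "indicator U \<in> borel_measurable (borel \<Otimes>\<^sub>M lborel :: (real \<times> real) measure)"
        proof -
          have "sets (borel \<Otimes>\<^sub>M lborel :: (real \<times> real) measure) = sets borel"
            unfolding borel_prod[symmetric] by (rule sets_pair_measure_cong) auto
          then show ?thesis using Um by (intro borel_measurable_indicator) simp
        qed
        then show ?thesis by measurable
      qed
      then have "(\<lambda>x. \<integral>\<^sup>+y. indicator U (x, y) * (if Sfin b \<gamma> (N0 + n) x j \<le> y \<and> y \<le> Sfin b \<gamma> (N0 + n) x j + r n then 1 else 0 :: ennreal) \<partial>lborel) \<in> borel_measurable borel"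
        using lborel.borel_measurable_nn_integral_fst by fastforce
      moreover have "(\<lambda>x. \<integral>\<^sup>+y. indicator U (x, y) * (if Sfin b \<gamma> (N0 + n) x j \<le> y \<and> y \<le> Sfin b \<gamma> (N0 + n) x j + r n then 1 else 0 :: ennreal) \<partial>lborel)
         = (\<lambda>x. \<integral>\<^sup>+y. indicator U (x, y) * indicator {Sfin b \<gamma> (N0 + n) x j..Sfin b \<gamma> (N0 + n) x j + r n} y \<partial>lborel)"
        by (intro ext nn_integral_cong) (auto simp: indicator_def)
      ultimately have "(\<lambda>x. \<integral>\<^sup>+y. indicator U (x, y) * indicator {Sfin b \<gamma> (N0 + n) x j..Sfin b \<gamma> (N0 + n) x j + r n} y \<partial>lborel) \<in> borel_measurable borel"
        by simp
      then show ?thesis unfolding g_def divide_ennreal_def by (intro borel_measurable_times_ennreal) simp_all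
    qed
    have int: "(\<integral>\<^sup>+z. indicator U z * ennreal (f n z) \<partial>lborel) = (\<integral>\<^sup>+x. indicator {0..<1} x * (\<integral>\<^sup>+i. g n x (code b (N0 + n) i) \<partial>bern b) \<partial>lborel)" for n
    proof -
      have "(\<integral>\<^sup>+z. indicator U z * ennreal (f n z) \<partial>lborel) = (\<integral>\<^sup>+x. \<integral>\<^sup>+y. indicator U (x, y) * ennreal (f n (x, y)) \<partial>lborel \<partial>lborel)"
        by (rule fubini) measurable
      also have "\<dots> = (\<integral>\<^sup>+x. indicator {0..<1} x * (\<integral>\<^sup>+i. g n x (code b (N0 + n) i) \<partial>bern b) \<partial>lborel)"
      proof (intro nn_integral_cong)
        fix x :: real
        let ?J = "\<lambda>j. {Sfin b \<gamma> (N0 + n) x j..Sfin b \<gamma> (N0 + n) x j + r n}"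
        have "(\<integral>\<^sup>+y. indicator U (x, y) * ennreal (f n (x, y)) \<partial>lborel)
          = (\<integral>\<^sup>+y. (indicator {0..<1} x * ennreal (1 / Z n)) * (\<Sum>j<b ^ (N0 + n). indicator U (x, y) * indicator (?J j) y) \<partial>lborel)"
        proof (intro nn_integral_cong)
          fix y
          have "ennreal (cov n x y / Z n) = ennreal (1 / Z n) * ennreal (cov n x y)"
            using Z[of n] cov0 by (simp add: ennreal_mult[symmetric])
          also have "ennreal (cov n x y) = (\<Sum>j<b ^ (N0 + n). indicator (?J j) y)"
            unfolding cov_def cover_def by (subst sum_ennreal[symmetric])
              (auto simp: indicator_def ennreal_of_nat_eq_real_of_nat intro!: sum.cong)
          finally show "indicator U (x, y) * ennreal (f n (x, y)) = (indicator {0..<1} x * ennreal (1 / Z n)) * (\<Sum>j<b ^ (N0 + n). indicator U (x, y) * indicator (?J j) y)"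
            by (auto simp: f_def indicator_def sum_distrib_left)
        qed
        also have "\<dots> = (indicator {0..<1} x * ennreal (1 / Z n)) * (\<Sum>j<b ^ (N0 + n). \<integral>\<^sup>+y. indicator U (x, y) * indicator (?J j) y \<partial>lborel)"
        proof -
          have "(\<lambda>y. indicator U (x, y) * indicator (?J j) y :: ennreal) \<in> borel_measurable lborel" for j
            using Ux[of x] by (intro borel_measurable_times_ennreal) auto
          then show ?thesis by (subst nn_integral_cmult) (auto intro!: borel_measurable_sum simp: nn_integral_sum simp del: sum_mult_indicator sum_indicator_mult)
        qed
        also have "\<dots> = indicator {0..<1} x * ((\<Sum>j<b ^ (N0 + n). g n x j) / ennreal (real (b ^ (N0 + n))))"
        proof -
          have "ennreal (1 / Z n) = inverse (ennreal (r n)) * inverse (ennreal (real (b ^ (N0 + n))))"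
            using r[of n] b by (simp add: Z_def inverse_ennreal ennreal_mult[symmetric] divide_inverse del: of_nat_power)
          then show ?thesis
            by (simp add: g_def divide_ennreal_def sum_distrib_right[symmetric] sum_distrib_left[symmetric] mult_ac del: of_nat_power)
        qed
        also have "\<dots> = indicator {0..<1} x * (\<integral>\<^sup>+i. g n x (code b (N0 + n) i) \<partial>bern b)"
          by (subst nn_integral_code[OF b]) simp
        finally show "(\<integral>\<^sup>+y. indicator U (x, y) * ennreal (f n (x, y)) \<partial>lborel) = indicator {0..<1} x * (\<integral>\<^sup>+i. g n x (code b (N0 + n) i) \<partial>bern b)" .
      qed
      finally show ?thesis .
    qed
    have pt: "indicator U (x, Ssum b \<gamma> psi x i) \<le> liminf (\<lambda>n. g n x (code b (N0 + n) i))" for x i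
    proof (cases "(x, Ssum b \<gamma> psi x i) \<in> U")
      case True
      define s where "s n = Sfin b \<gamma> (N0 + n) x (code b (N0 + n) i)" for n
      have "(\<lambda>n. Sfin b \<gamma> n x (code b n i)) \<longlonglongrightarrow> Ssum b \<gamma> psi x i" by (rule Sfin_code_tendsto[OF b \<gamma>])
      then have s: "s \<longlonglongrightarrow> Ssum b \<gamma> psi x i"
        using LIMSEQ_ignore_initial_segment[of _ _ N0] by (force simp: s_def[abs_def] add.commute)
      obtain e where e: "0 < e" "\<And>z. dist z (x, Ssum b \<gamma> psi x i) < e \<Longrightarrow> z \<in> U"
        using U True unfolding open_dist by blast
      have "\<forall>\<^sub>F n in sequentially. \<bar>s n - Ssum b \<gamma> psi x i\<bar> < e / 2"
        using tendstoD[OF s, of "e / 2"] e(1) by (simp add: dist_real_def)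
      moreover have "\<forall>\<^sub>F n in sequentially. \<bar>r n\<bar> < e / 2"
        using tendstoD[OF r_lim, of "e / 2"] e(1) by (simp add: dist_real_def)
      ultimately have ev: "\<forall>\<^sub>F n in sequentially. 1 \<le> g n x (code b (N0 + n) i)"
      proof eventually_elim
        case (elim n)
        have "(x, y) \<in> U" if y: "y \<in> {s n..s n + r n}" for y
        proof (rule e(2))
          have "\<bar>y - Ssum b \<gamma> psi x i\<bar> < e" using elim y unfolding atLeastAtMost_iff by linarith
          then show "dist (x, y) (x, Ssum b \<gamma> psi x i) < e" by (simp add: dist_Pair_Pair dist_real_def)
        qed
        then have "(\<integral>\<^sup>+y. indicator U (x, y) * indicator {s n..s n + r n} y \<partial>lborel) = (\<integral>\<^sup>+y. indicator {s n..s n + r n} y \<partial>lborel)"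
          by (intro nn_integral_cong) (auto simp: indicator_def)
        also have "\<dots> = ennreal (r n)" using r[of n] by simp
        finally show ?case using r[of n] by (simp add: g_def s_def[symmetric] ennreal_divide_self)
      qed
      have "1 \<le> liminf (\<lambda>n. g n x (code b (N0 + n) i))" by (rule Liminf_bounded[OF ev])
      then show ?thesis using True by simp
    qed simp
    have gcm[measurable]: "(\<lambda>i. g n x (code b (N0 + n) i)) \<in> borel_measurable (bern b)" for n x
      by (rule measurable_compose[OF code_measurable]) simp
    have gint[measurable]: "(\<lambda>x. \<integral>\<^sup>+i. g n x (code b (N0 + n) i) \<partial>bern b) \<in> borel_measurable borel" for n
      unfolding nn_integral_code[OF b] by measurable
    have "emeasure (srb b \<gamma> psi) U = (\<integral>\<^sup>+x. indicator {0..<1} x * (\<integral>\<^sup>+i. indicator U (x, Ssum b \<gamma> psi x i) \<partial>bern b) \<partial>lborel)"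
      by (rule emeasure_srb[OF b \<gamma> Um])
    also have "\<dots> \<le> (\<integral>\<^sup>+x. liminf (\<lambda>n. indicator {0..<1} x * (\<integral>\<^sup>+i. g n x (code b (N0 + n) i) \<partial>bern b)) \<partial>lborel)"
    proof (intro nn_integral_mono)
      fix x :: real
      have "(\<integral>\<^sup>+i. indicator U (x, Ssum b \<gamma> psi x i) \<partial>bern b) \<le> (\<integral>\<^sup>+i. liminf (\<lambda>n. g n x (code b (N0 + n) i)) \<partial>bern b)"
        by (intro nn_integral_mono pt)
      also have "\<dots> \<le> liminf (\<lambda>n. \<integral>\<^sup>+i. g n x (code b (N0 + n) i) \<partial>bern b)"
        by (rule nn_integral_liminf) simp
      finally show "indicator {0..<1} x * (\<integral>\<^sup>+i. indicator U (x, Ssum b \<gamma> psi x i) \<partial>bern b)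
        \<le> liminf (\<lambda>n. indicator {0..<1} x * (\<integral>\<^sup>+i. g n x (code b (N0 + n) i) \<partial>bern b))"
        by (auto simp: indicator_def)
    qed
    also have "\<dots> \<le> liminf (\<lambda>n. \<integral>\<^sup>+x. indicator {0..<1} x * (\<integral>\<^sup>+i. g n x (code b (N0 + n) i) \<partial>bern b) \<partial>lborel)"
      by (rule nn_integral_liminf) measurable
    finally show ?thesis unfolding int .
  qed
  have "\<exists>g. g \<in> borel_measurable borel \<and> (\<forall>x. 0 \<le> g x) \<and>
           (\<integral>\<^sup>+x. ennreal ((g x)\<^sup>2) \<partial>lborel) \<le> ennreal C \<and> srb b \<gamma> psi = density lborel (\<lambda>x. ennreal (g x))"
    by (rule density_of_L2_approximation[OF finite_measure_srb[OF b \<gamma>] sets_srb fm f0 C L2 lim]) auto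
  then show ?thesis by blast
qed


section \<open>From the density of the SRB measure to densities of the fibre measures\<close>

lemma AE_lborel_translate:
  fixes c :: real
  assumes "AE x in lborel. P x"
  shows "AE x in lborel. P (c + x)"
proof -
  obtain N where N: "{x \<in> space lborel. \<not> P x} \<subseteq> N" "N \<in> sets lborel" "emeasure lborel N = 0"
    using assms by (auto elim: AE_E)
  have "AE x in lborel. x \<notin> N" using N by (intro AE_not_in) (auto simp: null_sets_def)
  then have "AE x in distr lborel borel ((+) c). x \<notin> N" unfolding lborel_distr_plus .
  then have "AE x in lborel. c + x \<notin> N"
    using N by (subst (asm) AE_distr_iff) auto
  then show ?thesis using N by (auto elim!: eventually_mono)
qed

text \<open>Countably many half-lines suffice, so that the exceptional null sets of
  \<open>x\<close>, one for each half-line, can be united.\<close>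

lemma measure_eqI_dyadic_greaterThan:
  fixes M N :: "real measure"
  assumes sets: "sets M = sets borel" "sets N = sets borel" and fin: "finite_measure M"
    and eq: "\<And>q n. emeasure M {of_int q / 2 ^ n<..} = emeasure N {of_int q / 2 ^ n<..}"
  shows "M = N"
proof (rule measure_eqI_lessThan[OF sets])
  show "emeasure M {x<..} < \<infinity>" for x using finite_measure.emeasure_finite[OF fin] by (simp add: less_top)
  show "emeasure M {x<..} = emeasure N {x<..}" for x :: real
  proof -
    define q where "q n = of_int (\<lfloor>x * 2 ^ n\<rfloor> + 1) / (2 ^ n :: real)" for n :: nat
    have q1: "x < q n" for n
    proof -
      have "x * 2 ^ n < of_int (\<lfloor>x * 2 ^ n\<rfloor> + 1)" by linarith
      then show ?thesis by (simp add: q_def field_simps)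
    qed
    have q2: "q n \<le> x + 1 / 2 ^ n" for n
    proof -
      have "of_int (\<lfloor>x * 2 ^ n\<rfloor> + 1) \<le> x * 2 ^ n + 1" by linarith
      then show ?thesis by (simp add: q_def field_simps)
    qed
    have dec: "q (Suc n) \<le> q n" for n
    proof -
      have "\<lfloor>x * 2 ^ Suc n\<rfloor> + 1 \<le> 2 * (\<lfloor>x * 2 ^ n\<rfloor> + 1)"
        by (simp add: floor_less_iff mult.assoc[symmetric]) linarith
      then have "(of_int (\<lfloor>x * 2 ^ Suc n\<rfloor> + 1) :: real) \<le> 2 * of_int (\<lfloor>x * 2 ^ n\<rfloor> + 1)" by linarith
      then have "of_int (\<lfloor>x * 2 ^ Suc n\<rfloor> + 1) / (2 * 2 ^ n) \<le> 2 * of_int (\<lfloor>x * 2 ^ n\<rfloor> + 1) / (2 * 2 ^ n :: real)"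
        by (intro divide_right_mono) auto
      moreover have "2 * y / (2 * 2 ^ n) = y / 2 ^ n" for y :: real by simp
      ultimately show ?thesis by (simp only: q_def power_Suc)
    qed
    have un: "{x<..} = (\<Union>n. {q n<..})"
    proof (intro equalityI subsetI)
      fix y assume "y \<in> {x<..}"
      then obtain n where "1 / 2 ^ n < y - x"
        using real_arch_pow_inv[of "y - x" "1 / 2"] by (auto simp: power_divide)
      then show "y \<in> (\<Union>n. {q n<..})" using q2[of n] by (intro UN_I[of n]) auto
    qed (use q1 less_trans in blast)
    have inc: "incseq (\<lambda>n. {q n<..})" using dec by (intro incseq_SucI) (auto intro: le_less_trans)
    have sup: "(SUP n. emeasure X {q n<..}) = emeasure X (\<Union>n. {q n<..})" if "sets X = sets borel" for X
    proof (rule SUP_emeasure_incseq[OF _ inc])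
      show "range (\<lambda>n. {q n<..}) \<subseteq> sets X" unfolding that by auto
    qed
    have "(SUP n. emeasure M {q n<..}) = (SUP n. emeasure N {q n<..})"
      unfolding q_def eq ..
    then have "emeasure M (\<Union>n. {q n<..}) = emeasure N (\<Union>n. {q n<..})"
      unfolding sup[OF sets(1)] sup[OF sets(2)] .
    then show ?thesis by (subst (1 2) un)
  qed
qed

theorem L2_density_of_bounded:
  fixes b :: nat and \<gamma> :: real
  assumes b: "2 \<le> b" and \<gamma>: "0 < \<gamma>" "\<gamma> < 1" and bdd: "L2_bounded b \<gamma>"
  shows "(\<exists>f :: real \<times> real \<Rightarrow> real.
            f \<in> borel_measurable borel \<and> (\<forall>z. 0 \<le> f z) \<and>
            (\<forall>x y. x \<notin> {0..<1} \<longrightarrow> f (x, y) = 0) \<and>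
            integrable lborel (\<lambda>z. (f z)\<^sup>2) \<and>
            srb b \<gamma> psi = density lborel (\<lambda>z. ennreal (f z)))
       \<and> (AE x in lborel. \<exists>g :: real \<Rightarrow> real.
            g \<in> borel_measurable borel \<and> (\<forall>y. 0 \<le> g y) \<and>
            integrable lborel (\<lambda>y. (g y)\<^sup>2) \<and>
            mfib b \<gamma> psi x = density lborel (\<lambda>y. ennreal (g y)))"
proof -
  have b0: "0 < b" using b by simp
  obtain f0 C where f0[measurable]: "f0 \<in> borel_measurable borel" and f0_nonneg: "\<And>z. 0 \<le> f0 z"
    and f0_L2: "(\<integral>\<^sup>+z. ennreal ((f0 z)\<^sup>2) \<partial>lborel) \<le> ennreal C" and f0_srb: "srb b \<gamma> psi = density lborel (\<lambda>z. ennreal (f0 z))"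
    using srb_has_L2_density[OF b0 \<gamma> bdd] by blast
  \<comment> \<open>\<open>f0\<close> is determined only almost everywhere; the cut-off gives the
    pointwise vanishing outside the strip that is claimed.\<close>
  define f where "f z = indicator ({0..<1} \<times> UNIV) z * f0 z" for z :: "real \<times> real"
  have strip: "{0..<1::real} \<times> (UNIV::real set) \<in> sets borel"
    unfolding borel_prod[symmetric] by (rule pair_measureI) auto
  have f[measurable]: "f \<in> borel_measurable borel" unfolding f_def using strip by measurable
  have f_nonneg: "0 \<le> f z" for z using f0_nonneg by (simp add: f_def)
  have f_L2: "(\<integral>\<^sup>+z. ennreal ((f z)\<^sup>2) \<partial>lborel) \<le> ennreal C"
    by (rule order_trans[OF nn_integral_mono f0_L2]) (auto simp: f_def indicator_def)
  have f_srb: "srb b \<gamma> psi = density lborel (\<lambda>z. ennreal (f z))"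
  proof (rule measure_eqI)
    fix A assume "A \<in> sets (srb b \<gamma> psi)"
    then have A[measurable]: "A \<in> sets borel" by simp
    have AS: "A \<inter> {0..<1} \<times> UNIV \<in> sets borel" using A strip by auto
    have "emeasure (srb b \<gamma> psi) A = emeasure (srb b \<gamma> psi) (A \<inter> {0..<1} \<times> UNIV)"
      unfolding emeasure_srb[OF b0 \<gamma> A] emeasure_srb[OF b0 \<gamma> AS]
      by (intro nn_integral_cong) (auto simp: indicator_def)
    also have "\<dots> = (\<integral>\<^sup>+z. ennreal (f0 z) * indicator (A \<inter> {0..<1} \<times> UNIV) z \<partial>lborel)"
      unfolding f0_srb using AS by (subst emeasure_density) auto
    also have "\<dots> = (\<integral>\<^sup>+z. ennreal (f z) * indicator A z \<partial>lborel)"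
      by (intro nn_integral_cong) (auto simp: f_def indicator_def)
    also have "\<dots> = emeasure (density lborel (\<lambda>z. ennreal (f z))) A" by (subst emeasure_density) auto
    finally show "emeasure (srb b \<gamma> psi) A = emeasure (density lborel (\<lambda>z. ennreal (f z))) A" .
  qed simp
  have f_int: "integrable lborel (\<lambda>z. (f z)\<^sup>2)"
    by (rule integrableI_bounded) (use f_L2 in \<open>auto simp: power2_eq_square le_less_trans[OF _ ennreal_less_top]\<close>)
  have fubini: "(\<integral>\<^sup>+z. g z \<partial>lborel) = (\<integral>\<^sup>+x. \<integral>\<^sup>+y. g (x, y) \<partial>lborel \<partial>lborel)"
    and fubini_meas: "(\<lambda>x. \<integral>\<^sup>+y. g (x, y) \<partial>lborel) \<in> borel_measurable lborel"
    if "g \<in> borel_measurable borel" for g :: "real \<times> real \<Rightarrow> ennreal"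
  proof -
    have g: "g \<in> borel_measurable (lborel \<Otimes>\<^sub>M lborel)" using that by (simp add: lborel_prod)
    show "(\<integral>\<^sup>+z. g z \<partial>lborel) = (\<integral>\<^sup>+x. \<integral>\<^sup>+y. g (x, y) \<partial>lborel \<partial>lborel)"
      unfolding lborel_prod[symmetric] by (rule lborel.nn_integral_fst[symmetric, OF g])
    show "(\<lambda>x. \<integral>\<^sup>+y. g (x, y) \<partial>lborel) \<in> borel_measurable lborel"
      by (rule lborel.borel_measurable_nn_integral_fst[OF g])
  qed
  have fx[measurable]: "(\<lambda>y. f (x, y)) \<in> borel_measurable borel" for x
    by (rule measurable_compose[OF _ f]) (auto simp: borel_prod[symmetric])
  \<comment> \<open>For fixed \<open>a\<close> both sides are densities in \<open>x\<close> of the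
    measure that assigns to \<open>A\<close> the \<open>srb\<close> mass of
    \<open>A \<times> {a<..}\<close>, and densities are unique almost everywhere.\<close>
  have tail: "AE x in lborel. indicator {0..<1} x * emeasure (mfib b \<gamma> psi x) {a<..} = (\<integral>\<^sup>+y. ennreal (f (x, y)) * indicator {a<..} y \<partial>lborel)" for a
  proof (rule sigma_finite_measure.density_unique2[OF sigma_finite_lborel])
    have half: "UNIV \<times> {a<..} \<in> sets (borel :: (real \<times> real) measure)"
      unfolding borel_prod[symmetric] by (rule pair_measureI) auto
    have F: "(\<lambda>p. indicator (UNIV \<times> {a<..}) (fst p, Ssum b \<gamma> psi (fst p) (snd p)) :: ennreal) \<in> borel_measurable (borel \<Otimes>\<^sub>M bern b)"
      using Ssum_measurable_pair[OF b0 \<gamma>]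
      by (intro measurable_compose[OF _ borel_measurable_indicator[OF half]]) (auto simp: borel_prod[symmetric])
    interpret B: prob_space "bern b" by (rule prob_space_bern)
    have em: "emeasure (mfib b \<gamma> psi x) {a<..} = (\<integral>\<^sup>+i. indicator (UNIV \<times> {a<..}) (x, Ssum b \<gamma> psi x i) \<partial>bern b)" for x
    proof -
      have m: "{i. Ssum b \<gamma> psi x i \<in> {a<..}} \<in> sets (bern b)"
        using measurable_sets[OF Ssum_measurable[OF b0 \<gamma>, of x], of "{a<..}"] by (simp add: vimage_def)
      have "emeasure (mfib b \<gamma> psi x) {a<..} = (\<integral>\<^sup>+i. indicator {i. Ssum b \<gamma> psi x i \<in> {a<..}} i \<partial>bern b)"
        using m by (simp add: emeasure_mfib[OF b0 \<gamma>])
      then show ?thesis by (simp add: indicator_def)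
    qed
    show m1: "(\<lambda>x. indicator {0..<1} x * emeasure (mfib b \<gamma> psi x) {a<..}) \<in> borel_measurable lborel"
      using B.borel_measurable_nn_integral_fst[OF F] unfolding em by (simp add: borel_measurable_times_ennreal)
    have fh: "(\<lambda>z. ennreal (f z) * indicator (UNIV \<times> {a<..}) z) \<in> borel_measurable borel"
      using half by (intro borel_measurable_times_ennreal borel_measurable_indicator) auto
    have e: "(\<lambda>x. \<integral>\<^sup>+y. ennreal (f (x, y)) * indicator {a<..} y \<partial>lborel) = (\<lambda>x. \<integral>\<^sup>+y. ennreal (f (x, y)) * indicator (UNIV \<times> {a<..}) (x, y) \<partial>lborel)"
      by (intro ext nn_integral_cong) (auto simp: indicator_def)
    show "(\<lambda>x. \<integral>\<^sup>+y. ennreal (f (x, y)) * indicator {a<..} y \<partial>lborel) \<in> borel_measurable lborel"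
      unfolding e by (rule fubini_meas[OF fh])
    fix A :: "real set" assume "A \<in> sets lborel"
    then have A: "A \<in> sets borel" by simp
    have rect: "A \<times> {a<..} \<in> sets (borel :: (real \<times> real) measure)"
      unfolding borel_prod[symmetric] using A by (intro pair_measureI) auto
    have "(\<integral>\<^sup>+x\<in>A. indicator {0..<1} x * emeasure (mfib b \<gamma> psi x) {a<..} \<partial>lborel) = emeasure (srb b \<gamma> psi) (A \<times> {a<..})"
      unfolding emeasure_srb[OF b0 \<gamma> rect] em
      by (intro nn_integral_cong) (auto simp: indicator_def)
    also have "\<dots> = (\<integral>\<^sup>+z. ennreal (f z) * indicator (A \<times> {a<..}) z \<partial>lborel)"
      unfolding f_srb using rect by (subst emeasure_density) auto
    also have "\<dots> = (\<integral>\<^sup>+x. \<integral>\<^sup>+y. ennreal (f (x, y)) * indicator (A \<times> {a<..}) (x, y) \<partial>lborel \<partial>lborel)"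
      using rect by (intro fubini borel_measurable_times_ennreal borel_measurable_indicator) auto
    also have "\<dots> = (\<integral>\<^sup>+x\<in>A. (\<integral>\<^sup>+y. ennreal (f (x, y)) * indicator {a<..} y \<partial>lborel) \<partial>lborel)"
      by (intro nn_integral_cong) (auto simp: indicator_def)
    finally show "(\<integral>\<^sup>+x\<in>A. indicator {0..<1} x * emeasure (mfib b \<gamma> psi x) {a<..} \<partial>lborel)
      = (\<integral>\<^sup>+x\<in>A. (\<integral>\<^sup>+y. ennreal (f (x, y)) * indicator {a<..} y \<partial>lborel) \<partial>lborel)" .
  qed
  have "AE x in lborel. \<forall>q::int. \<forall>n::nat. indicator {0..<1} x * emeasure (mfib b \<gamma> psi x) {of_int q / 2 ^ n<..}
      = (\<integral>\<^sup>+y. ennreal (f (x, y)) * indicator {of_int q / 2 ^ n<..} y \<partial>lborel)"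
    by (simp only: AE_all_countable tail simp_thms)
  moreover have "AE x in lborel. (\<integral>\<^sup>+y. ennreal ((f (x, y))\<^sup>2) \<partial>lborel) \<noteq> \<infinity>"
  proof (rule nn_integral_PInf_AE)
    show "(\<lambda>x. \<integral>\<^sup>+y. ennreal ((f (x, y))\<^sup>2) \<partial>lborel) \<in> borel_measurable lborel"
      by (rule fubini_meas) measurable
    have "(\<integral>\<^sup>+x. \<integral>\<^sup>+y. ennreal ((f (x, y))\<^sup>2) \<partial>lborel \<partial>lborel) = (\<integral>\<^sup>+z. ennreal ((f z)\<^sup>2) \<partial>lborel)"
      by (rule fubini[symmetric]) measurable
    then show "(\<integral>\<^sup>+x. \<integral>\<^sup>+y. ennreal ((f (x, y))\<^sup>2) \<partial>lborel \<partial>lborel) \<noteq> \<infinity>"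
      using f_L2 by (simp add: top_unique) (metis ennreal_neq_top neq_top_trans)
  qed
  ultimately have unit: "AE x in lborel. x \<in> {0..<1} \<longrightarrow> (\<exists>g :: real \<Rightarrow> real.
            g \<in> borel_measurable borel \<and> (\<forall>y. 0 \<le> g y) \<and> integrable lborel (\<lambda>y. (g y)\<^sup>2) \<and>
            mfib b \<gamma> psi x = density lborel (\<lambda>y. ennreal (g y)))"
  proof eventually_elim
    case (elim x)
    show ?case
    proof
      assume x: "x \<in> {0..<1}"
      have "mfib b \<gamma> psi x = density lborel (\<lambda>y. ennreal (f (x, y)))"
      proof (rule measure_eqI_dyadic_greaterThan)
        show "finite_measure (mfib b \<gamma> psi x)"
          using prob_space_mfib[OF b0 \<gamma>] prob_space.finite_measure by blast
        show "emeasure (mfib b \<gamma> psi x) {of_int q / 2 ^ n<..} = emeasure (density lborel (\<lambda>y. ennreal (f (x, y)))) {of_int q / 2 ^ n<..}" for q n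
          using elim(1) x by (subst emeasure_density) auto
      qed auto
      moreover have "integrable lborel (\<lambda>y. (f (x, y))\<^sup>2)"
        by (rule integrableI_bounded) (use elim(2) in \<open>auto simp: less_top\<close>)
      ultimately show "\<exists>g :: real \<Rightarrow> real.
            g \<in> borel_measurable borel \<and> (\<forall>y. 0 \<le> g y) \<and> integrable lborel (\<lambda>y. (g y)\<^sup>2) \<and>
            mfib b \<gamma> psi x = density lborel (\<lambda>y. ennreal (g y))"
        using fx f_nonneg by blast
    qed
  qed
  \<comment> \<open>Almost every \<open>x\<close> is good after every integer translation into the
    unit interval; \<open>mfib_add_int\<close> then brings it back.\<close>
  have "AE x in lborel. \<forall>n::int. of_int n + x \<in> {0..<1} \<longrightarrow> (\<exists>g :: real \<Rightarrow> real.
            g \<in> borel_measurable borel \<and> (\<forall>y. 0 \<le> g y) \<and> integrable lborel (\<lambda>y. (g y)\<^sup>2) \<and>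
            mfib b \<gamma> psi (of_int n + x) = density lborel (\<lambda>y. ennreal (g y)))"
    unfolding AE_all_countable by (intro allI AE_lborel_translate[OF unit])
  then have "AE x in lborel. \<exists>g :: real \<Rightarrow> real.
            g \<in> borel_measurable borel \<and> (\<forall>y. 0 \<le> g y) \<and> integrable lborel (\<lambda>y. (g y)\<^sup>2) \<and>
            mfib b \<gamma> psi x = density lborel (\<lambda>y. ennreal (g y))"
  proof eventually_elim
    case (elim x)
    have "of_int (- \<lfloor>x\<rfloor>) + x \<in> {0..<1}" by (simp, linarith)
    with elim have "\<exists>g :: real \<Rightarrow> real.
            g \<in> borel_measurable borel \<and> (\<forall>y. 0 \<le> g y) \<and> integrable lborel (\<lambda>y. (g y)\<^sup>2) \<and>
            mfib b \<gamma> psi (of_int (- \<lfloor>x\<rfloor>) + x) = density lborel (\<lambda>y. ennreal (g y))" by blast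
    moreover have "mfib b \<gamma> psi (of_int (- \<lfloor>x\<rfloor>) + x) = mfib b \<gamma> psi x"
      using mfib_add_int[OF b0 \<gamma>, of x "- \<lfloor>x\<rfloor>"] by (simp only: add.commute)
    ultimately show ?case by simp
  qed
  moreover have "\<forall>x y. x \<notin> {0..<1} \<longrightarrow> f (x, y) = 0" by (simp add: f_def)
  ultimately show ?thesis using f f_nonneg f_int f_srb by blast
qed

section \<open>Criteria for bounded energy\<close>

lemma power_tail_le:
  fixes q :: real and c :: "nat \<Rightarrow> real"
  assumes q: "0 \<le> q" "q < 1" and m: "m \<le> N" and c: "\<And>n. \<bar>c n\<bar> \<le> 1"
  shows "\<bar>(\<Sum>n<N. q ^ n * c n) - (\<Sum>n<m. q ^ n * c n)\<bar> \<le> q ^ m / (1 - q)"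
proof -
  have "(\<Sum>n<N. q ^ n * c n) = (\<Sum>n<m. q ^ n * c n) + (\<Sum>n=m..<N. q ^ n * c n)"
    using m by (subst sum.atLeastLessThan_concat[symmetric, of 0 m N, unfolded atLeast0LessThan]) auto
  then have "\<bar>(\<Sum>n<N. q ^ n * c n) - (\<Sum>n<m. q ^ n * c n)\<bar> = \<bar>\<Sum>n=m..<N. q ^ n * c n\<bar>" by simp
  also have "\<dots> \<le> (\<Sum>n=m..<N. q ^ n)"
  proof (rule order_trans[OF sum_abs], rule sum_mono)
    fix n
    show "\<bar>q ^ n * c n\<bar> \<le> q ^ n" using q c[of n] by (simp add: abs_mult mult_left_le)
  qed
  also have "\<dots> = (\<Sum>n<N - m. q ^ m * q ^ n)"
    using m by (simp add: sum.atLeastLessThan_shift_0[of _ m N] atLeast0LessThan power_add add.commute mult.commute)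
  also have "\<dots> = q ^ m * (\<Sum>n<N - m. q ^ n)" by (simp add: sum_distrib_left)
  also have "\<dots> \<le> q ^ m * (1 / (1 - q))" using q by (intro mult_left_mono geometric_sum_le) auto
  finally show ?thesis by simp
qed

lemma abs_mult_le_1: "\<bar>a\<bar> \<le> 1 \<Longrightarrow> \<bar>c\<bar> \<le> 1 \<Longrightarrow> \<bar>a * c\<bar> \<le> (1::real)"
  unfolding abs_mult by (rule mult_le_one) auto

text \<open>Tangency at some level beyond \<open>N0\<close> is inherited, up to the geometric tails,
  by each truncation to \<open>m \<le> N0\<close> terms. Everything later is drawn from these
  finitely many inequalities.\<close>

lemma not_separatedE:
  assumes "\<not> separated b \<gamma> \<eta> N0 x k l" and b: "2 \<le> b" and \<gamma>: "0 < \<gamma>" "\<gamma> < 1"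
  obtains j j' where "j mod b = k" "j' mod b = l"
    "\<And>m. m \<le> N0 \<Longrightarrow> \<bar>sine_diff b \<gamma> m x j j'\<bar> < \<gamma> ^ m / (1 - \<gamma>) + \<eta>"
    "\<And>m. m \<le> N0 \<Longrightarrow> \<bar>cosine_diff b \<gamma> m x j j'\<bar> < (\<gamma> / real b) ^ m / (1 - \<gamma> / real b) + \<eta>"
proof -
  obtain N j j' where N: "N0 \<le> N" and j: "j mod b = k" "j' mod b = l"
    and s: "\<bar>sine_diff b \<gamma> N x j j'\<bar> < \<eta>" and c: "\<bar>cosine_diff b \<gamma> N x j j'\<bar> < \<eta>"
    using assms(1) unfolding separated_def by (auto simp: not_le)
  have "\<bar>sine_diff b \<gamma> m x j j'\<bar> < \<gamma> ^ m / (1 - \<gamma>) + \<eta>" if "m \<le> N0" for m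
  proof -
    have "\<bar>sine_diff b \<gamma> N x j j' - sine_diff b \<gamma> m x j j'\<bar> \<le> \<gamma> ^ m / (1 - \<gamma>)"
      unfolding sine_diff_def using \<gamma> N that by (intro power_tail_le abs_mult_le_1) auto
    then show ?thesis using s by linarith
  qed
  moreover have "\<bar>cosine_diff b \<gamma> m x j j'\<bar> < (\<gamma> / real b) ^ m / (1 - \<gamma> / real b) + \<eta>" if "m \<le> N0" for m
  proof -
    have "\<gamma> / real b < 1" using b \<gamma> by (simp add: field_simps)
    then have "\<bar>cosine_diff b \<gamma> N x j j' - cosine_diff b \<gamma> m x j j'\<bar> \<le> (\<gamma> / real b) ^ m / (1 - \<gamma> / real b)"
      unfolding cosine_diff_def using \<gamma> N that by (intro power_tail_le abs_mult_le_1) auto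
    then show ?thesis using c by linarith
  qed
  ultimately show ?thesis using j that by blast
qed

lemma first_digit_angle:
  assumes "j mod b = k" "0 < b"
  shows "sin (2 * pi * (x + real j) / real b) = sin (2 * pi * (x + real k) / real b)"
    and "cos (2 * pi * (x + real j) / real b) = cos (2 * pi * (x + real k) / real b)"
proof -
  have "j = k + b * (j div b)" using assms by auto
  then have "real j = real k + real b * real (j div b)" by (metis of_nat_add of_nat_mult)
  then have e: "2 * pi * (x + real j) / real b = 2 * pi * (x + real k) / real b + 2 * pi * real (j div b)"
    using assms by (simp add: field_simps)
  have "sin (2 * pi * real n) = 0" "cos (2 * pi * real n) = 1" for n
    using sin_2npi[of n] cos_2npi[of n] by (simp_all add: mult_ac)
  then show "sin (2 * pi * (x + real j) / real b) = sin (2 * pi * (x + real k) / real b)"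
    "cos (2 * pi * (x + real j) / real b) = cos (2 * pi * (x + real k) / real b)"
    unfolding e by (simp_all add: sin_add cos_add)
qed

text \<open>Changing \<open>j\<close> by a multiple of \<open>b\<close> shifts both angles by the
  same multiple of pi, up to full turns, so the signs cancel in the products.\<close>

lemma first_digit_diff:
  assumes "j mod b = k" "j' mod b = l" "0 < b"
  shows "cos (pi * (2 * x + real j + real j') / real b) * sin (pi * (real j - real j') / real b)
       = cos (pi * (2 * x + real k + real l) / real b) * sin (pi * (real k - real l) / real b)"
    and "sin (pi * (2 * x + real j + real j') / real b) * sin (pi * (real j - real j') / real b)
       = sin (pi * (2 * x + real k + real l) / real b) * sin (pi * (real k - real l) / real b)"
proof -
  have s: "cos (pi * (2 * x + u + v) / real b) * sin (pi * (u - v) / real b) = (sin (2 * pi * (x + u) / real b) - sin (2 * pi * (x + v) / real b)) / 2"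
   and c: "sin (pi * (2 * x + u + v) / real b) * sin (pi * (u - v) / real b) = (cos (2 * pi * (x + v) / real b) - cos (2 * pi * (x + u) / real b)) / 2" for u v
  proof -
    define M H where "M = pi * (2 * x + u + v) / real b" and "H = pi * (u - v) / real b"
    have e: "2 * pi * (x + u) / real b = M + H" "2 * pi * (x + v) / real b = M - H"
      by (simp_all add: M_def H_def add_divide_distrib diff_divide_distrib algebra_simps)
    show "cos (pi * (2 * x + u + v) / real b) * sin (pi * (u - v) / real b) = (sin (2 * pi * (x + u) / real b) - sin (2 * pi * (x + v) / real b)) / 2"
     "sin (pi * (2 * x + u + v) / real b) * sin (pi * (u - v) / real b) = (cos (2 * pi * (x + v) / real b) - cos (2 * pi * (x + u) / real b)) / 2"
      unfolding e M_def[symmetric] H_def[symmetric] by (simp_all add: sin_add sin_diff cos_add cos_diff)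
  qed
  show "cos (pi * (2 * x + real j + real j') / real b) * sin (pi * (real j - real j') / real b)
       = cos (pi * (2 * x + real k + real l) / real b) * sin (pi * (real k - real l) / real b)"
    "sin (pi * (2 * x + real j + real j') / real b) * sin (pi * (real j - real j') / real b)
       = sin (pi * (2 * x + real k + real l) / real b) * sin (pi * (real k - real l) / real b)"
    unfolding s c by (simp_all add: first_digit_angle[OF assms(1,3)] first_digit_angle[OF assms(2,3)])
qed

text \<open>The pair \<open>p\<close>, \<open>q\<close> is the cosine and sine of one angle times a
  common factor; digits from the third on enter only through the tails.\<close>

lemma not_separated_two_levels:
  assumes "\<not> separated b \<gamma> \<eta> N0 x k l" and b: "2 \<le> b" and \<gamma>: "0 < \<gamma>" "\<gamma> < 1" and N0: "2 \<le> N0"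
  defines "\<rho> \<equiv> \<gamma> / real b"
    and "S \<equiv> cos (pi * (2 * x + real k + real l) / real b) * sin (pi * (real k - real l) / real b)"
    and "C \<equiv> sin (pi * (2 * x + real k + real l) / real b) * sin (pi * (real k - real l) / real b)"
  shows "\<bar>S\<bar> < \<gamma> / (1 - \<gamma>) + \<eta>" "\<bar>C\<bar> < \<rho> / (1 - \<rho>) + \<eta>"
    "\<exists>p q. p\<^sup>2 + q\<^sup>2 \<le> 1 \<and> \<bar>S + \<gamma> * p\<bar> < \<gamma>\<^sup>2 / (1 - \<gamma>) + \<eta> \<and> \<bar>C + \<rho> * q\<bar> < \<rho>\<^sup>2 / (1 - \<rho>) + \<eta>"
proof -
  have b0: "0 < b" using b by simp
  obtain j j' where j: "j mod b = k" "j' mod b = l"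
    and s: "\<And>m. m \<le> N0 \<Longrightarrow> \<bar>sine_diff b \<gamma> m x j j'\<bar> < \<gamma> ^ m / (1 - \<gamma>) + \<eta>"
    and c: "\<And>m. m \<le> N0 \<Longrightarrow> \<bar>cosine_diff b \<gamma> m x j j'\<bar> < \<rho> ^ m / (1 - \<rho>) + \<eta>"
    using not_separatedE[OF assms(1-4)] unfolding \<rho>_def by blast
  have 1: "sine_diff b \<gamma> (Suc 0) x j j' = S" "cosine_diff b \<gamma> (Suc 0) x j j' = C"
    unfolding sine_diff_def cosine_diff_def S_def C_def using first_digit_diff[OF j b0] by simp_all
  show "\<bar>S\<bar> < \<gamma> / (1 - \<gamma>) + \<eta>" "\<bar>C\<bar> < \<rho> / (1 - \<rho>) + \<eta>"
    using s[of "Suc 0"] c[of "Suc 0"] N0 by (simp_all add: 1)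
  define M H where "M = pi * (2 * x + real j + real j') / real b ^ 2" and "H = pi * (real j - real j') / real b ^ 2"
  have 2: "sine_diff b \<gamma> 2 x j j' = S + \<gamma> * (cos M * sin H)" "cosine_diff b \<gamma> 2 x j j' = C + \<rho> * (sin M * sin H)"
    using 1 by (simp_all add: sine_diff_def cosine_diff_def numeral_2_eq_2 M_def H_def \<rho>_def)
  have "(cos M * sin H)\<^sup>2 + (sin M * sin H)\<^sup>2 = ((sin M)\<^sup>2 + (cos M)\<^sup>2) * (sin H)\<^sup>2"
    by (simp only: power_mult_distrib distrib_right add.commute)
  also have "\<dots> \<le> 1" by (simp add: abs_square_le_1)
  finally show "\<exists>p q. p\<^sup>2 + q\<^sup>2 \<le> 1 \<and> \<bar>S + \<gamma> * p\<bar> < \<gamma>\<^sup>2 / (1 - \<gamma>) + \<eta> \<and> \<bar>C + \<rho> * q\<bar> < \<rho>\<^sup>2 / (1 - \<rho>) + \<eta>"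
    using s[of 2] c[of 2] N0 2 by (metis (no_types))
qed

text \<open>Without tangential pairs only the diagonal is charged, so the identity matrix serves as
  \<open>W\<close> and \<Lambda> = 1.\<close>

lemma L2_bounded_if_separated:
  assumes b: "2 \<le> b" and \<gamma>: "0 < \<gamma>" "\<gamma> < 1" "1 < \<gamma> * real b" and \<eta>: "0 < \<eta>"
    and sep: "\<And>x k l. \<lbrakk>0 \<le> x; x < 1; k < b; l < b; k \<noteq> l\<rbrakk> \<Longrightarrow> separated b \<gamma> \<eta> N0 x k l"
  shows "L2_bounded b \<gamma>"
proof (rule L2_boundedI[where W = "\<lambda>x k l. of_bool (k = l)" and \<omega> = "\<lambda>_. 1" and \<Lambda> = 1 and \<Omega> = 1 and ?N0.0 = N0])
  show "separated b \<gamma> \<eta> N0 x k l" if "0 \<le> x" "x < 1" "k < b" "l < b" "of_bool (k = l) * of_bool (l = k) < (1::real)" for x k l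
    using that by (intro sep) auto
  show "1 * (\<Sum>l<b. of_bool (k = l)) \<le> (1::real) * 1" if "k < b" for k
    using that by (simp add: of_bool_def)
qed (use assms in auto)

text \<open>Only the derivative is used. Tangency makes its first term smaller than the tail
  \<open>\<gamma> / (real b - \<gamma>)\<close> up to \<eta>; twice that term is the difference of
  the cosines at the two preimages. Every neighbour, \<open>k\<close> included, gets weight 1, hence
  \<Lambda> = n.\<close>

lemma L2_bounded_if_few_neighbours:
  assumes b: "2 \<le> b" and \<gamma>: "0 < \<gamma>" "\<gamma> < 1" and D: "2 * \<gamma> / (real b - \<gamma>) < D" and n: "real n < \<gamma> * real b"
    and card: "\<And>x k. \<lbrakk>0 \<le> x; x < 1; k < b\<rbrakk> \<Longrightarrow>
      card {l. l < b \<and> \<bar>cos (2 * pi * (x + real l) / real b) - cos (2 * pi * (x + real k) / real b)\<bar> \<le> D} \<le> n"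
  shows "L2_bounded b \<gamma>"
proof (rule L2_boundedI[where \<omega> = "\<lambda>_. 1" and \<Lambda> = "real n" and \<Omega> = 1 and ?N0.0 = 2 and \<eta> = "(D - 2 * \<gamma> / (real b - \<gamma>)) / 2"
    and W = "\<lambda>x k l. if \<bar>cos (2 * pi * (x + real l) / real b) - cos (2 * pi * (x + real k) / real b)\<bar> \<le> D then 1 else 0"])
  fix x :: real and k l assume x: "0 \<le> x" "x < 1" and kl: "k < b" "l < b"
    and W: "(if \<bar>cos (2 * pi * (x + real l) / real b) - cos (2 * pi * (x + real k) / real b)\<bar> \<le> D then 1 else 0) *
        (if \<bar>cos (2 * pi * (x + real k) / real b) - cos (2 * pi * (x + real l) / real b)\<bar> \<le> D then 1 else 0) < (1::real)"
  show "separated b \<gamma> ((D - 2 * \<gamma> / (real b - \<gamma>)) / 2) 2 x k l"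
  proof (rule ccontr)
    assume ns: "\<not> ?thesis"
    define M H where "M = pi * (2 * x + real k + real l) / real b" and "H = pi * (real k - real l) / real b"
    have e: "2 * pi * (x + real k) / real b = M + H" "2 * pi * (x + real l) / real b = M - H"
      by (simp_all add: M_def H_def add_divide_distrib diff_divide_distrib algebra_simps)
    have "\<bar>sin M * sin H\<bar> < \<gamma> / real b / (1 - \<gamma> / real b) + (D - 2 * \<gamma> / (real b - \<gamma>)) / 2"
      using not_separated_two_levels(2)[OF ns b \<gamma>] by (simp add: M_def H_def)
    also have "\<gamma> / real b / (1 - \<gamma> / real b) = \<gamma> / (real b - \<gamma>)" using b \<gamma> by (simp add: field_simps)
    finally have "2 * \<bar>sin M * sin H\<bar> < D" by (simp add: field_simps)
    then have "\<bar>cos (M - H) - cos (M + H)\<bar> \<le> D" by (simp add: cos_add cos_diff abs_mult mult.commute)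
    then show False using W unfolding e by (simp add: abs_minus_commute)
  qed
next
  fix x :: real and k assume x: "0 \<le> x" "x < 1" "k < b"
  have "(\<Sum>l<b. if \<bar>cos (2 * pi * (x + real l) / real b) - cos (2 * pi * (x + real k) / real b)\<bar> \<le> D then 1 else 0)
     = real (card {l. l < b \<and> \<bar>cos (2 * pi * (x + real l) / real b) - cos (2 * pi * (x + real k) / real b)\<bar> \<le> D})"
    by (simp add: sum.If_cases Collect_conj_eq lessThan_def)
  then show "1 * (\<Sum>l<b. if \<bar>cos (2 * pi * (x + real l) / real b) - cos (2 * pi * (x + real k) / real b)\<bar> \<le> D then 1 else 0) \<le> real n * 1"
    using card[OF x] by simp
qed (use assms in auto)

text \<open>Off the diagonal each \<open>k\<close> has at most one partner, so a row sum is 1 or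
  \<open>1 + v x k\<close>, and the weights of two partners need only multiply to at least
  1.\<close>

lemma L2_bounded_if_matching:
  fixes E :: "real \<Rightarrow> nat \<Rightarrow> nat \<Rightarrow> bool" and v :: "real \<Rightarrow> nat \<Rightarrow> real"
  assumes b: "2 \<le> b" and \<gamma>: "0 < \<gamma>" "\<gamma> < 1" and \<eta>: "0 < \<eta>" and \<Lambda>: "\<Lambda> < \<gamma> * real b"
    and Em[measurable]: "\<And>k l. Measurable.pred borel (\<lambda>x. E x k l)" and vm[measurable]: "\<And>k. (\<lambda>x. v x k) \<in> borel_measurable borel"
    and v0: "\<And>x k. 0 \<le> v x k"
    and \<omega>m[measurable]: "\<omega> \<in> borel_measurable borel" and \<omega>1: "\<And>x. 1 \<le> \<omega> x" and \<omega>2: "\<And>x. \<omega> x \<le> \<Omega>"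
    and sep: "\<And>x k l. \<lbrakk>0 \<le> x; x < 1; k < b; l < b; k \<noteq> l; \<not> E x k l\<rbrakk> \<Longrightarrow> separated b \<gamma> \<eta> N0 x k l"
    and sym: "\<And>x k l. E x k l \<Longrightarrow> E x l k"
    and uniq: "\<And>x k l l'. \<lbrakk>E x k l; E x k l'; k < b; l < b; l' < b; k \<noteq> l; k \<noteq> l'\<rbrakk> \<Longrightarrow> l = l'"
    and v1: "\<And>x k l. \<lbrakk>0 \<le> x; x < 1; k < b; l < b; k \<noteq> l; E x k l\<rbrakk> \<Longrightarrow> 1 \<le> v x k * v x l"
    and unmatched: "\<And>x k. \<lbrakk>0 \<le> x; x < 1; k < b\<rbrakk> \<Longrightarrow> \<omega> x \<le> \<Lambda> * \<omega> ((x + real k) / real b)"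
    and matched: "\<And>x k l. \<lbrakk>0 \<le> x; x < 1; k < b; l < b; k \<noteq> l; E x k l\<rbrakk> \<Longrightarrow> \<omega> x * (1 + v x k) \<le> \<Lambda> * \<omega> ((x + real k) / real b)"
  shows "L2_bounded b \<gamma>"
proof (rule L2_boundedI[OF b \<gamma> \<eta> \<Lambda>, where W = "\<lambda>x k l. if k = l then 1 else if E x k l then v x k else 0" and \<omega> = \<omega> and \<Omega> = \<Omega> and ?N0.0 = N0])
  show "separated b \<gamma> \<eta> N0 x k l" if "0 \<le> x" "x < 1" "k < b" "l < b"
    "(if k = l then 1 else if E x k l then v x k else 0) * (if l = k then 1 else if E x l k then v x l else 0) < 1" for x k l
    using that sym[of x k l] v1[of x k l] by (intro sep) (auto split: if_splits)
  fix x :: real and k assume x: "0 \<le> x" "x < 1" "k < b"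
  show "\<omega> x * (\<Sum>l<b. if k = l then 1 else if E x k l then v x k else 0) \<le> \<Lambda> * \<omega> ((x + real k) / real b)"
  proof (cases "\<exists>l<b. k \<noteq> l \<and> E x k l")
    case True
    then obtain l where l: "l < b" "k \<noteq> l" "E x k l" by blast
    have "(\<Sum>l<b. if k = l then 1 else if E x k l then v x k else 0) = (\<Sum>l\<in>{k, l}. if k = l then 1 else if E x k l then v x k else 0)"
    proof (intro sum.mono_neutral_right ballI)
      fix m assume m: "m \<in> {..<b} - {k, l}"
      then have "\<not> E x k m" using uniq[OF l(3), of m] l x by blast
      then show "(if k = m then 1 else if E x k m then v x k else 0) = 0" using m by simp
    qed (use l x in auto)
    also have "\<dots> = 1 + v x k" using l by simp
    finally show ?thesis using matched[OF x l] by simp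
  next
    case False
    have "(\<Sum>l<b. if k = l then 1 else if E x k l then v x k else 0) = (\<Sum>l\<in>{k}. if k = l then 1 else if E x k l then v x k else 0)"
    proof (intro sum.mono_neutral_right ballI)
      fix m assume m: "m \<in> {..<b} - {k}"
      then have "\<not> E x k m" using False by blast
      then show "(if k = m then 1 else if E x k m then v x k else 0) = 0" using m by simp
    qed (use x in auto)
    also have "\<dots> = 1" by simp
    finally show ?thesis using unmatched[OF x] by simp
  qed
qed (use v0 \<omega>1 \<omega>2 in auto)

text \<open>The preimages \<open>(x + real k) / real b\<close> and
  \<open>(x + real l) / real b\<close> add up to an integer within w / b: they are almost mirror
  images under y -> -y mod 1, where the cosine takes equal values.\<close>

definition near_multiple :: "nat \<Rightarrow> real \<Rightarrow> real \<Rightarrow> nat \<Rightarrow> nat \<Rightarrow> bool" where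
  "near_multiple b w x k l \<longleftrightarrow> (\<exists>n::int. \<bar>2 * x + real k + real l - real b * of_int n\<bar> < w)"

lemma near_multiple_measurable[measurable]: "Measurable.pred borel (\<lambda>x. near_multiple b w x k l)"
  unfolding near_multiple_def by measurable

lemma near_multiple_sym: "near_multiple b w x k l \<Longrightarrow> near_multiple b w x l k"
  by (simp add: near_multiple_def add_ac)

lemma near_multiple_uniq:
  assumes "near_multiple b w x k l" "near_multiple b w x k l'" "l < b" "l' < b" "w \<le> 1 / 2"
  shows "l = l'"
proof -
  obtain n n' :: int where n: "\<bar>2 * x + real k + real l - real b * of_int n\<bar> < w" "\<bar>2 * x + real k + real l' - real b * of_int n'\<bar> < w"
    using assms(1,2) unfolding near_multiple_def by blast
  have "\<bar>of_int (int l - int l' - int b * (n - n')) :: real\<bar> < 1"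
    using n assms(5) by (simp add: algebra_simps)
  then have "int l - int l' - int b * (n - n') = 0" by linarith
  then have "int l = int l' + int b * (n - n')" by simp
  then have "int l mod int b = int l' mod int b" by (metis mod_mult_self2)
  then show ?thesis using assms(3,4) by simp
qed

text \<open>After reduction modulo pi to an angle of size at most pi / 2, monotonicity of the sine
  turns the bound on the sine into one on the angle.\<close>

lemma near_multipleI:
  assumes "\<bar>sin (pi * (2 * x + real k + real l) / real b)\<bar> < sin (pi * w / real b)" and w: "0 < w" "2 * w < real b"
  shows "near_multiple b w x k l"
proof -
  define z where "z = pi * (2 * x + real k + real l) / real b"
  define n where "n = round (z / pi)"
  define u where "u = z - pi * of_int n"
  have b: "0 < real b" using w by linarith
  have "\<bar>of_int n - z / pi\<bar> \<le> 1 / 2" unfolding n_def by (rule of_int_round_abs_le)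
  then have "pi * \<bar>of_int n - z / pi\<bar> \<le> pi * (1 / 2)" by (intro mult_left_mono) auto
  moreover have "pi * \<bar>of_int n - z / pi\<bar> = \<bar>u\<bar>"
    by (simp add: u_def abs_mult[of pi, simplified, symmetric] right_diff_distrib abs_minus_commute)
  ultimately have u: "\<bar>u\<bar> \<le> pi / 2" by simp
  have "sin z = sin (u + pi * of_int n)" by (simp add: u_def)
  also have "\<dots> = sin u * cos (pi * of_int n)" using sin_npi_int[of n] by (simp add: sin_add)
  finally have sz: "\<bar>sin z\<bar> = \<bar>sin u\<bar>" using cos_npi_int[of n] by (auto simp: abs_mult split: if_splits)
  have "\<bar>sin u\<bar> = sin \<bar>u\<bar>"
  proof (cases "0 \<le> u")
    case True
    then show ?thesis using u sin_ge_zero[of u] pi_gt_zero by simp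
  next
    case False
    then show ?thesis using u sin_ge_zero[of "- u"] pi_gt_zero by simp
  qed
  then have lt: "sin \<bar>u\<bar> < sin (pi * w / real b)" using assms(1) sz by (simp add: z_def)
  have "\<bar>u\<bar> < pi * w / real b"
  proof (rule ccontr)
    assume "\<not> ?thesis"
    then have "sin (pi * w / real b) \<le> sin \<bar>u\<bar>"
      using u w b by (intro sin_monotone_2pi_le) (auto simp: not_less intro: order_trans[of _ 0])
    then show False using lt by simp
  qed
  then have "real b / pi * \<bar>u\<bar> < real b / pi * (pi * w / real b)" using b by (intro mult_strict_left_mono) auto
  also have "real b / pi * (pi * w / real b) = w" using b by simp
  also have "real b / pi * \<bar>u\<bar> = \<bar>real b / pi * u\<bar>" using b by (simp add: abs_mult)
  also have "real b / pi * u = 2 * x + real k + real l - real b * of_int n"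
    using b by (simp add: u_def z_def field_simps)
  finally show ?thesis unfolding near_multiple_def by blast
qed

text \<open>A partner at the preimage y = \<open>(x + real k) / real b\<close>, whatever the digits
  \<open>i\<close> and \<open>j\<close>, puts 2 y within \<open>w\<close> of an integer; multiplied
  by \<open>b\<close> this is a condition on \<open>x\<close> and \<open>k\<close> alone.\<close>

lemma near_multiple_digit:
  assumes "near_multiple b w ((x + real k) / real b) i j" "0 < b"
  shows "\<exists>p::int. \<bar>2 * x + 2 * real k - real b * of_int p\<bar> < real b * w"
proof -
  obtain n :: int where n: "\<bar>2 * ((x + real k) / real b) + real i + real j - real b * of_int n\<bar> < w"
    using assms(1) unfolding near_multiple_def by blast
  have "real b * \<bar>2 * ((x + real k) / real b) + real i + real j - real b * of_int n\<bar> < real b * w"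
    using n assms(2) by (intro mult_strict_left_mono) auto
  also have "real b * \<bar>2 * ((x + real k) / real b) + real i + real j - real b * of_int n\<bar>
     = \<bar>real b * (2 * ((x + real k) / real b) + real i + real j - real b * of_int n)\<bar>" by (simp add: abs_mult)
  also have "real b * (2 * ((x + real k) / real b) + real i + real j - real b * of_int n)
     = 2 * x + 2 * real k - real b * of_int (int b * n - int i - int j)"
    using assms(2) by (simp add: field_simps)
  finally show ?thesis by blast
qed

lemma eq_if_diff_multiple:
  fixes k l b :: nat and z :: int
  assumes "\<bar>real k - real l - real b * of_int z\<bar> < 1" "k < b" "l < b"
  shows "k = l"
proof -
  have "\<bar>of_int (int k - int l - int b * z) :: real\<bar> < 1" using assms(1) by simp
  then have "int k - int l - int b * z = 0" by linarith
  then have "int k = int l + int b * z" by simp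
  then have "int k mod int b = int l mod int b" by (metis mod_mult_self2)
  then show ?thesis using assms(2,3) by simp
qed

definition has_partner :: "nat \<Rightarrow> real \<Rightarrow> real \<Rightarrow> bool" where
  "has_partner b w x \<longleftrightarrow> (\<exists>k<b. \<exists>l<b. k \<noteq> l \<and> near_multiple b w x k l)"

lemma has_partner_measurable[measurable]: "Measurable.pred borel (has_partner b w)"
proof -
  have "Measurable.pred borel (\<lambda>x. \<exists>k\<in>{..<b}. \<exists>l\<in>{..<b}. k \<noteq> l \<and> near_multiple b w x k l)" by measurable
  then show ?thesis by (simp add: has_partner_def[abs_def] Bex_def lessThan_def)
qed

text \<open>No two consecutive points of a backward orbit have a partner, so the cost
  is \<open>2\<close> at most every other step.\<close>
lemma L2_bounded_sqrt2:
  assumes b: "2 \<le> b" and \<gamma>: "0 < \<gamma>" "\<gamma> < 1" and t: "sqrt 2 < \<gamma> * real b" and \<eta>: "0 < \<eta>"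
    and sep: "\<And>x k l. \<lbrakk>0 \<le> x; x < 1; k < b; l < b; k \<noteq> l; \<not> near_multiple b (1 / (real b + 1)) x k l\<rbrakk> \<Longrightarrow> separated b \<gamma> \<eta> N0 x k l"
  shows "L2_bounded b \<gamma>"
proof -
  \<comment> \<open>This width gives \<open>real b * w + w = 1\<close>: the condition on
    \<open>2 * k\<close> minus that on \<open>k + l\<close> then forces
    \<open>k = l\<close>.\<close>
  define w where "w = 1 / (real b + 1)"
  have w: "0 < w" "w \<le> 1 / 2" "(real b + 1) * w = 1" using b by (auto simp: w_def field_simps)
  have b0: "0 < b" using b by simp
  have nopartner: "\<not> has_partner b w ((x + real k) / real b)" if kl: "k < b" "l < b" "k \<noteq> l" and E: "near_multiple b w x k l" for x k l
  proof
    assume "has_partner b w ((x + real k) / real b)"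
    then obtain p :: int where p: "\<bar>2 * x + 2 * real k - real b * of_int p\<bar> < real b * w"
      using near_multiple_digit[OF _ b0] unfolding has_partner_def by blast
    obtain n :: int where n: "\<bar>2 * x + real k + real l - real b * of_int n\<bar> < w"
      using E unfolding near_multiple_def by blast
    have "\<bar>real k - real l - real b * of_int (p - n)\<bar> < real b * w + w"
      using p n by (simp add: algebra_simps)
    then have "\<bar>real k - real l - real b * of_int (p - n)\<bar> < 1" using w(3) by (simp add: algebra_simps)
    then show False using eq_if_diff_multiple kl by blast
  qed
  show ?thesis
  proof (rule L2_bounded_if_matching[where E = "near_multiple b w" and \<eta> = \<eta> and ?N0.0 = N0 and v = "\<lambda>_ _. 1" and \<Lambda> = "sqrt 2" and \<Omega> = "sqrt 2"
        and \<omega> = "\<lambda>x. if has_partner b w x then 1 else sqrt 2"])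
    fix x :: real and k l
    assume x: "0 \<le> x" "x < 1" "k < b" and l: "l < b" "k \<noteq> l" "near_multiple b w x k l"
    have "has_partner b w x" using x l unfolding has_partner_def by blast
    then show "(if has_partner b w x then 1 else sqrt 2) * (1 + 1) \<le> sqrt 2 * (if has_partner b w ((x + real k) / real b) then 1 else sqrt 2)"
      using nopartner[of k l x] x l by simp
  next
    fix x :: real and k
    show "(if has_partner b w x then 1 else sqrt 2) \<le> sqrt 2 * (if has_partner b w ((x + real k) / real b) then 1 else sqrt 2)"
      by simp
  qed (use assms w near_multiple_sym near_multiple_uniq in \<open>auto simp: w_def[symmetric]\<close>)
qed

text \<open>Here consecutive points of a backward orbit may have partners, but then the partner
  of the later point does not; unequal weights in \<open>2 a b \<le> v a\<^sup>2 + v\<^sup>-\<^sup>1 b\<^sup>2\<close> exploit this.\<close>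
lemma L2_bounded_golden:
  assumes b: "3 \<le> b" and \<gamma>: "0 < \<gamma>" "\<gamma> < 1" and t: "(1 + sqrt 5) / 2 < \<gamma> * real b" and \<eta>: "0 < \<eta>"
    and sep: "\<And>x k l. \<lbrakk>0 \<le> x; x < 1; k < b; l < b; k \<noteq> l; \<not> near_multiple b (1 / real b) x k l\<rbrakk> \<Longrightarrow> separated b \<gamma> \<eta> N0 x k l"
  shows "L2_bounded b \<gamma>"
proof -
  \<comment> \<open>The inverse golden ratio: \<open>g * (1 + g) = 1\<close> makes the two weights
    admissible, and \<open>2 + g = (1 + g) * (1 + g)\<close> makes the cost of a partnered digit
    tight in both cases.\<close>
  define g where "g = (sqrt 5 - 1) / 2"
  have "sqrt 1 < sqrt (5::real)" by (intro real_sqrt_less_mono) simp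
  then have g0: "0 < g" by (simp add: g_def)
  have g1: "g * g = 1 - g" by (simp add: g_def field_simps)
  define w where "w = 1 / real b"
  have w: "0 < w" "w \<le> 1 / 2" "real b * w = 1" "w \<le> 1 / 3" using b by (auto simp: w_def field_simps)
  have b0: "0 < b" "2 \<le> b" using b by auto
  have nopartner: "\<not> (has_partner b w ((x + real k) / real b) \<and> has_partner b w ((x + real l) / real b))"
    if kl: "k < b" "l < b" "k \<noteq> l" and E: "near_multiple b w x k l" for x k l
  proof
    assume "has_partner b w ((x + real k) / real b) \<and> has_partner b w ((x + real l) / real b)"
    then obtain p q :: int where p: "\<bar>2 * x + 2 * real k - real b * of_int p\<bar> < 1" and q: "\<bar>2 * x + 2 * real l - real b * of_int q\<bar> < 1"
      using near_multiple_digit[OF _ b0(1)] w(3) unfolding has_partner_def by metis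
    obtain n :: int where n: "\<bar>2 * x + real k + real l - real b * of_int n\<bar> < w"
      using E unfolding near_multiple_def by blast
    \<comment> \<open>The conditions for \<open>k\<close> and for \<open>l\<close>, added, minus
      twice the one for the pair, leave a multiple of \<open>b\<close> of size below
      \<open>2 + 2 * w\<close>; for \<open>b \<ge> 3\<close> it must be 0.\<close>
    have "\<bar>real b * of_int (p + q - 2 * n)\<bar> < 2 + 2 * w"
      using p q n by (simp add: algebra_simps)
    also have "\<dots> < real b" using w b by simp
    finally have "real b * \<bar>of_int (p + q - 2 * n)\<bar> < real b * 1" by (simp add: abs_mult)
    then have "\<bar>of_int (p + q - 2 * n) :: real\<bar> < 1" using b0 by simp
    then have "p + q - 2 * n = 0" by linarith
    then have q': "q = 2 * n - p" by simp
    have "\<bar>2 * (real k - real l) - real b * of_int (p - q)\<bar> < 2" using p q by (simp add: algebra_simps)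
    then have "\<bar>real k - real l - real b * of_int (p - n)\<bar> < 1" unfolding q' by (simp add: algebra_simps)
    then show False using eq_if_diff_multiple kl by blast
  qed
  show ?thesis
  proof (rule L2_bounded_if_matching[where E = "near_multiple b w" and \<eta> = \<eta> and ?N0.0 = N0 and \<Lambda> = "1 + g" and \<Omega> = "1 + g"
        and v = "\<lambda>x k. if has_partner b w ((x + real k) / real b) then g else 1 + g"
        and \<omega> = "\<lambda>x. if has_partner b w x then 1 else 1 + g"])
    show "(\<lambda>x. if has_partner b w ((x + real k) / real b) then g else 1 + g) \<in> borel_measurable borel" for k
      by measurable
    fix x :: real and k l
    assume x: "0 \<le> x" "x < 1" "k < b" and l: "l < b" "k \<noteq> l" "near_multiple b w x k l"
    show "1 \<le> (if has_partner b w ((x + real k) / real b) then g else 1 + g) * (if has_partner b w ((x + real l) / real b) then g else 1 + g)"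
      using nopartner[of k l x] x l g0 g1 by (auto simp: algebra_simps)
    have "has_partner b w x" using x l unfolding has_partner_def by blast
    then show "(if has_partner b w x then 1 else 1 + g) * (1 + (if has_partner b w ((x + real k) / real b) then g else 1 + g))
      \<le> (1 + g) * (if has_partner b w ((x + real k) / real b) then 1 else 1 + g)"
      using g0 g1 by (auto simp: algebra_simps)
  next
    fix x :: real and k
    show "(if has_partner b w x then 1 else 1 + g) \<le> (1 + g) * (if has_partner b w ((x + real k) / real b) then 1 else 1 + g)"
      using g0 by (auto simp: algebra_simps)
  next
    show "1 + g < \<gamma> * real b" using t by (simp add: g_def field_simps)
  qed (use assms w b0 g0 near_multiple_sym near_multiple_uniq in \<open>auto simp: w_def[symmetric]\<close>)
qed

section \<open>Gaps between the digit points on the circle and counts of nearly equal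
  cosines\<close>

lemma pi_frac_mono: "u \<le> v \<Longrightarrow> pi * u / real b \<le> pi * v / real b"
  by (intro divide_right_mono mult_left_mono) auto

text \<open>Among the nonzero multiples of pi / b below pi the sine is smallest at the first and, by
  reflection, at the last.\<close>

lemma sin_digit_gap:
  assumes "k < b" "l < b" "k \<noteq> l"
  shows "sin (pi / real b) \<le> \<bar>sin (pi * (real k - real l) / real b)\<bar>"
proof -
  define d where "d = (if k < l then l - k else k - l)"
  have d: "1 \<le> d" "d < b" using assms by (auto simp: d_def)
  have "\<bar>sin (pi * (real k - real l) / real b)\<bar> = \<bar>sin (pi * real d / real b)\<bar>"
  proof (cases "k < l")
    case True
    then have "real k - real l = - real d" by (simp add: d_def of_nat_diff)
    then show ?thesis by simp
  next
    case False
    then show ?thesis by (simp add: d_def of_nat_diff)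
  qed
  moreover have "sin (pi / real b) \<le> sin (pi * real d / real b)"
  proof (cases "2 * d \<le> b")
    case True
    have "2 * real d \<le> real b" using True by (metis of_nat_le_iff of_nat_mult of_nat_numeral)
    then have "pi * real d / real b \<le> pi / 2" using d by (simp add: field_simps)
    moreover have "pi / real b \<le> pi * real d / real b" using d by (simp add: field_simps)
    moreover have "- (pi / 2) \<le> pi / real b" using d by (simp add: order_trans[of _ 0])
    ultimately show ?thesis by (intro sin_monotone_2pi_le) auto
  next
    case False
    have "real b \<le> 2 * real d" using False by (metis nat_le_linear of_nat_le_iff of_nat_mult of_nat_numeral)
    moreover have "1 \<le> real b - real d" using d by linarith
    ultimately have h: "pi * (real b - real d) / real b \<le> pi / 2" "pi / real b \<le> pi * (real b - real d) / real b"
      using d pi_frac_mono[of "real b - real d" "real b / 2" b] pi_frac_mono[of 1 "real b - real d" b] by simp_all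
    have "sin (pi * real d / real b) = sin (pi - pi * real d / real b)" by simp
    also have "pi - pi * real d / real b = pi * (real b - real d) / real b" using d by (simp add: field_simps)
    also have "sin (pi / real b) \<le> sin (pi * (real b - real d) / real b)"
      using h d by (intro sin_monotone_2pi_le) (auto simp: order_trans[of _ 0])
    finally show ?thesis by linarith
  qed
  ultimately show ?thesis by linarith
qed

lemma sin_pi_div_pos: "2 \<le> b \<Longrightarrow> 0 < sin (pi / real b)"
  by (intro sin_gt_zero) (auto simp: field_simps)

text \<open>The two components of the first term have squares adding to
  \<open>(sin H)\<^sup>2\<close>, at least the squared gap, while tangency keeps each below its
  tail; under \<open>gap\<close> both cannot hold.\<close>

lemma L2_bounded_if_gap_dominates:
  assumes b: "2 \<le> b" and \<gamma>: "0 < \<gamma>" "\<gamma> < 1" "1 < \<gamma> * real b"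
    and gap: "(\<gamma> / (1 - \<gamma>))\<^sup>2 + (\<gamma> / (real b - \<gamma>))\<^sup>2 < (sin (pi / real b))\<^sup>2"
  shows "L2_bounded b \<gamma>"
proof -
  define \<sigma> \<tau> where "\<sigma> = \<gamma> / (1 - \<gamma>)" and "\<tau> = \<gamma> / (real b - \<gamma>)"
  have st: "0 \<le> \<sigma>" "0 \<le> \<tau>" using b \<gamma> by (auto simp: \<sigma>_def \<tau>_def)
  define e where "e = (sin (pi / real b))\<^sup>2 - \<sigma>\<^sup>2 - \<tau>\<^sup>2"
  have e: "0 < e" using gap by (simp add: e_def \<sigma>_def \<tau>_def)
  \<comment> \<open>Chosen so that enlarging both tails by \<eta> uses less than the slack
    \<open>e\<close>.\<close>
  define \<eta> where "\<eta> = min 1 (e / (2 * \<sigma> + 2 * \<tau> + 3))"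
  have \<eta>: "0 < \<eta>" "\<eta> \<le> 1" "\<eta> * (2 * \<sigma> + 2 * \<tau> + 3) \<le> e"
  proof -
    show "0 < \<eta>" using e st by (simp add: \<eta>_def)
    have "\<eta> * (2 * \<sigma> + 2 * \<tau> + 3) \<le> e / (2 * \<sigma> + 2 * \<tau> + 3) * (2 * \<sigma> + 2 * \<tau> + 3)"
      using st by (intro mult_right_mono) (auto simp: \<eta>_def)
    then show "\<eta> * (2 * \<sigma> + 2 * \<tau> + 3) \<le> e" using st by simp
  qed (simp add: \<eta>_def)
  have lt: "(\<sigma> + \<eta>)\<^sup>2 + (\<tau> + \<eta>)\<^sup>2 < (sin (pi / real b))\<^sup>2"
  proof -
    have "\<eta> * \<eta> \<le> \<eta> * 1" using \<eta> by (intro mult_left_mono) auto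
    then have "(\<sigma> + \<eta>)\<^sup>2 + (\<tau> + \<eta>)\<^sup>2 \<le> \<sigma>\<^sup>2 + \<tau>\<^sup>2 + \<eta> * (2 * \<sigma> + 2 * \<tau> + 2)" by (simp add: power2_eq_square algebra_simps)
    also have "\<dots> < \<sigma>\<^sup>2 + \<tau>\<^sup>2 + \<eta> * (2 * \<sigma> + 2 * \<tau> + 3)" using \<eta> by simp
    also have "\<dots> \<le> \<sigma>\<^sup>2 + \<tau>\<^sup>2 + e" using \<eta> by simp
    finally show ?thesis by (simp add: e_def)
  qed
  show ?thesis
  proof (rule L2_bounded_if_separated[OF b \<gamma> \<eta>(1), where ?N0.0 = 2])
    fix x :: real and k l assume kl: "k < b" "l < b" "k \<noteq> l"
    show "separated b \<gamma> \<eta> 2 x k l"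
    proof (rule ccontr)
      assume ns: "\<not> ?thesis"
      define M H where "M = pi * (2 * x + real k + real l) / real b" and "H = pi * (real k - real l) / real b"
      have "\<gamma> / real b / (1 - \<gamma> / real b) = \<tau>" using b \<gamma> by (simp add: field_simps \<tau>_def)
      then have "\<bar>cos M * sin H\<bar> < \<sigma> + \<eta>" "\<bar>sin M * sin H\<bar> < \<tau> + \<eta>"
        using not_separated_two_levels(1,2)[OF ns b \<gamma>(1,2)] by (simp_all add: M_def H_def \<sigma>_def)
      then have "(cos M * sin H)\<^sup>2 + (sin M * sin H)\<^sup>2 < (\<sigma> + \<eta>)\<^sup>2 + (\<tau> + \<eta>)\<^sup>2"
        by (intro add_strict_mono; subst power2_abs[symmetric]; intro power_strict_mono) auto
      moreover have "(cos M * sin H)\<^sup>2 + (sin M * sin H)\<^sup>2 = ((sin M)\<^sup>2 + (cos M)\<^sup>2) * (sin H)\<^sup>2"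
        by (simp only: power_mult_distrib distrib_right add.commute)
      moreover have "(sin (pi / real b))\<^sup>2 \<le> (sin H)\<^sup>2"
        unfolding H_def using power_mono[OF sin_digit_gap[OF kl], of 2] sin_pi_div_pos[OF b] by simp
      ultimately show False using lt by simp
    qed
  qed
qed

text \<open>The difference is \<open>2 * sin (a + d) * sin d\<close>, and the midpoint
  \<open>a + d\<close> keeps distance at least \<open>d\<close> from both ends of
  \<open>{0..pi}\<close>, so both sines dominate \<open>sin c\<close>.\<close>

lemma cos_diff_half_circle:
  assumes a: "0 \<le> a" "a + 2 * d \<le> pi" "0 \<le> c" "c \<le> d"
  shows "2 * (sin c)\<^sup>2 \<le> cos a - cos (a + 2 * d)"
proof -
  have "cos a - cos (a + 2 * d) = 2 * sin (a + d) * sin d"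
  proof -
    have "(a + (a + 2 * d)) / 2 = a + d" "(a + 2 * d - a) / 2 = d" by simp_all
    then show ?thesis unfolding cos_diff_cos by (simp only:)
  qed
  moreover have "sin c \<le> sin d" using a by (intro sin_monotone_2pi_le) auto
  moreover have "sin d \<le> sin (a + d)"
  proof (cases "a + d \<le> pi / 2")
    case True then show ?thesis using a by (intro sin_monotone_2pi_le) auto
  next
    case False
    have "sin d \<le> sin (pi - (a + d))" using False a by (intro sin_monotone_2pi_le) auto
    then show ?thesis by simp
  qed
  moreover have "0 \<le> sin c" using a by (intro sin_ge_zero) auto
  moreover have "sin c * sin c \<le> sin (a + d) * sin d"
    using calculation by (intro mult_mono) auto
  ultimately show ?thesis by (simp add: power2_eq_square)
qed

text \<open>The angle \<open>2 * pi * (x + real l) / real b\<close> lies in the half circle from 0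
  to pi; on each half the cosine is monotone.\<close>

definition upper_half :: "nat \<Rightarrow> real \<Rightarrow> nat \<Rightarrow> bool" where
  "upper_half b x l \<longleftrightarrow> 2 * (x + real l) \<le> real b"

lemma cos_diff_same_half:
  assumes x: "0 \<le> x" "x < 1" and b: "0 < b" and l: "l < b" "l' < b" "l + \<kappa> \<le> l'" and same: "upper_half b x l \<longleftrightarrow> upper_half b x l'"
  shows "2 * (sin (pi * real \<kappa> / real b))\<^sup>2 \<le> \<bar>cos (2 * pi * (x + real l) / real b) - cos (2 * pi * (x + real l') / real b)\<bar>"
proof -
  define d where "d = pi * (real l' - real l) / real b"
  have d: "0 \<le> pi * real \<kappa> / real b" "pi * real \<kappa> / real b \<le> d"
    unfolding d_def using l by (auto intro!: divide_right_mono mult_left_mono)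
  show ?thesis
  proof (cases "upper_half b x l'")
    case True
    define a where "a = 2 * pi * (x + real l) / real b"
    have e: "2 * pi * (x + real l') / real b = a + 2 * d" using b by (simp add: a_def d_def field_simps)
    have "2 * pi * (x + real l') / real b \<le> pi"
      using True b pi_frac_mono[of "2 * (x + real l')" "real b" b] by (simp add: upper_half_def mult_ac)
    then have "2 * (sin (pi * real \<kappa> / real b))\<^sup>2 \<le> cos a - cos (a + 2 * d)"
      using x d unfolding e by (intro cos_diff_half_circle) (auto simp: a_def)
    then show ?thesis unfolding e a_def[symmetric] by linarith
  next
    case False
    define a where "a = 2 * pi - 2 * pi * (x + real l') / real b"
    have e: "2 * pi * (x + real l) / real b = 2 * pi - (a + 2 * d)" "2 * pi * (x + real l') / real b = 2 * pi - a"
      using b by (simp_all add: a_def d_def field_simps)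
    have "real l' + 1 \<le> real b" using l by linarith
    then have "0 \<le> a" using x b pi_frac_mono[of "2 * (x + real l')" "2 * real b" b] by (simp add: a_def mult_ac)
    moreover have "a + 2 * d \<le> pi"
    proof -
      have "real b \<le> 2 * (x + real l)" using False same by (simp add: upper_half_def)
      then have "pi \<le> 2 * pi * (x + real l) / real b"
        using b pi_frac_mono[of "real b" "2 * (x + real l)" b] by (simp add: mult_ac)
      then show ?thesis using e(1) by linarith
    qed
    ultimately have "2 * (sin (pi * real \<kappa> / real b))\<^sup>2 \<le> cos a - cos (a + 2 * d)"
      using d by (intro cos_diff_half_circle) auto
    moreover have "cos (2 * pi - (a + 2 * d)) = cos (a + 2 * d)" "cos (2 * pi - a) = cos a"
      by (simp_all only: cos_diff sin_two_pi cos_two_pi)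
    ultimately show ?thesis unfolding e by linarith
  qed
qed

lemma card_le_if_diff_less:
  fixes A :: "nat set"
  assumes "finite A" "\<And>i j. i \<in> A \<Longrightarrow> j \<in> A \<Longrightarrow> \<not> i + \<kappa> \<le> j"
  shows "card A \<le> \<kappa>"
proof (cases "A = {}")
  case False
  have "A \<subseteq> {Min A..<Min A + \<kappa>}"
  proof
    fix j assume j: "j \<in> A"
    then show "j \<in> {Min A..<Min A + \<kappa>}" using assms(2)[OF Min_in[OF assms(1) False] j] assms(1) by auto
  qed
  then have "card A \<le> card {Min A..<Min A + \<kappa>}" by (intro card_mono) auto
  then show ?thesis by simp
qed simp

text \<open>Two neighbours of \<open>k\<close> have cosines at most \<open>2 * D\<close> apart, so
  on one half circle their digits differ by less than \<kappa>: at most \<kappa> on each half. Under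
  the stronger bound on \<open>D\<close> the half that contains \<open>k\<close> has no other
  neighbour.\<close>

lemma card_cos_neighbours:
  assumes x: "0 \<le> x" "x < 1" and b: "0 < b" and k: "k < b" and \<kappa>: "D < (sin (pi * real \<kappa> / real b))\<^sup>2"
    and N: "N = {l. l < b \<and> \<bar>cos (2 * pi * (x + real l) / real b) - cos (2 * pi * (x + real k) / real b)\<bar> \<le> D}"
  shows "card N \<le> 2 * \<kappa>" and "D < 2 * (sin (pi / real b))\<^sup>2 \<Longrightarrow> card N \<le> 1 + \<kappa>"
proof -
  have fin: "finite N" unfolding N by simp
  have half: "card {l \<in> N. upper_half b x l = u} \<le> \<kappa>" for u
  proof (rule card_le_if_diff_less)
    fix i j assume ij: "i \<in> {l \<in> N. upper_half b x l = u}" "j \<in> {l \<in> N. upper_half b x l = u}"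
    show "\<not> i + \<kappa> \<le> j"
    proof
      assume "i + \<kappa> \<le> j"
      then have "2 * (sin (pi * real \<kappa> / real b))\<^sup>2 \<le> \<bar>cos (2 * pi * (x + real i) / real b) - cos (2 * pi * (x + real j) / real b)\<bar>"
        using ij N by (intro cos_diff_same_half x b) auto
      also have "\<dots> \<le> 2 * D" using ij N by auto
      finally show False using \<kappa> by simp
    qed
  qed (use fin in auto)
  have split: "N = {l \<in> N. upper_half b x l = u} \<union> {l \<in> N. upper_half b x l = (\<not> u)}" for u by auto
  have cU: "card N \<le> card {l \<in> N. upper_half b x l = u} + card {l \<in> N. upper_half b x l = (\<not> u)}" for u
    by (subst split[of u]) (rule card_Un_le)
  show "card N \<le> 2 * \<kappa>" using cU[of True] half[of True] half[of False] by simp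
  assume D: "D < 2 * (sin (pi / real b))\<^sup>2"
  have "{l \<in> N. upper_half b x l = upper_half b x k} \<subseteq> {k}"
  proof
    fix l assume l: "l \<in> {l \<in> N. upper_half b x l = upper_half b x k}"
    show "l \<in> {k}"
    proof (rule ccontr)
      assume "l \<notin> {k}"
      then have "l + 1 \<le> k \<or> k + 1 \<le> l" by auto
      then have "2 * (sin (pi * real 1 / real b))\<^sup>2 \<le> \<bar>cos (2 * pi * (x + real l) / real b) - cos (2 * pi * (x + real k) / real b)\<bar>"
        using cos_diff_same_half[OF x b, of l k 1] cos_diff_same_half[OF x b, of k l 1] l k N by (auto simp: abs_minus_commute)
      then show False using D l N by auto
    qed
  qed
  then have "card {l \<in> N. upper_half b x l = upper_half b x k} \<le> card {k}" by (intro card_mono) auto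
  then show "card N \<le> 1 + \<kappa>" using cU[of "upper_half b x k"] half[of "\<not> upper_half b x k"] by simp
qed

lemma L2_bounded_count2:
  assumes b: "2 \<le> b" and \<gamma>: "0 < \<gamma>" "\<gamma> < 1" and n: "2 * real \<kappa> < \<gamma> * real b"
    and D: "2 * \<gamma> / (real b - \<gamma>) < (sin (pi * real \<kappa> / real b))\<^sup>2"
  shows "L2_bounded b \<gamma>"
proof -
  obtain D where D: "2 * \<gamma> / (real b - \<gamma>) < D" "D < (sin (pi * real \<kappa> / real b))\<^sup>2" using dense[OF D] by blast
  show ?thesis
    by (rule L2_bounded_if_few_neighbours[OF b \<gamma> D(1), of "2 * \<kappa>"])
       (use n b in \<open>auto intro!: card_cos_neighbours(1)[OF _ _ _ _ D(2)]\<close>)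
qed

lemma L2_bounded_count1:
  assumes b: "2 \<le> b" and \<gamma>: "0 < \<gamma>" "\<gamma> < 1" and n: "1 + real \<kappa> < \<gamma> * real b"
    and D: "2 * \<gamma> / (real b - \<gamma>) < (sin (pi * real \<kappa> / real b))\<^sup>2" "2 * \<gamma> / (real b - \<gamma>) < 2 * (sin (pi / real b))\<^sup>2"
  shows "L2_bounded b \<gamma>"
proof -
  have "2 * \<gamma> / (real b - \<gamma>) < min ((sin (pi * real \<kappa> / real b))\<^sup>2) (2 * (sin (pi / real b))\<^sup>2)" using D by simp
  then obtain D where D: "2 * \<gamma> / (real b - \<gamma>) < D" "D < min ((sin (pi * real \<kappa> / real b))\<^sup>2) (2 * (sin (pi / real b))\<^sup>2)" using dense by blast
  then have D2: "D < (sin (pi * real \<kappa> / real b))\<^sup>2" "D < 2 * (sin (pi / real b))\<^sup>2" by auto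
  show ?thesis
    by (rule L2_bounded_if_few_neighbours[OF b \<gamma> D(1), of "1 + \<kappa>"])
       (use n b D2(2) in \<open>auto intro!: card_cos_neighbours(2)[OF _ _ _ _ D2(1), simplified]\<close>)
qed

section \<open>Bases at least three\<close>

text \<open>Concavity of the sine on \<open>{0..pi}\<close>: the chord from the origin lies below
  the graph. Jordan's inequality and most numerical lower bounds for sines come from here.\<close>

lemma sin_scaled_ge:
  assumes "0 \<le> a" "a \<le> pi" "0 \<le> c" "c \<le> 1"
  shows "c * sin a \<le> sin (c * a)"
proof -
  have "convex_on {0..pi} (\<lambda>x. - sin x)"
  proof (rule f''_ge0_imp_convex)
    show "((\<lambda>x. - sin x) has_real_derivative - cos x) (at x)" for x by (auto intro!: derivative_eq_intros)
    show "((\<lambda>x. - cos x) has_real_derivative sin x) (at x)" for x by (auto intro!: derivative_eq_intros)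
  qed (auto intro: sin_ge_zero)
  then have "- sin ((1 - c) *\<^sub>R 0 + c *\<^sub>R a) \<le> (1 - c) * (- sin 0) + c * (- sin a)"
    using assms by (intro convex_onD) auto
  then show ?thesis by simp
qed

lemma sin_pi_div_ge:
  assumes "6 \<le> b"
  shows "3 / real b \<le> sin (pi / real b)"
proof -
  have "6 / real b * sin (pi / 6) \<le> sin (6 / real b * (pi / 6))"
    using assms by (intro sin_scaled_ge) (auto simp: field_simps)
  then show ?thesis by (simp add: sin_30)
qed

text \<open>As 3 pi / 5 and 2 pi / 5 add up to pi, the cosine of pi / 5 satisfies a cubic that
  splits into \<open>c + 1\<close> and a quadratic.\<close>

lemma sin_square_pi_fifth: "(sin (pi / 5))\<^sup>2 = (5 - sqrt 5) / 8"
proof -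
  define c where "c = cos (pi / 5)"
  have "3 * (pi / 5) = pi - 2 * (pi / 5)" by simp
  then have "cos (3 * (pi / 5)) = cos (pi - 2 * (pi / 5))" by (simp only:)
  also have "\<dots> = - cos (2 * (pi / 5))" by (rule cos_pi_minus)
  finally have "4 * c ^ 3 - 3 * c = - (2 * c\<^sup>2 - 1)"
    unfolding cos_treble_cos cos_double_cos c_def by simp
  then have f: "(c + 1) * (4 * c\<^sup>2 - 2 * c - 1) = 0" by (simp add: power2_eq_square power3_eq_cube algebra_simps)
  have c0: "0 < c" unfolding c_def by (intro cos_gt_zero) (auto simp: field_simps)
  then have q: "4 * c\<^sup>2 - 2 * c - 1 = 0" using f by auto
  then have "(4 * c - 1)\<^sup>2 = 5" by (simp add: power2_eq_square algebra_simps)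
  moreover have "0 \<le> 4 * c - 1"
  proof (rule ccontr)
    assume "\<not> ?thesis"
    then have "c * c \<le> 1 / 4 * c" using c0 by (intro mult_right_mono) auto
    then show False using q c0 unfolding power2_eq_square by linarith
  qed
  ultimately have "4 * c - 1 = sqrt 5" using real_sqrt_unique by metis
  then have c: "c = (1 + sqrt 5) / 4" by simp
  have "(sin (pi / 5))\<^sup>2 = 1 - c\<^sup>2" by (simp add: c_def sin_squared_eq)
  also have "\<dots> = (5 - sqrt 5) / 8" by (simp add: c power2_eq_square field_simps)
  finally show ?thesis .
qed

lemma sqrt5_bounds: "559 / 250 < sqrt 5" "sqrt 5 < (22361 / 10000::real)"
proof -
  show "559 / 250 < sqrt 5" by (rule real_less_rsqrt) (simp add: power2_eq_square)
  show "sqrt 5 < 22361 / 10000" by (rule real_less_lsqrt) (simp_all add: power2_eq_square)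
qed

lemma sin_square_gap_bound:
  assumes "4 \<le> b"
  obtains "b = 4" "(sin (pi / real b))\<^sup>2 = 1 / 2" | "b = 5" "(1727 / 5000) < (sin (pi / real b))\<^sup>2" "(sin (pi / real b))\<^sup>2 < (173 / 500)"
    | "6 \<le> b" "9 / (real b)\<^sup>2 \<le> (sin (pi / real b))\<^sup>2"
proof -
  consider "b = 4" | "b = 5" | "6 \<le> b" using assms by linarith
  then show ?thesis
  proof cases
    case 1
    then show ?thesis using that(1) by (simp add: sin_45 power_divide)
  next
    case 2
    then show ?thesis using that(2) sqrt5_bounds sin_square_pi_fifth by simp
  next
    case 3
    then have "(3 / real b)\<^sup>2 \<le> (sin (pi / real b))\<^sup>2" by (intro power_mono sin_pi_div_ge) auto
    then show ?thesis using that(3) 3 by (simp add: power_divide)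
  qed
qed

text \<open>The number of neighbours has to stay below t = \<gamma> b. For t in (2,3] two are
  allowed, for t in (3,4] three by \<open>L2_bounded_count1\<close>, and beyond that the largest
  even number below t.\<close>

lemma L2_bounded_large_product:
  assumes b: "4 \<le> b" and \<gamma>: "0 < \<gamma>" "\<gamma> < 1" and t: "2 < \<gamma> * real b"
  shows "L2_bounded b \<gamma>"
proof -
  have b2: "2 \<le> b" using b by simp
  have b4: "4 \<le> real b" using b by simp
  have g: "0 < real b - \<gamma>" using b4 \<gamma> by linarith
  consider "\<gamma> * real b \<le> 3" | "3 < \<gamma> * real b" "\<gamma> * real b \<le> 4" | "4 < \<gamma> * real b" by linarith
  then show ?thesis
  proof cases
    case 1
    have "2 * \<gamma> < (sin (pi / real b))\<^sup>2 * (real b - \<gamma>)"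
    proof (rule sin_square_gap_bound[OF b])
      assume h: "b = 4" "(sin (pi / real b))\<^sup>2 = 1 / 2"
      show ?thesis unfolding h(2) using h(1) 1 by simp
    next
      assume h: "b = 5" "(1727 / 5000) < (sin (pi / real b))\<^sup>2" "(sin (pi / real b))\<^sup>2 < (173 / 500)"
      have "(1727 / 5000) * (real b - \<gamma>) \<le> (sin (pi / real b))\<^sup>2 * (real b - \<gamma>)" using h g by (intro mult_right_mono) auto
      then show ?thesis using h(1) 1 by simp
    next
      assume h: "6 \<le> b" "9 / (real b)\<^sup>2 \<le> (sin (pi / real b))\<^sup>2"
      have "2 * \<gamma> * (real b)\<^sup>2 = 2 * (\<gamma> * real b) * real b" by (simp add: power2_eq_square)
      also have "\<dots> \<le> 6 * real b" using 1 h by (intro mult_right_mono) auto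
      also have "\<dots> < 9 * (real b - \<gamma>)" using h \<gamma> by simp
      finally have "2 * \<gamma> < 9 / (real b)\<^sup>2 * (real b - \<gamma>)" using h by (simp add: field_simps)
      also have "\<dots> \<le> (sin (pi / real b))\<^sup>2 * (real b - \<gamma>)" using h g by (intro mult_right_mono) auto
      finally show ?thesis .
    qed
    then show ?thesis using L2_bounded_count2[OF b2 \<gamma>, of 1] t g by (simp add: divide_less_eq)
  next
    case 2
    \<comment> \<open>Then doubling the angle at least doubles the squared sine, so the estimate
      proved next serves both requirements of \<open>L2_bounded_count1\<close>.\<close>
    have half: "(sin (pi / real b))\<^sup>2 \<le> 1 / 2"
    proof -
      have "sin (pi / real b) \<le> sin (pi / 4)" using b by (intro sin_monotone_2pi_le) (auto simp: field_simps order_trans[of _ 0])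
      then have "(sin (pi / real b))\<^sup>2 \<le> (sin (pi / 4))\<^sup>2" using sin_pi_div_pos[OF b2] by (intro power_mono) auto
      then show ?thesis by (simp add: sin_45 power_divide)
    qed
    have "2 * \<gamma> < 2 * (sin (pi / real b))\<^sup>2 * (real b - \<gamma>)"
    proof (rule sin_square_gap_bound[OF b])
      assume h: "b = 4" "(sin (pi / real b))\<^sup>2 = 1 / 2"
      show ?thesis unfolding h(2) using h(1) \<gamma> by simp
    next
      assume h: "b = 5" "(1727 / 5000) < (sin (pi / real b))\<^sup>2" "(sin (pi / real b))\<^sup>2 < (173 / 500)"
      have "2 * (1727 / 5000) * (real b - \<gamma>) \<le> 2 * (sin (pi / real b))\<^sup>2 * (real b - \<gamma>)" using h g by (intro mult_right_mono) auto
      then show ?thesis using h(1) \<gamma> by simp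
    next
      assume h: "6 \<le> b" "9 / (real b)\<^sup>2 \<le> (sin (pi / real b))\<^sup>2"
      have "2 * \<gamma> * (real b)\<^sup>2 = 2 * (\<gamma> * real b) * real b" by (simp add: power2_eq_square)
      also have "\<dots> \<le> 8 * real b" using 2 h by (intro mult_right_mono) auto
      also have "\<dots> < 18 * (real b - \<gamma>)" using h \<gamma> by simp
      finally have "2 * \<gamma> < 2 * (9 / (real b)\<^sup>2) * (real b - \<gamma>)" using h by (simp add: field_simps)
      also have "\<dots> \<le> 2 * (sin (pi / real b))\<^sup>2 * (real b - \<gamma>)" using h g by (intro mult_right_mono) auto
      finally show ?thesis .
    qed
    then have D: "2 * \<gamma> / (real b - \<gamma>) < 2 * (sin (pi / real b))\<^sup>2" using g by (simp add: divide_less_eq)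
    have "(sin (pi * real 2 / real b))\<^sup>2 = (sin (2 * (pi / real b)))\<^sup>2" by (simp add: mult.commute)
    also have "\<dots> = 4 * (sin (pi / real b))\<^sup>2 * (1 - (sin (pi / real b))\<^sup>2)"
      unfolding sin_double by (simp add: power_mult_distrib cos_squared_eq)
    also have "\<dots> \<ge> 4 * (sin (pi / real b))\<^sup>2 * (1 / 2)" using half by (intro mult_left_mono) auto
    finally have "2 * \<gamma> / (real b - \<gamma>) < (sin (pi * real 2 / real b))\<^sup>2" using D by simp
    then show ?thesis using L2_bounded_count1[OF b2 \<gamma>, of 2] D 2 by simp
  next
    case 3
    \<comment> \<open>The largest \<kappa> with
      \<open>2 * real \<kappa> < \<gamma> * real b\<close>; strictness is the reason for ceiling
      minus one.\<close>
    define \<kappa> where "\<kappa> = nat \<lceil>\<gamma> * real b / 2\<rceil> - 1"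
    have k: "2 * real \<kappa> < \<gamma> * real b" "\<gamma> * real b \<le> 2 * real \<kappa> + 2" "2 \<le> \<kappa>"
    proof -
      have c: "2 < \<lceil>\<gamma> * real b / 2\<rceil>" using 3 by linarith
      then have "int \<kappa> = \<lceil>\<gamma> * real b / 2\<rceil> - 1" unfolding \<kappa>_def by linarith
      then have r: "real \<kappa> = of_int \<lceil>\<gamma> * real b / 2\<rceil> - 1" by linarith
      have cc: "of_int \<lceil>\<gamma> * real b / 2\<rceil> - 1 < \<gamma> * real b / 2" "\<gamma> * real b / 2 \<le> of_int \<lceil>\<gamma> * real b / 2\<rceil>"
        using ceiling_correct[of "\<gamma> * real b / 2"] by blast+
      show "2 * real \<kappa> < \<gamma> * real b" using r cc by linarith
      show "\<gamma> * real b \<le> 2 * real \<kappa> + 2" using r cc by linarith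
      show "2 \<le> \<kappa>" using c unfolding \<kappa>_def by linarith
    qed
    have "\<gamma> * real b < 1 * real b" using \<gamma> b by (intro mult_strict_right_mono) auto
    then have tb: "\<gamma> * real b < real b" by simp
    then have "4 < real b" using 3 by linarith
    then have b5: "5 \<le> real b" by simp
    have kb: "2 * real \<kappa> < real b" using k tb by linarith
    have "2 * real \<kappa> / real b * sin (pi / 2) \<le> sin (2 * real \<kappa> / real b * (pi / 2))"
      using kb b5 by (intro sin_scaled_ge) (auto simp: field_simps)
    then have J: "2 * real \<kappa> / real b \<le> sin (pi * real \<kappa> / real b)" by (simp add: mult_ac)
    have "2 * \<gamma> / (real b - \<gamma>) < (2 * real \<kappa> / real b)\<^sup>2"
    proof -
      define K where "K = real \<kappa>"
      have K: "2 \<le> K" "\<gamma> * real b \<le> 2 * K + 2" using k by (auto simp: K_def)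
      have "K * 2 \<le> K * K" using K by (intro mult_left_mono) auto
      \<comment> \<open>That is \<open>4 * K * K - 5 * K - 6 \<ge> 0\<close>, with equality at the
        smallest case \<open>K = 2\<close>.\<close>
      have "0 \<le> (K - 2) * (4 * K + 3)" using K by (intro mult_nonneg_nonneg) auto
      then have "K * K \<le> 5 * (K * K - K - 1)" by (simp add: algebra_simps)
      also have "\<dots> \<le> real b * (K * K - K - 1)"
      proof (rule mult_right_mono[OF b5])
        show "0 \<le> K * K - K - 1" using \<open>K * 2 \<le> K * K\<close> K by linarith
      qed
      finally have "(K + 1) * real b \<le> K * K * (real b - 1)" by (simp add: algebra_simps)
      also have "\<dots> < K * K * (real b - \<gamma>)" using \<gamma> K by (intro mult_strict_left_mono) auto
      finally have "(2 * K + 2) * real b < 2 * (K * K * (real b - \<gamma>))" by (simp add: algebra_simps)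
      moreover have "\<gamma> * real b * real b \<le> (2 * K + 2) * real b" using K b5 by (intro mult_right_mono) auto
      ultimately have "2 * \<gamma> * (real b)\<^sup>2 < (2 * K)\<^sup>2 * (real b - \<gamma>)" by (simp add: power2_eq_square algebra_simps)
      then show ?thesis using g b5 by (simp add: K_def[symmetric] field_simps)
    qed
    also have "\<dots> \<le> (sin (pi * real \<kappa> / real b))\<^sup>2" using J by (intro power_mono) auto
    finally show ?thesis using L2_bounded_count2[OF b2 \<gamma> k(1)] by blast
  qed
qed

text \<open>Since \<gamma> \<le> 2 / b \<le> 2 / 7, the tails are at most 2.8 / b and 0.3 / b,
  against a gap of at least 3 / b.\<close>

lemma L2_bounded_ge7:
  assumes b: "7 \<le> b" and \<gamma>: "0 < \<gamma>" "\<gamma> < 1" and t: "1 < \<gamma> * real b" "\<gamma> * real b \<le> 2"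
  shows "L2_bounded b \<gamma>"
proof (rule L2_bounded_if_gap_dominates)
  have b7: "7 \<le> real b" using b by simp
  have "\<gamma> * 7 \<le> \<gamma> * real b" using b7 \<gamma> by (intro mult_left_mono) auto
  then have g: "\<gamma> \<le> 2 / 7" using t by simp
  have "\<gamma> / (1 - \<gamma>) \<le> (14 / 5) / real b" using g \<gamma> t b7 by (simp add: field_simps)
  then have 1: "(\<gamma> / (1 - \<gamma>))\<^sup>2 \<le> ((14 / 5) / real b)\<^sup>2" using \<gamma> by (intro power_mono) auto
  have "\<gamma> / (real b - \<gamma>) \<le> (3 / 10) / real b" using g \<gamma> t b7 by (simp add: field_simps)
  then have 2: "(\<gamma> / (real b - \<gamma>))\<^sup>2 \<le> ((3 / 10) / real b)\<^sup>2" using \<gamma> b7 by (intro power_mono) auto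
  have "((14 / 5) / real b)\<^sup>2 + ((3 / 10) / real b)\<^sup>2 < (3 / real b)\<^sup>2"
    using b7 by (simp add: power_divide field_simps power2_eq_square)
  also have "\<dots> \<le> (sin (pi / real b))\<^sup>2" using b by (intro power_mono sin_pi_div_ge) auto
  finally show "(\<gamma> / (1 - \<gamma>))\<^sup>2 + (\<gamma> / (real b - \<gamma>))\<^sup>2 < (sin (pi / real b))\<^sup>2" using 1 2 by linarith
qed (use assms in auto)

text \<open>For these bases the gap dominates up to 1.64, a little past the golden ratio, where
  \<open>L2_bounded_golden\<close> can take over.\<close>

lemma L2_bounded_456_small:
  assumes b: "b = 4 \<or> b = 5 \<or> b = 6" and \<gamma>: "0 < \<gamma>" "\<gamma> < 1" and t: "1 < \<gamma> * real b" "\<gamma> * real b \<le> (41 / 25)"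
  shows "L2_bounded b \<gamma>"
proof (rule L2_bounded_if_gap_dominates)
  have bound: "(\<gamma> / (1 - \<gamma>))\<^sup>2 + (\<gamma> / (real b - \<gamma>))\<^sup>2 \<le> B\<^sup>2 + C\<^sup>2"
    if "\<gamma> \<le> B * (1 - \<gamma>)" "\<gamma> \<le> C * (real b - \<gamma>)" for B C
    using that \<gamma> b by (intro add_mono power_mono) (auto simp: divide_le_eq)
  have s: "4 \<le> b" using b by auto
  show "(\<gamma> / (1 - \<gamma>))\<^sup>2 + (\<gamma> / (real b - \<gamma>))\<^sup>2 < (sin (pi / real b))\<^sup>2"
  proof (rule sin_square_gap_bound[OF s])
    assume h: "b = 4" "(sin (pi / real b))\<^sup>2 = 1 / 2"
    then have "\<gamma> \<le> (41 / 100)" using t by simp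
    then have "(\<gamma> / (1 - \<gamma>))\<^sup>2 + (\<gamma> / (real b - \<gamma>))\<^sup>2 \<le> (139 / 200)\<^sup>2 + (1143 / 10000)\<^sup>2" using h by (intro bound) auto
    also have "\<dots> < 1 / 2" by (simp add: power2_eq_square)
    finally show ?thesis using h by simp
  next
    assume h: "b = 5" "(1727 / 5000) < (sin (pi / real b))\<^sup>2"
    then have "\<gamma> \<le> (41 / 125)" using t by simp
    then have "(\<gamma> / (1 - \<gamma>))\<^sup>2 + (\<gamma> / (real b - \<gamma>))\<^sup>2 \<le> (1 / 2)\<^sup>2 + (1 / 10)\<^sup>2" using h by (intro bound) auto
    also have "\<dots> < (1727 / 5000)" by (simp add: power2_eq_square)
    finally show ?thesis using h by simp
  next
    assume h: "6 \<le> b" "9 / (real b)\<^sup>2 \<le> (sin (pi / real b))\<^sup>2"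
    then have b6: "b = 6" using b by auto
    then have "\<gamma> \<le> (7 / 25)" using t by simp
    then have "(\<gamma> / (1 - \<gamma>))\<^sup>2 + (\<gamma> / (real b - \<gamma>))\<^sup>2 \<le> (2 / 5)\<^sup>2 + (1 / 10)\<^sup>2" using b6 by (intro bound) auto
    also have "\<dots> < 9 / (real b)\<^sup>2" by (simp add: power2_eq_square b6)
    finally show ?thesis using h by simp
  qed
qed (use assms in auto)

text \<open>The terms of the second digit contribute \<open>(p, q)\<close> with \<open>p\<^sup>2 + q\<^sup>2 \<le> 1\<close>, so they cannot
  make up for both components of the first ones at the same time.\<close>
lemma near_multiple_if_not_separated:
  assumes ns: "\<not> separated b \<gamma> \<eta> 2 x k l" and b: "2 \<le> b" and \<gamma>: "0 < \<gamma>" "\<gamma> < 1" and kl: "k < b" "l < b" "k \<noteq> l"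
    and w: "0 < w" "2 * w < real b" and a: "0 \<le> a" "a \<le> sin (pi / real b)" and z: "0 \<le> z" "z \<le> sin (pi * w / real b)" and \<eta>: "0 < \<eta>"
    and A: "0 \<le> A" "A\<^sup>2 + (\<gamma> / (real b - \<gamma>) + \<eta>)\<^sup>2 \<le> a\<^sup>2"
    and PQ: "0 \<le> P" "0 \<le> Q" "1 < P\<^sup>2 + Q\<^sup>2" "\<gamma> * P + \<gamma>\<^sup>2 / (1 - \<gamma>) + \<eta> \<le> A"
      "\<gamma> / real b * Q + (\<gamma> / real b)\<^sup>2 / (1 - \<gamma> / real b) + \<eta> \<le> a * z"
  shows "near_multiple b w x k l"
proof (rule ccontr)
  assume nn: "\<not> ?thesis"
  define M H where "M = pi * (2 * x + real k + real l) / real b" and "H = pi * (real k - real l) / real b"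
  have zM: "z \<le> \<bar>sin M\<bar>" using nn near_multipleI[OF _ w, of x k l] z unfolding M_def by linarith
  have aH: "a \<le> \<bar>sin H\<bar>" using sin_digit_gap[OF kl] a unfolding H_def by linarith
  define S C where "S = cos M * sin H" and "C = sin M * sin H"
  have b0: "0 < real b" using b by simp
  have rho: "\<gamma> / real b / (1 - \<gamma> / real b) = \<gamma> / (real b - \<gamma>)" using b \<gamma> by (simp add: field_simps)
  obtain p q where pq: "p\<^sup>2 + q\<^sup>2 \<le> 1" "\<bar>S + \<gamma> * p\<bar> < \<gamma>\<^sup>2 / (1 - \<gamma>) + \<eta>"
     "\<bar>C + \<gamma> / real b * q\<bar> < (\<gamma> / real b)\<^sup>2 / (1 - \<gamma> / real b) + \<eta>"
    using not_separated_two_levels(3)[OF ns b \<gamma>] unfolding S_def C_def M_def H_def by auto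
  have C: "\<bar>C\<bar> < \<gamma> / (real b - \<gamma>) + \<eta>"
    using not_separated_two_levels(2)[OF ns b \<gamma>] unfolding rho C_def M_def H_def by simp
  have "a * z \<le> \<bar>C\<bar>" unfolding C_def abs_mult using zM aH a z by (subst mult.commute) (intro mult_mono, auto)
  moreover have "\<bar>\<gamma> / real b * q\<bar> = \<gamma> / real b * \<bar>q\<bar>" using \<gamma> by (simp add: abs_mult)
  ultimately have "\<gamma> / real b * Q < \<gamma> / real b * \<bar>q\<bar>" using pq(3) PQ(5) by linarith
  then have Q: "Q < \<bar>q\<bar>" using \<gamma> b0 by (simp add: divide_less_cancel)
  have "S\<^sup>2 + C\<^sup>2 = ((sin M)\<^sup>2 + (cos M)\<^sup>2) * (sin H)\<^sup>2"
    unfolding S_def C_def by (simp only: power_mult_distrib distrib_right add.commute)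
  then have "S\<^sup>2 + C\<^sup>2 = (sin H)\<^sup>2" by simp
  moreover have "a\<^sup>2 \<le> (sin H)\<^sup>2" using power_mono[OF aH a(1), of 2] by simp
  moreover have "C\<^sup>2 \<le> (\<gamma> / (real b - \<gamma>) + \<eta>)\<^sup>2" using power_mono[of "\<bar>C\<bar>" _ 2] C by simp
  ultimately have "A\<^sup>2 \<le> \<bar>S\<bar>\<^sup>2" using A(2) by simp
  then have "A \<le> \<bar>S\<bar>" by (rule power2_le_imp_le) simp
  moreover have "\<bar>\<gamma> * p\<bar> = \<gamma> * \<bar>p\<bar>" using \<gamma> by (simp add: abs_mult)
  ultimately have "\<gamma> * P < \<gamma> * \<bar>p\<bar>" using pq(2) PQ(4) by linarith
  then have P: "P < \<bar>p\<bar>" using \<gamma> by simp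
  have "P\<^sup>2 \<le> p\<^sup>2" "Q\<^sup>2 \<le> q\<^sup>2" using power_mono[of P "\<bar>p\<bar>" 2] power_mono[of Q "\<bar>q\<bar>" 2] P Q PQ by simp_all
  then show False using pq(1) PQ(3) by linarith
qed

lemma golden_bound: "(1 + sqrt 5) / 2 < ((81 / 50)::real)"
  using sqrt5_bounds by simp

lemma square_div_bounds:
  assumes "0 < \<gamma>" "\<gamma> \<le> g" "g < (1::real)"
  shows "\<gamma> / (1 - \<gamma>) \<le> g / (1 - g)" "\<gamma>\<^sup>2 / (1 - \<gamma>) \<le> g\<^sup>2 / (1 - g)"
  using assms by (auto intro!: frac_le power_mono)

lemma L2_bounded_456_golden:
  assumes b: "b = 4 \<or> b = 5 \<or> b = 6" and \<gamma>: "0 < \<gamma>" "\<gamma> < 1" and t: "(81 / 50) \<le> \<gamma> * real b" "\<gamma> * real b \<le> 2"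
  shows "L2_bounded b \<gamma>"
proof (rule L2_bounded_golden[where \<eta> = "1 / 1000" and ?N0.0 = 2])
  fix x :: real and k l assume kl: "k < b" "l < b" "k \<noteq> l" and nn: "\<not> near_multiple b (1 / real b) x k l"
  show "separated b \<gamma> (1 / 1000) 2 x k l"
  proof (rule ccontr)
    assume ns: "\<not> ?thesis"
    have b2: "2 \<le> b" using b by auto
    \<comment> \<open>All tails increase with \<gamma>, so the numerical conditions are checked only
      at the right end \<open>g\<close> of the range.\<close>
    define g where "g = 2 / real b"
    have g: "\<gamma> \<le> g" "g < 1" using b t by (auto simp: g_def)
    have G: "\<gamma>\<^sup>2 / (1 - \<gamma>) \<le> g\<^sup>2 / (1 - g)" by (rule square_div_bounds(2)[OF \<gamma>(1) g])
    have R: "\<gamma> / real b \<le> g / real b" "(\<gamma> / real b)\<^sup>2 / (1 - \<gamma> / real b) \<le> (g / real b)\<^sup>2 / (1 - g / real b)"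
      using g \<gamma> b by (auto intro!: divide_right_mono square_div_bounds(2))
    have T: "\<gamma> / (real b - \<gamma>) \<le> g / (real b - g)" using g \<gamma> b by (intro frac_le) auto
    \<comment> \<open>\<open>A\<close> bounds the sine component of the first term from below;
      \<open>P\<close> and \<open>Q\<close> are what the second digit would have to supply in the
      two components to cancel it.\<close>
    have key: "near_multiple b (1 / real b) x k l"
      if a: "0 \<le> a" "a \<le> sin (pi / real b)" and z: "0 \<le> z" "z \<le> sin (pi * (1 / real b) / real b)"
        and A: "0 \<le> A" "A\<^sup>2 + (g / (real b - g) + 1 / 1000)\<^sup>2 \<le> a\<^sup>2"
        and PQ: "0 \<le> P" "0 \<le> Q" "1 < P\<^sup>2 + Q\<^sup>2" "g * P + g\<^sup>2 / (1 - g) + 1 / 1000 \<le> A"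
          "g / real b * Q + (g / real b)\<^sup>2 / (1 - g / real b) + 1 / 1000 \<le> a * z" for a z A P Q
    proof (rule near_multiple_if_not_separated[OF ns b2 \<gamma> kl _ _ a z _ A(1) _ PQ(1-3)])
      have "(\<gamma> / (real b - \<gamma>) + 1 / 1000)\<^sup>2 \<le> (g / (real b - g) + 1 / 1000)\<^sup>2"
        using T \<gamma> b by (intro power_mono add_mono) auto
      then show "A\<^sup>2 + (\<gamma> / (real b - \<gamma>) + 1 / 1000)\<^sup>2 \<le> a\<^sup>2" using A by linarith
      have "\<gamma> * P \<le> g * P" using g PQ by (intro mult_right_mono) auto
      then show "\<gamma> * P + \<gamma>\<^sup>2 / (1 - \<gamma>) + 1 / 1000 \<le> A" using PQ G by linarith
      have "\<gamma> / real b * Q \<le> g / real b * Q" using R PQ by (intro mult_right_mono) auto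
      then show "\<gamma> / real b * Q + (\<gamma> / real b)\<^sup>2 / (1 - \<gamma> / real b) + 1 / 1000 \<le> a * z" using PQ R by linarith
    qed (use b in auto)
    have chord: "3 / (real b)\<^sup>2 \<le> sin (pi * (1 / real b) / real b)"
    proof -
      have "6 / (real b)\<^sup>2 * sin (pi / 6) \<le> sin (6 / (real b)\<^sup>2 * (pi / 6))"
        using b by (intro sin_scaled_ge) auto
      then show ?thesis by (simp add: sin_30 power2_eq_square)
    qed
    have "near_multiple b (1 / real b) x k l"
    proof -
      consider "b = 4" | "b = 5" | "b = 6" using b by blast
      then show ?thesis
      proof cases
        case 1
        define c where "c = cos (pi / 8)"
        have "cos (2 * (pi / 8)) = sqrt 2 / 2" by (simp add: cos_45)
        then have "2 * c\<^sup>2 - 1 = sqrt 2 / 2" unfolding cos_double_cos c_def .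
        moreover have "sqrt 2 < (14143 / 10000)" by (intro real_less_lsqrt) (auto simp: power2_eq_square)
        ultimately have "c\<^sup>2 < (231 / 250)\<^sup>2" by (simp add: power2_eq_square)
        then have "c < (231 / 250)" by (rule power2_less_imp_less) simp
        moreover have "c = 1 - 2 * (sin (pi / 16))\<^sup>2" using cos_double_sin[of "pi / 16"] by (simp add: c_def)
        ultimately have "(19493 / 100000)\<^sup>2 \<le> (sin (pi / 16))\<^sup>2" by (simp add: power2_eq_square)
        then have z: "(19493 / 100000) \<le> sin (pi / 16)"
          by (rule power2_le_imp_le) (auto intro!: sin_ge_zero)
        have s: "(7071 / 10000) \<le> sin (pi / 4)"
          unfolding sin_45 using real_le_rsqrt[of "(7071 / 5000)" 2] by (simp add: power2_eq_square)
        \<comment> \<open>The witnesses \<open>a\<close> and \<open>z\<close> lie just below the two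
          sines; \<open>A\<close>, \<open>P\<close>, \<open>Q\<close> are then taken at or somewhat
          below the largest values that the conditions of \<open>key\<close> allow. The same holds
          for bases 5 and 6.\<close>
        show ?thesis
          by (rule key[of "(7071 / 10000)" "(19493 / 100000)" "(3461 / 5000)" "(239 / 625)" "(951 / 1000)"]) (use 1 z s in \<open>auto simp: g_def power2_eq_square\<close>)
      next
        case 2
        have "(47 / 80)\<^sup>2 \<le> (sin (pi / 5))\<^sup>2" unfolding sin_square_pi_fifth using sqrt5_bounds by (simp add: power2_eq_square)
        then have s: "(47 / 80) \<le> sin (pi / 5)" by (rule power2_le_imp_le) (auto intro!: sin_ge_zero)
        show ?thesis
          by (rule key[of "(47 / 80)" "(3 / 25)" "(29 / 50)" "(39 / 50)" "(39 / 50)"]) (use 2 s chord in \<open>auto simp: g_def power2_eq_square\<close>)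
      next
        case 3
        show ?thesis
          by (rule key[of "(1 / 2)" "1 / 12" "(62 / 125)" "(49 / 50)" "(3 / 5)"]) (use 3 chord in \<open>auto simp: g_def power2_eq_square sin_30\<close>)
      qed
    qed
    then show False using nn by blast
  qed
qed (use assms golden_bound in auto)

theorem L2_bounded_ge4:
  assumes b: "4 \<le> b" and \<gamma>: "0 < \<gamma>" "\<gamma> < 1" and t: "1 < \<gamma> * real b"
  shows "L2_bounded b \<gamma>"
proof -
  consider "2 < \<gamma> * real b" | "\<gamma> * real b \<le> 2" by linarith
  then show ?thesis
  proof cases
    case 1
    then show ?thesis using L2_bounded_large_product[OF b \<gamma>] by blast
  next
    case 2
    consider "7 \<le> b" | "b = 4 \<or> b = 5 \<or> b = 6" using b by linarith
    then show ?thesis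
    proof cases
      case 1
      then show ?thesis using L2_bounded_ge7[OF _ \<gamma> t] 2 by blast
    next
      case b: 2
      show ?thesis
        using L2_bounded_456_small[OF b \<gamma> t] L2_bounded_456_golden[OF b \<gamma> _ 2] by (cases "\<gamma> * real b \<le> (41 / 25)") auto
    qed
  qed
qed


section \<open>Base three\<close>

lemma near_multiple_if_not_separated_crude:
  assumes ns: "\<not> separated b \<gamma> \<eta> 2 x k l" and b: "2 \<le> b" and \<gamma>: "0 < \<gamma>" "\<gamma> < 1" and kl: "k < b" "l < b" "k \<noteq> l"
    and w: "0 < w" "2 * w < real b" and a: "0 \<le> a" "a \<le> sin (pi / real b)" and z: "0 \<le> z" "z \<le> sin (pi * w / real b)"
    and az: "\<gamma> / (real b - \<gamma>) + \<eta> \<le> a * z"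
  shows "near_multiple b w x k l"
proof (rule ccontr)
  assume nn: "\<not> ?thesis"
  define M H where "M = pi * (2 * x + real k + real l) / real b" and "H = pi * (real k - real l) / real b"
  have zM: "z \<le> \<bar>sin M\<bar>" using nn near_multipleI[OF _ w, of x k l] z unfolding M_def by linarith
  have aH: "a \<le> \<bar>sin H\<bar>" using sin_digit_gap[OF kl] a unfolding H_def by linarith
  have rho: "\<gamma> / real b / (1 - \<gamma> / real b) = \<gamma> / (real b - \<gamma>)" using b \<gamma> by (simp add: field_simps)
  have "\<bar>sin M * sin H\<bar> < \<gamma> / (real b - \<gamma>) + \<eta>"
    using not_separated_two_levels(2)[OF ns b \<gamma>] unfolding rho M_def H_def by simp
  moreover have "a * z \<le> \<bar>sin M * sin H\<bar>" unfolding abs_mult using zM aH a z by (subst mult.commute) (intro mult_mono, auto)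
  ultimately show False using az by linarith
qed

lemma sin_treble: "sin (3 * a) = 3 * sin a - 4 * sin a ^ 3" for a :: real
proof -
  have "sin (3 * a) = sin (2 * a + a)" by simp
  also have "\<dots> = 2 * sin a * (1 - (sin a)\<^sup>2) + (1 - 2 * (sin a)\<^sup>2) * sin a"
    unfolding sin_add sin_double cos_double_sin by (simp add: power2_eq_square cos_squared_eq[unfolded power2_eq_square] mult.assoc)
  also have "\<dots> = 3 * sin a - 4 * sin a ^ 3" by (simp add: power2_eq_square power3_eq_cube algebra_simps)
  finally show ?thesis .
qed

text \<open>For nonnegative \<open>s\<close> the cube lies above its tangent at 269 / 500, which
  nearly maximises \<open>(3 + g) * s - 4 * s ^ 3\<close> for the largest \<open>g\<close>; this
  reduces the claim to a linear one.\<close>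

lemma cubic_upper:
  assumes s: "\<bar>s\<bar> \<le> 1" and g: "0 \<le> g" "g \<le> (943 / 2000::real)"
  shows "(3 + g) * s - 4 * s ^ 3 \<le> 5 / 4"
proof (cases "0 \<le> s")
  case True
  have "(3 + g) * s \<le> (3 + 943 / 2000) * s" using True g by (intro mult_right_mono) auto
  moreover have "0 \<le> s ^ 3 - 3 * (269 / 500)\<^sup>2 * s + 2 * (269 / 500) ^ 3"
  proof -
    have "(s - c)\<^sup>2 * (s + 2 * c) = s ^ 3 - 3 * c\<^sup>2 * s + 2 * c ^ 3" for c
      by (simp add: power2_eq_square power3_eq_cube algebra_simps)
    moreover have "0 \<le> (s - 269 / 500)\<^sup>2 * (s + 2 * (269 / 500))" using True by (intro mult_nonneg_nonneg) auto
    ultimately show ?thesis by metis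
  qed
  ultimately show ?thesis using True by (simp add: power_divide)
next
  case False
  have "- s * s\<^sup>2 \<le> - s * 1" using False s by (intro mult_left_mono) (auto simp: abs_square_le_1)
  moreover have "- s * s\<^sup>2 = - (s ^ 3)" by (simp add: power2_eq_square power3_eq_cube)
  moreover have "g * s \<le> 0" using False g by (simp add: mult_nonneg_nonpos)
  moreover have "(3 + g) * s = 3 * s + g * s" by (simp add: distrib_right)
  ultimately show ?thesis using False s by linarith
qed

text \<open>In base 3 the angles of consecutive levels are \<open>3 * a\<close> and
  \<open>a\<close>. The two sines cannot be extremal with equal sign, so 5 / 4 improves on the
  trivial bound \<open>1 + g\<close> at the top of the range.\<close>

lemma sin_treble_combination:
  assumes g: "0 \<le> g" "g \<le> (943 / 2000::real)"
  shows "\<bar>sin (3 * a) + g * sin a\<bar> \<le> 5 / 4"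
proof -
  have "sin (3 * a) + g * sin a = (3 + g) * sin a - 4 * sin a ^ 3"
    unfolding sin_treble by (simp add: algebra_simps)
  moreover have "- (sin (3 * a) + g * sin a) = (3 + g) * sin (- a) - 4 * sin (- a) ^ 3"
    unfolding sin_treble by (simp add: power3_eq_cube algebra_simps)
  ultimately show ?thesis using cubic_upper[OF abs_sin_le_one g, of a] cubic_upper[OF abs_sin_le_one g, of "- a"] by linarith
qed

lemma sin_gap_3: "(sin (pi / 3))\<^sup>2 = 3 / 4" "433 / 500 \<le> sin (pi / 3)"
proof -
  show "(sin (pi / 3))\<^sup>2 = 3 / 4" by (simp add: sin_60 power_divide)
  have "433 / 250 \<le> sqrt 3" by (rule real_le_rsqrt) (simp add: power2_eq_square)
  then show "433 / 500 \<le> sin (pi / 3)" by (simp add: sin_60)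
qed

text \<open>At the top of the range, just above sqrt 2 / 3, the tail \<gamma> / (1 - \<gamma>)
  exceeds the gap sin (pi / 3), so the first digit alone cannot exclude tangency. Joining the second
  and third level by \<open>sin_treble_combination\<close> brings the sine component down to
  0.79.\<close>

lemma L2_bounded_3_none:
  assumes \<gamma>: "1 < \<gamma> * 3" "\<gamma> \<le> 943 / 2000"
  shows "L2_bounded 3 \<gamma>"
proof (rule L2_bounded_if_separated[where \<eta> = "1 / 1000" and ?N0.0 = 3])
  show g: "0 < \<gamma>" "\<gamma> < 1" using \<gamma> by auto
  fix x :: real and k l :: nat assume kl: "k < 3" "l < 3" "k \<noteq> l"
  show "separated 3 \<gamma> (1 / 1000) 3 x k l"
  proof (rule ccontr)
    assume ns: "\<not> ?thesis"
    obtain j j' where j: "j mod 3 = k" "j' mod 3 = l"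
      and s': "\<And>m. m \<le> 3 \<Longrightarrow> \<bar>sine_diff 3 \<gamma> m x j j'\<bar> < \<gamma> ^ m / (1 - \<gamma>) + 1 / 1000"
      and c': "\<And>m. m \<le> 3 \<Longrightarrow> \<bar>cosine_diff 3 \<gamma> m x j j'\<bar> < (\<gamma> / real 3) ^ m / (1 - \<gamma> / real 3) + 1 / 1000"
    proof (rule not_separatedE[OF ns _ g])
      show "2 \<le> (3::nat)" by simp
    qed blast
    note s = s'[of 3, simplified] and c = c'[of 1, simplified]
    define M H where "M = pi * (2 * x + real k + real l) / real 3" and "H = pi * (real k - real l) / real 3"
    define u v where "u = 2 * pi * (x + real j) / 27" and "v = 2 * pi * (x + real j') / 27"
    have first: "cos (pi * (2 * x + real j + real j') / real 3) * sin (pi * (real j - real j') / real 3) = cos M * sin H"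
      "sin (pi * (2 * x + real j + real j') / real 3) * sin (pi * (real j - real j') / real 3) = sin M * sin H"
      unfolding M_def H_def by (rule first_digit_diff[OF j]; simp)+
    have prod: "cos p * sin q = (sin (p + q) - sin (p - q)) / 2" for p q :: real by (simp add: sin_add sin_diff)
    have "sine_diff 3 \<gamma> 3 x j j' = cos M * sin H + \<gamma> * ((sin (3 * u) - sin (3 * v)) / 2) + \<gamma>\<^sup>2 * ((sin u - sin v) / 2)"
    proof -
      have e: "pi * (2 * x + real j + real j') / 9 + pi * (real j - real j') / 9 = 3 * u"
         "pi * (2 * x + real j + real j') / 9 - pi * (real j - real j') / 9 = 3 * v"
         "pi * (2 * x + real j + real j') / 27 + pi * (real j - real j') / 27 = u"
         "pi * (2 * x + real j + real j') / 27 - pi * (real j - real j') / 27 = v"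
        by (simp_all add: u_def v_def algebra_simps add_divide_distrib diff_divide_distrib)
      have "sine_diff 3 \<gamma> 3 x j j' = cos M * sin H + \<gamma> * (cos (pi * (2 * x + real j + real j') / 9) * sin (pi * (real j - real j') / 9))
          + \<gamma>\<^sup>2 * (cos (pi * (2 * x + real j + real j') / 27) * sin (pi * (real j - real j') / 27))"
        using first(1) by (simp add: sine_diff_def eval_nat_numeral)
      then show ?thesis by (simp only: prod e)
    qed
    also have "\<dots> = cos M * sin H + \<gamma> / 2 * ((sin (3 * u) + \<gamma> * sin u) - (sin (3 * v) + \<gamma> * sin v))"
      by (simp add: power2_eq_square field_simps)
    finally have sd: "sine_diff 3 \<gamma> 3 x j j' = cos M * sin H + \<gamma> / 2 * ((sin (3 * u) + \<gamma> * sin u) - (sin (3 * v) + \<gamma> * sin v))" .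
    have "\<bar>(sin (3 * u) + \<gamma> * sin u) - (sin (3 * v) + \<gamma> * sin v)\<bar> \<le> 5 / 2"
      using sin_treble_combination[of \<gamma> u] sin_treble_combination[of \<gamma> v] g \<gamma> by linarith
    then have "\<bar>\<gamma> / 2 * ((sin (3 * u) + \<gamma> * sin u) - (sin (3 * v) + \<gamma> * sin v))\<bar> \<le> 943 / 2000 / 2 * (5 / 2)"
      unfolding abs_mult using g \<gamma> by (intro mult_mono) auto
    moreover have "\<gamma> ^ 3 / (1 - \<gamma>) \<le> (943 / 2000) ^ 3 / (1 - 943 / 2000)"
      using g \<gamma> by (intro frac_le power_mono) auto
    moreover have "943 / 2000 / 2 * (5 / 2) + (943 / 2000) ^ 3 / (1 - 943 / 2000) + 1 / 1000 \<le> (79 / 100 :: real)"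
      by (simp add: power3_eq_cube)
    ultimately have S: "\<bar>cos M * sin H\<bar> \<le> 79 / 100" using s unfolding sd by linarith
    have "cosine_diff 3 \<gamma> 1 x j j' = sin M * sin H" using first(2) by (simp add: cosine_diff_def)
    moreover have "(\<gamma> / 3) / (1 - \<gamma> / 3) \<le> (943 / 2000 / 3) / (1 - 943 / 2000 / 3)"
      using g \<gamma> by (intro frac_le) auto
    ultimately have C: "\<bar>sin M * sin H\<bar> \<le> 19 / 100" using c by simp
    have "(cos M * sin H)\<^sup>2 + (sin M * sin H)\<^sup>2 \<le> (79 / 100)\<^sup>2 + (19 / 100)\<^sup>2"
      using power_mono[OF S, of 2] power_mono[OF C, of 2] by simp
    moreover have "(cos M * sin H)\<^sup>2 + (sin M * sin H)\<^sup>2 = ((sin M)\<^sup>2 + (cos M)\<^sup>2) * (sin H)\<^sup>2"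
      by (simp only: power_mult_distrib distrib_right add.commute)
    moreover from this have "(cos M * sin H)\<^sup>2 + (sin M * sin H)\<^sup>2 = (sin H)\<^sup>2" by simp
    moreover have "(sin (pi / 3))\<^sup>2 \<le> (sin H)\<^sup>2"
      using power_mono[OF sin_digit_gap[OF kl], of 2] sin_gap_3(2) unfolding H_def by simp
    moreover have "(79 / 100)\<^sup>2 + (19 / 100)\<^sup>2 < (3 / 4 :: real)" by (simp add: power2_eq_square)
    ultimately show False using sin_gap_3(1) by linarith
  qed
qed (use \<gamma> in auto)

lemma L2_bounded_3_sqrt2:
  assumes \<gamma>: "943 / 2000 < \<gamma>" "\<gamma> \<le> 2697 / 5000"
  shows "L2_bounded 3 \<gamma>"
proof (rule L2_bounded_sqrt2[where \<eta> = "1 / 1000" and ?N0.0 = 2])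
  have "sqrt 2 < 14143 / 10000" by (rule real_less_lsqrt) (simp_all add: power2_eq_square)
  then show "sqrt 2 < \<gamma> * real 3" using \<gamma> by simp
  have "cos (2 * (pi / 12)) = sqrt 3 / 2" by (simp add: cos_30)
  then have "(sin (pi / 12))\<^sup>2 = (1 - sqrt 3 / 2) / 2" unfolding cos_double_sin by simp
  moreover have "sqrt 3 < 17321 / 10000" by (rule real_less_lsqrt) (simp_all add: power2_eq_square)
  ultimately have "(64 / 250)\<^sup>2 \<le> (sin (pi / 12))\<^sup>2" by (simp add: power2_eq_square)
  then have z: "64 / 250 \<le> sin (pi / 12)" by (rule power2_le_imp_le) (auto intro!: sin_ge_zero)
  have T: "\<gamma> / (real 3 - \<gamma>) \<le> 2697 / 5000 / (3 - 2697 / 5000)" using \<gamma> by (intro frac_le) auto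
  fix x :: real and k l :: nat assume kl: "k < 3" "l < 3" "k \<noteq> l" and nn: "\<not> near_multiple 3 (1 / (real 3 + 1)) x k l"
  show "separated 3 \<gamma> (1 / 1000) 2 x k l"
    by (rule ccontr, rule notE[OF nn], rule near_multiple_if_not_separated_crude[where a = "433 / 500" and z = "64 / 250"])
       (use \<gamma> kl sin_gap_3 z T in auto)
qed (use \<gamma> in auto)

lemma L2_bounded_3_golden:
  assumes \<gamma>: "2697 / 5000 < \<gamma>" "\<gamma> \<le> 2 / 3"
  shows "L2_bounded 3 \<gamma>"
proof (rule L2_bounded_golden[where \<eta> = "1 / 1000" and ?N0.0 = 2])
  show "(1 + sqrt 5) / 2 < \<gamma> * real 3" using \<gamma> sqrt5_bounds by simp
  have "2 / 3 * sin (pi / 6) \<le> sin (2 / 3 * (pi / 6))" by (intro sin_scaled_ge) auto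
  then have z: "1 / 3 \<le> sin (pi / 9)" by (simp add: sin_30)
  have T: "\<gamma> / (real 3 - \<gamma>) \<le> 2 / 3 / (3 - 2 / 3)" using \<gamma> by (intro frac_le) auto
  fix x :: real and k l :: nat assume kl: "k < 3" "l < 3" "k \<noteq> l" and nn: "\<not> near_multiple 3 (1 / real 3) x k l"
  show "separated 3 \<gamma> (1 / 1000) 2 x k l"
    by (rule ccontr, rule notE[OF nn], rule near_multiple_if_not_separated_crude[where a = "433 / 500" and z = "1 / 3"])
       (use \<gamma> kl sin_gap_3 z T in auto)
qed (use \<gamma> in auto)

text \<open>Cosines at three equidistant points sum to 0 and their squares to 3 / 2, whatever
  \<open>x\<close> is. As 9 / 2 exceeds 3, the three differences cannot all have size at most
  1.\<close>

lemma cos_third_roots_spread: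
  fixes x :: real
  defines "c \<equiv> \<lambda>k::nat. cos (2 * pi * (x + real k) / real 3)"
  shows "(c 0 - c 1)\<^sup>2 + (c 0 - c 2)\<^sup>2 + (c 1 - c 2)\<^sup>2 = 9 / 2"
proof -
  define a where "a = 2 * pi * x / 3"
  have e: "2 * pi * (x + real 0) / real 3 = a" "2 * pi * (x + real 1) / real 3 = a + 2 * (pi / 3)"
    "2 * pi * (x + real 2) / real 3 = a + 4 * (pi / 3)" by (simp_all add: a_def field_simps)
  have t: "cos (2 * (pi / 3)) = - (1 / 2)" "sin (2 * (pi / 3)) = sqrt 3 / 2"
    unfolding cos_double_cos sin_double by (simp_all add: cos_60 sin_60 power2_eq_square)
  have "4 * (pi / 3) = 2 * (2 * (pi / 3))" by simp
  then have t': "cos (4 * (pi / 3)) = - (1 / 2)" "sin (4 * (pi / 3)) = - (sqrt 3 / 2)"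
    by (simp_all only: cos_double_cos[of "2 * (pi / 3)"] sin_double[of "2 * (pi / 3)"] t) (simp_all add: power2_eq_square)
  have "(c 0 - c 1)\<^sup>2 + (c 0 - c 2)\<^sup>2 + (c 1 - c 2)\<^sup>2 = 9 / 2 * ((cos a)\<^sup>2 + (sin a)\<^sup>2)"
  proof -
    have "(A - (A * - (1 / 2) - B * (r / 2)))\<^sup>2 + (A - (A * - (1 / 2) - B * - (r / 2)))\<^sup>2
        + ((A * - (1 / 2) - B * (r / 2)) - (A * - (1 / 2) - B * - (r / 2)))\<^sup>2 = 9 / 2 * A\<^sup>2 + 3 / 2 * (r * r) * B\<^sup>2" for A B r :: real
      by (simp add: power2_eq_square field_simps)
    note gen = this
    have r: "sqrt 3 * sqrt 3 = (3::real)" by simp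
    show ?thesis unfolding c_def e cos_add t t' gen r by (simp only: distrib_left)
  qed
  then show ?thesis by simp
qed

lemma L2_bounded_3_large:
  assumes \<gamma>: "817 / 1000 \<le> \<gamma>" "\<gamma> < 1"
  shows "L2_bounded 3 \<gamma>"
proof -
  have "2 * \<gamma> / (3 - \<gamma>) < 1" using \<gamma> by (simp add: divide_less_eq)
  then obtain D where D: "2 * \<gamma> / (3 - \<gamma>) < D" "D < 1" using dense by blast
  have D0: "0 \<le> D" using D \<gamma> by (smt (verit) divide_nonneg_pos)
  define c where "c x k = cos (2 * pi * (x + real k) / real 3)" for x :: real and k :: nat
  define E where "E x k l \<longleftrightarrow> \<bar>c x k - c x l\<bar> \<le> D" for x k l
  have Esym: "E x k l \<longleftrightarrow> E x l k" for x k l by (auto simp: E_def abs_minus_commute)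
  have Erefl: "E x k k" for x k using D0 by (simp add: E_def)
  have incomplete: "\<not> (E x 0 1 \<and> E x 0 2 \<and> E x 1 2)" for x
  proof
    assume "E x 0 1 \<and> E x 0 2 \<and> E x 1 2"
    then have "(c x 0 - c x 1)\<^sup>2 \<le> D\<^sup>2" "(c x 0 - c x 2)\<^sup>2 \<le> D\<^sup>2" "(c x 1 - c x 2)\<^sup>2 \<le> D\<^sup>2"
      using D0 by (auto simp: E_def abs_le_square_iff[symmetric])
    moreover have "D\<^sup>2 \<le> 1" using D D0 by (simp add: power_le_one)
    ultimately show False using cos_third_roots_spread[of x] unfolding c_def by linarith
  qed
  \<comment> \<open>By \<open>incomplete\<close> the relation \<open>E\<close> on the three digits
    is at most a path; \<open>mid\<close> marks the middle vertex of a path.\<close>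
  define mid where "mid x k \<longleftrightarrow> E x k 0 \<and> E x k 1 \<and> E x k 2" for x k
  \<comment> \<open>The middle vertex pays for two edges and gets the smaller weight:
    \<open>5 / 7\<close> approximates 1 / sqrt 2, which solves 1 + 2 v = 1 + 1 / v. The costs are 17
    / 7 in the middle and 12 / 5 at the ends.\<close>
  define W where "W x k l = (if k = l then 1 else if E x k l then (if mid x k then 5 / 7 else if mid x l then 7 / 5 else 1) else 0 :: real)" for x k l
  have Em[measurable]: "Measurable.pred borel (\<lambda>x. E x k l)" for k l unfolding E_def c_def by measurable
  have mm[measurable]: "Measurable.pred borel (\<lambda>x. mid x k)" for k unfolding mid_def by measurable
  have three: "k = 0 \<or> k = 1 \<or> k = 2" if "k < 3" for k :: nat using that by linarith
  have two_mid: "\<not> (mid x k \<and> mid x l)" if "k < 3" "l < 3" "k \<noteq> l" for x k l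
    using incomplete[of x] three[OF that(1)] three[OF that(2)] that(3) Esym[of x] by (auto simp: mid_def)
  show ?thesis
  proof (rule L2_boundedI[where W = W and \<omega> = "\<lambda>_. 1" and \<Lambda> = "17 / 7" and \<Omega> = 1 and ?N0.0 = 2 and \<eta> = "(D - 2 * \<gamma> / (3 - \<gamma>)) / 2"])
    show "(\<lambda>x. W x k l) \<in> borel_measurable borel" for k l unfolding W_def by measurable
    show "0 \<le> W x k l" for x k l by (simp add: W_def)
    fix x :: real and k :: nat assume k: "k < 3"
    show "1 * (\<Sum>l<3. W x k l) \<le> 17 / 7 * 1"
      using incomplete[of x] three[OF k] Esym[of x] Erefl[of x] by (auto simp: W_def mid_def eval_nat_numeral)
  next
    fix x :: real and k l :: nat assume kl: "k < 3" "l < 3" "W x k l * W x l k < 1"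
    show "separated 3 \<gamma> ((D - 2 * \<gamma> / (3 - \<gamma>)) / 2) 2 x k l"
    proof (rule ccontr)
      assume ns: "\<not> ?thesis"
      have g: "0 < \<gamma>" using \<gamma> by simp
      define M H where "M = pi * (2 * x + real k + real l) / real 3" and "H = pi * (real k - real l) / real 3"
      have e: "2 * pi * (x + real k) / real 3 = M + H" "2 * pi * (x + real l) / real 3 = M - H"
        by (simp_all add: M_def H_def algebra_simps add_divide_distrib diff_divide_distrib)
      have "\<bar>sin M * sin H\<bar> < \<gamma> / 3 / (1 - \<gamma> / 3) + (D - 2 * \<gamma> / (3 - \<gamma>)) / 2"
        using not_separated_two_levels(2)[OF ns _ g \<gamma>(2)] by (simp add: M_def H_def)
      also have "\<gamma> / 3 / (1 - \<gamma> / 3) = \<gamma> / (3 - \<gamma>)" using \<gamma> by (simp add: field_simps)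
      finally have "2 * \<bar>sin M * sin H\<bar> < D" by (simp add: field_simps)
      then have "\<bar>c x k - c x l\<bar> \<le> D" unfolding c_def e by (simp add: cos_add cos_diff abs_mult mult.commute)
      then have "E x k l" by (simp add: E_def)
      then show False using kl two_mid[of k l x] Esym[of x k l] by (auto simp: W_def split: if_splits)
    qed
  qed (use \<gamma> D in auto)
qed

theorem L2_bounded_3:
  assumes \<gamma>: "1 < \<gamma> * 3" "\<gamma> < 1"
  shows "L2_bounded 3 \<gamma>"
proof -
  consider "\<gamma> \<le> 943 / 2000" | "943 / 2000 < \<gamma>" "\<gamma> \<le> 2697 / 5000" | "2697 / 5000 < \<gamma>" "\<gamma> \<le> 2 / 3"
    | "2 / 3 < \<gamma>" "\<gamma> < 817 / 1000" | "817 / 1000 \<le> \<gamma>" by linarith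
  then show ?thesis
  proof cases
    case 4
    show ?thesis
    proof (rule L2_bounded_count2[of _ _ 1])
      have "2 * \<gamma> / (3 - \<gamma>) < 3 / 4" using 4 by (simp add: divide_less_eq)
      then show "2 * \<gamma> / (real 3 - \<gamma>) < (sin (pi * real 1 / real 3))\<^sup>2" using sin_gap_3(1) by simp
    qed (use 4 in auto)
  qed (use L2_bounded_3_none L2_bounded_3_sqrt2 L2_bounded_3_golden L2_bounded_3_large \<gamma> in auto)
qed

section \<open>Base two\<close>

lemma abs_le_of_square: "x\<^sup>2 \<le> c\<^sup>2 \<Longrightarrow> 0 \<le> c \<Longrightarrow> \<bar>x\<bar> \<le> (c::real)"
  using abs_le_square_iff[of x c] by simp

lemma abs_ge_of_square: "c\<^sup>2 \<le> x\<^sup>2 \<Longrightarrow> 0 \<le> c \<Longrightarrow> c \<le> \<bar>x::real\<bar>"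
  using abs_le_square_iff[of c x] by simp

lemma sine_diff_commute: "sine_diff b \<gamma> N x j' j = - sine_diff b \<gamma> N x j j'"
proof -
  have "sin (pi * (real j' - real j) / c) = - sin (pi * (real j - real j') / c)" for c
    by (metis minus_diff_eq minus_divide_left mult_minus_right sin_minus)
  then show ?thesis unfolding sine_diff_def sum_negf[symmetric] by (simp add: add_ac)
qed

lemma cosine_diff_commute: "cosine_diff b \<gamma> N x j' j = - cosine_diff b \<gamma> N x j j'"
proof -
  have "sin (pi * (real j' - real j) / c) = - sin (pi * (real j - real j') / c)" for c
    by (metis minus_diff_eq minus_divide_left mult_minus_right sin_minus)
  then show ?thesis unfolding cosine_diff_def sum_negf[symmetric] by (simp add: add_ac)
qed

lemma separated_commute: "separated b \<gamma> \<eta> N0 x k l \<Longrightarrow> separated b \<gamma> \<eta> N0 x l k"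
  unfolding separated_def by (metis sine_diff_commute cosine_diff_commute abs_minus_cancel)

text \<open>For \<open>b = 2\<close> the tangential \<open>x\<close> are those near \<open>1/2\<close>.\<close>
locale binary_separation =
  fixes \<gamma> \<delta> \<eta> :: real and N0 :: nat
  assumes \<gamma>: "0 < \<gamma>" "\<gamma> < 1" and \<eta>: "0 < \<eta>" and \<delta>: "0 < \<delta>"
    and sep01: "\<And>x. \<lbrakk>0 \<le> x; x < 1; \<delta> \<le> \<bar>x - 1 / 2\<bar>\<rbrakk> \<Longrightarrow> separated 2 \<gamma> \<eta> N0 x 0 1"
begin

lemma L2_bounded_if_weights:
  fixes v :: "real \<Rightarrow> nat \<Rightarrow> real" and \<omega> :: "real \<Rightarrow> real"
  assumes \<Lambda>: "\<Lambda> < 2 * \<gamma>" and vm: "\<And>k. (\<lambda>x. v x k) \<in> borel_measurable borel" and v0: "\<And>x k. 0 \<le> v x k"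
    and \<omega>m: "\<omega> \<in> borel_measurable borel" and \<omega>: "\<And>x. 1 \<le> \<omega> x" "\<And>x. \<omega> x \<le> \<Omega>"
    and v1: "\<And>x. \<lbrakk>0 \<le> x; x < 1; \<bar>x - 1 / 2\<bar> < \<delta>\<rbrakk> \<Longrightarrow> 1 \<le> v x 0 * v x 1"
    and unmatched: "\<And>x k. \<lbrakk>0 \<le> x; x < 1; k < 2\<rbrakk> \<Longrightarrow> \<omega> x \<le> \<Lambda> * \<omega> ((x + real k) / 2)"
    and matched: "\<And>x k. \<lbrakk>0 \<le> x; x < 1; k < 2; \<bar>x - 1 / 2\<bar> < \<delta>\<rbrakk> \<Longrightarrow> \<omega> x * (1 + v x k) \<le> \<Lambda> * \<omega> ((x + real k) / 2)"
  shows "L2_bounded 2 \<gamma>"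
proof (rule L2_bounded_if_matching[where E = "\<lambda>x _ _. \<bar>x - 1 / 2\<bar> < \<delta>" and v = v and \<omega> = \<omega> and \<Lambda> = \<Lambda> and \<Omega> = \<Omega> and \<eta> = \<eta> and ?N0.0 = N0])
  have two: "k = 0 \<and> l = 1 \<or> k = 1 \<and> l = 0" if "k < 2" "l < 2" "k \<noteq> l" for k l :: nat using that by linarith
  show "separated 2 \<gamma> \<eta> N0 x k l" if "0 \<le> x" "x < 1" "k < 2" "l < 2" "k \<noteq> l" "\<not> \<bar>x - 1 / 2\<bar> < \<delta>" for x k l
    using that two[of k l] sep01[of x] separated_commute by auto
  show "1 \<le> v x k * v x l" if "0 \<le> x" "x < 1" "k < 2" "l < 2" "k \<noteq> l" "\<bar>x - 1 / 2\<bar> < \<delta>" for x k l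
    using that two[of k l] v1[of x] by (auto simp: mult.commute)
qed (use assms \<gamma> \<eta> in auto)

text \<open>The two preimages of \<open>x\<close> differ by 1 / 2, so with
  \<open>\<delta> \<le> 1 / 4\<close> at most one of them is tangential again. The weights follow
  the pattern of \<open>L2_bounded_golden\<close>.\<close>

lemma L2_bounded_binary_golden:
  assumes "\<delta> \<le> 1 / 4" and t: "(8091 / 5000) \<le> 2 * \<gamma>"
  shows "L2_bounded 2 \<gamma>"
proof -
  \<comment> \<open>A rational number slightly above the inverse golden ratio, so that
    \<open>g * (1 + g) \<ge> 1\<close>.\<close>
  define g :: real where "g = (12361 / 20000)"
  have g: "0 < g" "1 \<le> g * (1 + g)" by (simp_all add: g_def)
  define K where "K x \<longleftrightarrow> \<bar>x - 1 / 2\<bar> < \<delta>" for x :: real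
  have [measurable]: "Measurable.pred borel K" unfolding K_def by measurable
  show ?thesis
  proof (rule L2_bounded_if_weights[where \<Lambda> = "1 + g" and \<Omega> = "1 + g" and v = "\<lambda>x k. if K ((x + real k) / 2) then g else 1 + g" and \<omega> = "\<lambda>x. if K x then 1 else 1 + g"])
    fix x :: real assume x: "0 \<le> x" "x < 1" "\<bar>x - 1 / 2\<bar> < \<delta>"
    have "\<not> (K (x / 2) \<and> K ((x + 1) / 2))"
    proof
      assume "K (x / 2) \<and> K ((x + 1) / 2)"
      then have "1 / 4 < x / 2" "(x + 1) / 2 < 3 / 4" using assms(1) unfolding K_def by linarith+
      then show False by simp
    qed
    moreover have "1 \<le> (1 + g) * (1 + g)" using g by (simp add: algebra_simps add_nonneg_nonneg)
    ultimately show "1 \<le> (if K ((x + real 0) / 2) then g else 1 + g) * (if K ((x + real 1) / 2) then g else 1 + g)"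
      using g by (auto simp: mult.commute)
  qed (use g t in \<open>auto simp: K_def[symmetric] g_def\<close>)
qed

text \<open>If \<open>x\<close> is within \<open>1/8\<close> of \<open>1/2\<close>, then its preimages lie near \<open>1/4\<close> and \<open>3/4\<close>, and the one nearer to
  \<open>1/2\<close> needs three steps to return, the other one two. Hence the threshold is the root of
  \<open>(c\<^sup>2 - 1) (c\<^sup>3 - 1) = 1\<close>, the plastic number.\<close>
lemma L2_bounded_binary_plastic:
  assumes \<delta>8: "\<delta> \<le> 1 / 8" and t: "(53 / 40) < 2 * \<gamma>"
  shows "L2_bounded 2 \<gamma>"
proof -
  define c :: real where "c = (53 / 40)"
  have c: "1 < c" "1 \<le> (c\<^sup>2 - 1) * (c ^ 3 - 1)" "1 \<le> c\<^sup>2" "c \<le> c\<^sup>2" "1 \<le> c ^ 3" by (simp_all add: c_def power2_eq_square power3_eq_cube)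
  define K where "K x \<longleftrightarrow> \<bar>x - 1 / 2\<bar> < \<delta>" for x :: real
  define L where "L x \<longleftrightarrow> \<bar>x - 1 / 2\<bar> > 1 / 4" for x :: real
  \<comment> \<open>The exponent of \<open>c\<close> is the least number of backward steps after
    which tangency is possible: a point of \<open>L\<close> may have a tangential preimage, a point
    outside \<open>K\<close> and \<open>L\<close> has none.\<close>
  define \<omega> where "\<omega> x = (if K x then 1 else if L x then c else c\<^sup>2)" for x
  \<comment> \<open>The condition on \<open>k\<close> selects the preimage farther from 1 / 2, which
    can return sooner and therefore gets the smaller weight.\<close>
  define v where "v x k = (if (x < 1 / 2) = (k = 0) then c\<^sup>2 - 1 else c ^ 3 - 1)" for x :: real and k :: nat
  have [measurable]: "Measurable.pred borel K" "Measurable.pred borel L" unfolding K_def L_def by measurable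
  have \<omega>c: "c \<le> \<omega> x" if "\<not> K x" for x using that c by (simp add: \<omega>_def)
  show ?thesis
  proof (rule L2_bounded_if_weights[where \<Lambda> = c and \<Omega> = "c\<^sup>2" and v = v and \<omega> = \<omega>])
    show "(\<lambda>x. v x k) \<in> borel_measurable borel" for k unfolding v_def by measurable
    show "\<omega> \<in> borel_measurable borel" unfolding \<omega>_def by measurable
    fix x :: real and k :: nat assume x: "0 \<le> x" "x < 1" "k < 2"
    have k: "k = 0 \<or> k = 1" using x by linarith
    let ?y = "(x + real k) / 2"
    have "\<omega> x * 1 \<le> c * \<omega> ?y \<and> (K x \<longrightarrow> \<omega> x * (1 + v x k) \<le> c * \<omega> ?y)"
    proof (cases "K x")
      case True
      have nK: "\<not> K ?y" using k True \<delta>8 unfolding K_def by (auto simp: abs_if add_divide_distrib split: if_splits)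
      show ?thesis
      proof (cases "(x < 1 / 2) = (k = 0)")
        case t: True
        have "c * c \<le> c * \<omega> ?y" using \<omega>c[OF nK] c by (intro mult_left_mono) auto
        then have "c\<^sup>2 \<le> c * \<omega> ?y" "1 \<le> c * \<omega> ?y" using c(3) unfolding power2_eq_square by linarith+
        moreover have "\<omega> x = 1" "v x k = c\<^sup>2 - 1" using True t by (simp_all add: \<omega>_def v_def)
        ultimately show ?thesis by simp
      next
        case f: False
        then have "\<not> L ?y" using k x unfolding L_def by (auto simp: abs_if add_divide_distrib split: if_splits)
        then have "\<omega> ?y = c\<^sup>2" using nK by (simp add: \<omega>_def)
        moreover have "\<omega> x = 1" "v x k = c ^ 3 - 1" using True f by (auto simp: \<omega>_def v_def)
        ultimately show ?thesis using c by (simp add: power2_eq_square power3_eq_cube)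
      qed
    next
      case nK: False
      show ?thesis
      proof (cases "L x")
        case True
        have "1 \<le> \<omega> ?y" using c by (simp add: \<omega>_def)
        then have "c * 1 \<le> c * \<omega> ?y" using c by (intro mult_left_mono) auto
        then show ?thesis using nK True by (simp add: \<omega>_def)
      next
        case False
        have "\<not> K ?y" using k False \<delta>8 unfolding K_def L_def by (auto simp: abs_if add_divide_distrib split: if_splits)
        then have "c * c \<le> c * \<omega> ?y" using \<omega>c c by (intro mult_left_mono) auto
        then show ?thesis using nK False by (simp add: \<omega>_def power2_eq_square)
      qed
    qed
    then show "\<omega> x \<le> c * \<omega> ?y" and "\<bar>x - 1 / 2\<bar> < \<delta> \<Longrightarrow> \<omega> x * (1 + v x k) \<le> c * \<omega> ?y"
      by (simp_all add: K_def)
  qed (use c t in \<open>auto simp: \<omega>_def v_def c_def mult.commute\<close>)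
qed

text \<open>A backward orbit returns to the \<open>\<delta>\<close>-neighbourhood of \<open>1/2\<close> only after \<open>n\<close> steps, and at \<open>x\<close> at least
  \<open>1 + m x\<close> steps have passed since the last visit.\<close>
lemma L2_bounded_binary_sparse:
  assumes n: "2 \<le> n" and \<delta>n: "\<delta> * (2 ^ n + 2) \<le> 1" and c: "1 \<le> c" "2 \<le> c ^ n" "c ^ (n - 1) \<le> 2" and t: "c < 2 * \<gamma>"
  shows "L2_bounded 2 \<gamma>"
proof -
  define K where "K x \<longleftrightarrow> \<bar>x - 1 / 2\<bar> < \<delta>" for x :: real
  \<comment> \<open>On the unit interval this is the distance to the nearest integer; a backward
    step turns d into d / 2 or (1 - d) / 2.\<close>
  define d where "d x = min x (1 - x)" for x :: real
  \<comment> \<open>A preimage of a point of \<open>K\<close> has d above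
    \<open>1 / 4 - \<delta> / 2\<close>, and each backward step reduces d at most by half, so
    \<open>m\<close> grows by at most 1 per step. A return to \<open>K\<close> needs d below
    \<open>2 * \<delta>\<close>, where all \<open>n - 2\<close> summands are 1; this is what
    \<open>\<delta>n\<close> ensures.\<close>
  define m where "m x = (\<Sum>i<n - 2. of_bool (d x * 2 ^ i \<le> 1 / 4 - \<delta> / 2) :: nat)" for x
  \<comment> \<open>The cost 2 of a tangency is paid off by a factor \<open>c\<close> per step:
    \<open>2 \<le> c ^ n\<close> means that it is settled on return,
    \<open>c ^ (n - 1) \<le> 2\<close> keeps \<omega> at least 1.\<close>
  define \<omega> where "\<omega> x = (if K x then 1 else 2 / c ^ (1 + m x))" for x
  have c0: "0 < c" using c by simp
  have \<delta>6: "\<delta> \<le> 1 / 6"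
  proof -
    have "(2::real) ^ 2 \<le> 2 ^ n" using n by (intro power_increasing) auto
    then have "\<delta> * 6 \<le> \<delta> * (2 ^ n + 2)" using \<delta> by (intro mult_left_mono) auto
    then show ?thesis using \<delta>n by simp
  qed
  have m_le: "m x \<le> n - 2" for x
  proof -
    have "m x \<le> (\<Sum>i<n - 2. 1)" unfolding m_def by (intro sum_mono) auto
    then show ?thesis by simp
  qed
  have \<omega>1: "1 \<le> \<omega> x" for x
  proof (cases "K x")
    case False
    have "c ^ (1 + m x) \<le> c ^ (n - 1)" using m_le[of x] n c by (intro power_increasing) auto
    then have "c ^ (1 + m x) \<le> 2" using c by linarith
    then show ?thesis using False c0 by (simp add: \<omega>_def)
  qed (simp add: \<omega>_def)
  have \<omega>2: "\<omega> x \<le> 2" for x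
    using one_le_power[OF c(1), of "1 + m x"] by (auto simp: \<omega>_def divide_le_eq)
  have [measurable]: "Measurable.pred borel K" "m \<in> borel \<rightarrow>\<^sub>M count_space UNIV"
    unfolding K_def m_def d_def by measurable
  have \<omega>m: "\<omega> \<in> borel_measurable borel" unfolding \<omega>_def by measurable
  have dy: "d ((x + real k) / 2) = d x / 2 \<or> d ((x + real k) / 2) = (1 - d x) / 2" if "0 \<le> x" "x < 1" "k < 2" for x k
  proof -
    have "k = 0 \<or> k = 1" using that by linarith
    then show ?thesis using that by (auto simp: d_def min_def field_simps)
  qed
  have d_half: "d x \<le> 1 / 2" for x by (auto simp: d_def min_def)
  have Kd: "K x \<longleftrightarrow> 1 / 2 - \<delta> < d x" for x by (auto simp: K_def d_def min_def abs_if)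
  have step: "\<omega> x * (if K x then 2 else 1) \<le> c * \<omega> y" if x: "0 \<le> x" "x < 1" "k < 2" and y: "y = (x + real k) / 2" for x k y
  proof (cases "K x")
    case True
    have "\<not> K y" "1 / 4 - \<delta> / 2 < d y" using dy[OF x] True d_half[of x] \<delta>6 \<delta> unfolding Kd y by auto
    moreover have "m y = 0"
    proof -
      have "1 / 4 - \<delta> / 2 < d y * 2 ^ i" for i
      proof -
        have "d y * 1 \<le> d y * 2 ^ i" using calculation(2) \<delta>6 by (intro mult_left_mono) auto
        then show ?thesis using calculation(2) by simp
      qed
      then show ?thesis unfolding m_def by (intro sum.neutral) (simp add: not_le)
    qed
    ultimately show ?thesis using True c0 by (simp add: \<omega>_def)
  next
    case False
    show ?thesis
    proof (cases "K y")
      case True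
      have d2: "d x < 2 * \<delta>" using dy[OF x] True d_half[of x] \<delta>6 \<delta> unfolding Kd y by auto
      have "m x = n - 2"
      proof -
        have "d x * 2 ^ i \<le> 1 / 4 - \<delta> / 2" if i: "i < n - 2" for i
        proof -
          have "d x * 2 ^ i \<le> 2 * \<delta> * 2 ^ (n - 3)"
            using d2 \<delta> i n by (intro mult_mono power_increasing) auto
          also have "\<dots> = \<delta> * 2 ^ n / 4"
          proof -
            obtain p where "n = p + 3" using i that[of "n - 3"] by linarith
            then show ?thesis by (simp add: power_add)
          qed
          also have "\<dots> \<le> 1 / 4 - \<delta> / 2" using \<delta>n by (simp add: field_simps)
          finally show ?thesis .
        qed
        then show ?thesis by (simp add: m_def)
      qed
      then have "\<omega> x = 2 / c ^ (n - 1)" using False n by (simp add: \<omega>_def Suc_diff_le[symmetric] numeral_2_eq_2)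
      also have "\<dots> \<le> c"
      proof -
        have "c ^ n = c * c ^ (n - 1)" using n by (cases n) auto
        then show ?thesis using c c0 by (simp add: divide_le_eq)
      qed
      finally show ?thesis using True False by (simp add: \<omega>_def)
    next
      case nKy: False
      have "d x / 2 \<le> d y" using dy[OF x] d_half[of x] unfolding y by auto
      have "m y \<le> m x + 1"
      proof (cases "n - 2")
        case (Suc p)
        have "m y = of_bool (d y * 2 ^ 0 \<le> 1 / 4 - \<delta> / 2) + (\<Sum>i<p. of_bool (d y * 2 ^ Suc i \<le> 1 / 4 - \<delta> / 2))"
          unfolding m_def Suc by (subst sum.lessThan_Suc_shift) simp
        also have "\<dots> \<le> 1 + (\<Sum>i<p. of_bool (d x * 2 ^ i \<le> 1 / 4 - \<delta> / 2))"
        proof (intro add_mono sum_mono)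
          fix i
          have "d x / 2 * 2 ^ Suc i \<le> d y * 2 ^ Suc i" using \<open>d x / 2 \<le> d y\<close> by (intro mult_right_mono) auto
          then have "d x * 2 ^ i \<le> d y * 2 ^ Suc i" by simp
          then show "of_bool (d y * 2 ^ Suc i \<le> 1 / 4 - \<delta> / 2) \<le> (of_bool (d x * 2 ^ i \<le> 1 / 4 - \<delta> / 2) :: nat)" 
            unfolding of_bool_less_eq_iff by linarith
        qed auto
        also have "\<dots> \<le> 1 + m x" unfolding m_def Suc by simp
        finally show ?thesis by simp
      qed (simp add: m_def)
      then have "c ^ (1 + m y) \<le> c ^ (1 + (m x + 1))" using c by (intro power_increasing) auto
      then have "c ^ (1 + m y) \<le> c * c ^ (1 + m x)" by simp
      then have "2 / c ^ (1 + m x) \<le> c * (2 / c ^ (1 + m y))" using c0 by (simp add: field_simps)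
      then show ?thesis using False nKy by (simp add: \<omega>_def)
    qed
  qed
  show ?thesis
  proof (rule L2_bounded_if_weights[where \<Lambda> = c and \<Omega> = 2 and v = "\<lambda>_ _. 1" and \<omega> = \<omega>, OF t _ _ \<omega>m \<omega>1 \<omega>2])
    fix x :: real and k :: nat assume x: "0 \<le> x" "x < 1" "k < 2"
    have "\<omega> x * 1 \<le> \<omega> x * (if K x then 2 else 1)" using \<omega>1[of x] by (intro mult_left_mono) auto
    then show "\<omega> x \<le> c * \<omega> ((x + real k) / 2)" using step[OF x refl] by linarith
    assume "\<bar>x - 1 / 2\<bar> < \<delta>"
    then have "K x" by (simp add: K_def)
    then show "\<omega> x * (1 + 1) \<le> c * \<omega> ((x + real k) / 2)" using step[OF x refl] by simp
  qed auto
qed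

end

section \<open>Base two: numerical consequences of tangency for doubled angles\<close>

lemma abs_le_if_square_eq: "x\<^sup>2 = s \<Longrightarrow> s \<le> c\<^sup>2 \<Longrightarrow> 0 \<le> c \<Longrightarrow> \<bar>x\<bar> \<le> (c::real)"
  using abs_le_square_iff[of x c] by simp

lemma abs_ge_if_square_eq: "x\<^sup>2 = s \<Longrightarrow> c\<^sup>2 \<le> s \<Longrightarrow> 0 \<le> c \<Longrightarrow> c \<le> \<bar>x::real\<bar>"
  using abs_le_square_iff[of c x] by simp

lemma abs_mult_le: "0 \<le> a \<Longrightarrow> a \<le> A \<Longrightarrow> \<bar>x\<bar> \<le> B \<Longrightarrow> \<bar>a * x\<bar> \<le> A * (B::real)"
  by (simp add: abs_mult mult_mono)

lemma abs_mult_ge: "0 \<le> a \<Longrightarrow> a \<le> A \<Longrightarrow> \<bar>x\<bar> \<le> B \<Longrightarrow> - (A * B) \<le> a * (x::real)"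
  using abs_mult_le[of a A x B] by linarith

lemma power_tail_mono:
  fixes q p :: real
  assumes "0 \<le> q" "q \<le> p" "p < 1" "p ^ m / (1 - p) \<le> t"
  shows "q ^ m / (1 - q) \<le> t"
proof -
  have "q ^ m / (1 - q) \<le> p ^ m / (1 - p)" using assms by (intro frac_le power_mono) auto
  then show ?thesis using assms by simp
qed

text \<open>\<open>C n, Z n\<close> and \<open>X n, Y n\<close> are the cosines and sines of the angles \<open>\<pi> (2 x + j + j') / 2\<^sup>n\<^sup>+\<^sup>1\<close> and
  \<open>\<pi> (j - j') / 2\<^sup>n\<^sup>+\<^sup>1\<close>, up to signs chosen such that \<open>Y 0 = 1\<close> and \<open>Z 0 \<ge> 0\<close>. Then \<open>Z 0\<close> is the sine of
  \<open>\<pi> \<bar>x - 1/2\<bar>\<close>, and an upper bound on it localises the tangential \<open>x\<close>.\<close>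
locale doubling =
  fixes C Z X Y :: "nat \<Rightarrow> real" and \<gamma> :: real
  assumes \<gamma>: "1 / 2 < \<gamma>" "\<gamma> < 1"
    and C_double: "\<And>n. C n = 2 * (C (Suc n))\<^sup>2 - 1" and Z_double: "\<And>n. Z n = 2 * Z (Suc n) * C (Suc n)"
    and CZ: "\<And>n. (C n)\<^sup>2 + (Z n)\<^sup>2 = 1"
    and X_double: "\<And>n. X n = 2 * (X (Suc n))\<^sup>2 - 1" and Y_double: "\<And>n. Y n = 2 * Y (Suc n) * X (Suc n)"
    and XY: "\<And>n. (X n)\<^sup>2 + (Y n)\<^sup>2 = 1"
    and X0: "X 0 = 0" and Y0: "Y 0 = 1" and Z0: "0 \<le> Z 0"
    and F: "\<And>m. m \<le> 5 \<Longrightarrow> \<bar>\<Sum>n<m. \<gamma> ^ n * (C n * Y n)\<bar> < \<gamma> ^ m / (1 - \<gamma>) + 1 / 10000"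
    and G: "\<And>m. m \<le> 5 \<Longrightarrow> \<bar>\<Sum>n<m. (\<gamma> / 2) ^ n * (Z n * Y n)\<bar> < (\<gamma> / 2) ^ m / (1 - \<gamma> / 2) + 1 / 10000"
begin

abbreviation "\<rho> \<equiv> \<gamma> / 2"
abbreviation "r \<equiv> sqrt (1 / 2)"
abbreviation "C1 \<equiv> C (Suc 0)"
abbreviation "C2 \<equiv> C (Suc (Suc 0))"
abbreviation "C3 \<equiv> C (Suc (Suc (Suc 0)))"
abbreviation "C4 \<equiv> C (Suc (Suc (Suc (Suc 0))))"
abbreviation "Z1 \<equiv> Z (Suc 0)"
abbreviation "Z2 \<equiv> Z (Suc (Suc 0))"
abbreviation "X1 \<equiv> X (Suc 0)"
abbreviation "X2 \<equiv> X (Suc (Suc 0))"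
abbreviation "X3 \<equiv> X (Suc (Suc (Suc 0)))"
abbreviation "Y1 \<equiv> Y (Suc 0)"
abbreviation "Y2 \<equiv> Y (Suc (Suc 0))"
abbreviation "Y3 \<equiv> Y (Suc (Suc (Suc 0)))"
abbreviation "Y4 \<equiv> Y (Suc (Suc (Suc (Suc 0))))"

lemma half_angle:
  "(C (Suc n))\<^sup>2 = (1 + C n) / 2" "(Z (Suc n))\<^sup>2 = (1 - C n) / 2" "Z (Suc n) * C (Suc n) = Z n / 2"
  "(X (Suc n))\<^sup>2 = (1 + X n) / 2" "(Y (Suc n))\<^sup>2 = (1 - X n) / 2" "Y (Suc n) * X (Suc n) = Y n / 2"
proof -
  show "(C (Suc n))\<^sup>2 = (1 + C n) / 2" "(X (Suc n))\<^sup>2 = (1 + X n) / 2" using C_double[of n] X_double[of n] by simp_all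
  then show "(Z (Suc n))\<^sup>2 = (1 - C n) / 2" "(Y (Suc n))\<^sup>2 = (1 - X n) / 2"
    using CZ[of "Suc n"] XY[of "Suc n"] by (simp_all add: field_simps)
  show "Z (Suc n) * C (Suc n) = Z n / 2" "Y (Suc n) * X (Suc n) = Y n / 2" using Z_double[of n] Y_double[of n] by simp_all
qed

lemma abs_le_1: "\<bar>C n\<bar> \<le> 1" "\<bar>Z n\<bar> \<le> 1" "\<bar>X n\<bar> \<le> 1" "\<bar>Y n\<bar> \<le> 1"
  using CZ[of n] XY[of n] zero_le_power2[of "C n"] zero_le_power2[of "Z n"] zero_le_power2[of "X n"] zero_le_power2[of "Y n"]
  unfolding abs_square_le_1[symmetric] by linarith+

lemma r: "r * r = 1 / 2" "7071 / 10000 < r" "r < 70711 / 100000" "r\<^sup>2 = 1 / 2"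
proof -
  show "7071 / 10000 < r" by (rule real_less_rsqrt) (simp add: power2_eq_square)
  show "r < 70711 / 100000" by (rule real_less_lsqrt) (simp_all add: power2_eq_square)
qed simp_all

text \<open>Up to sign normalisation the angle at level 0 is pi / 2 modulo 2 pi, so its half is pi /
  4 or 5 pi / 4.\<close>

lemma X1Y1: "X1 = r \<and> Y1 = r \<or> X1 = - r \<and> Y1 = - r"
proof -
  have "X1\<^sup>2 = r\<^sup>2" using half_angle(4)[of 0] X0 by simp
  then have "X1 = r \<or> X1 = - r" by (simp only: power2_eq_iff)
  moreover have YX: "Y1 * X1 = r * r" using half_angle(6)[of 0] Y0 r(1) by simp
  have "Y1 = r" if "X1 = r" using YX unfolding that by (subst (asm) mult_right_cancel) auto
  moreover have "- Y1 = r" if "X1 = - r" using YX unfolding that minus_mult_commute[symmetric] by (subst (asm) mult_right_cancel) auto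
  ultimately show ?thesis by auto
qed

lemma C_series:
  "\<bar>C 0 + \<gamma> * (C1 * Y1)\<bar> < \<gamma> ^ 2 / (1 - \<gamma>) + 1 / 10000"
  "\<bar>C 0 + \<gamma> * (C1 * Y1) + \<gamma> ^ 2 * (C2 * Y2)\<bar> < \<gamma> ^ 3 / (1 - \<gamma>) + 1 / 10000"
  "\<bar>C 0 + \<gamma> * (C1 * Y1) + \<gamma> ^ 2 * (C2 * Y2) + \<gamma> ^ 3 * (C3 * Y3)\<bar> < \<gamma> ^ 4 / (1 - \<gamma>) + 1 / 10000"
  "\<bar>C 0 + \<gamma> * (C1 * Y1) + \<gamma> ^ 2 * (C2 * Y2) + \<gamma> ^ 3 * (C3 * Y3) + \<gamma> ^ 4 * (C4 * Y4)\<bar> < \<gamma> ^ 5 / (1 - \<gamma>) + 1 / 10000"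
  using F[of 2] F[of 3] F[of 4] F[of 5] Y0 by (simp_all add: eval_nat_numeral)

lemma Z_series:
  "\<bar>Z 0 + \<rho> * (Z1 * Y1)\<bar> < \<rho> ^ 2 / (1 - \<rho>) + 1 / 10000"
  "\<bar>Z 0 + \<rho> * (Z1 * Y1) + \<rho> ^ 2 * (Z2 * Y2)\<bar> < \<rho> ^ 3 / (1 - \<rho>) + 1 / 10000"
  using G[of 2] G[of 3] Y0 by (simp_all add: eval_nat_numeral)

text \<open>Two terms of the \<open>Z\<close> series bound \<open>Z 0\<close> unless the second is
  negative, and when \<open>0 \<le> C 0\<close> that term is at most half of
  \<open>\<rho> * Z 0\<close> in size. The third alternative, an obtuse angle with a compensating
  second term, is the one that needs more levels.\<close>

lemma Z0_cases:
  assumes p: "\<rho> \<le> p" "p < 1" and t: "p ^ 2 / (1 - p) + 1 / 10000 \<le> t"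
  shows "Z 0 < t \<or> 0 \<le> C 0 \<and> Z 0 * (1 - \<rho> / 2) < t \<or> C 0 < 0 \<and> Z1 * Y1 < 0"
proof -
  have \<rho>: "0 < \<rho>" using \<gamma> by simp
  have "\<rho> ^ 2 / (1 - \<rho>) \<le> t - 1 / 10000" by (rule power_tail_mono[of _ p]) (use \<rho> p t in auto)
  then have G2: "\<bar>Z 0 + \<rho> * (Z1 * Y1)\<bar> < t" using Z_series(1) by linarith
  consider "0 \<le> Z1 * Y1" | "0 \<le> C 0" | "C 0 < 0" "Z1 * Y1 < 0" by linarith
  then show ?thesis
  proof cases
    case 1
    then have "0 \<le> \<rho> * (Z1 * Y1)" using \<rho> by simp
    then show ?thesis using G2 by linarith
  next
    case 2
    have "C 0 * C 0 \<le> C 0 * 1" using 2 abs_le_1(1)[of 0] by (intro mult_left_mono) auto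
    then have le: "1 - C 0 \<le> (Z 0)\<^sup>2" using CZ[of 0] by (simp add: power2_eq_square)
    have "(Z1 * Y1)\<^sup>2 = (1 - C 0) / 4" unfolding power_mult_distrib half_angle X0 by simp
    then have "\<bar>Z1 * Y1\<bar> \<le> Z 0 / 2" using le Z0 by (intro abs_le_if_square_eq) (auto simp: power_divide)
    then have "\<bar>\<rho> * (Z1 * Y1)\<bar> \<le> \<rho> * (Z 0 / 2)" using \<rho> by (intro abs_mult_le) auto
    then have "Z 0 - \<rho> * (Z 0 / 2) < t" using G2 by linarith
    then show ?thesis using 2 by (simp add: algebra_simps)
  qed simp
qed

text \<open>\<open>Z 0 \<ge> 0\<close> gives \<open>C1\<close> and \<open>Z1\<close> a common sign,
  and \<open>Y1\<close> (equal to \<open>X1\<close>) the opposite one. Only a global sign remains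
  free; it decides between the two alternatives at level 2.\<close>

lemma obtuse:
  assumes "C 0 < 0" "Z1 * Y1 < 0"
  obtains u w where "0 \<le> u" "0 < w" "w \<le> 1" "u\<^sup>2 + w\<^sup>2 = 1" "C 0 = u\<^sup>2 - w\<^sup>2" "Z 0 = 2 * u * w"
    "Z1 * Y1 = - (r * w)" "C1 * Y1 = - (r * u)"
    "(C2 * Y2)\<^sup>2 = (1 + u) * (1 + r) / 4 \<and> (Z2 * Y2)\<^sup>2 = (1 - u) * (1 + r) / 4 \<and> 0 \<le> (C2 * Y2) * (Z2 * Y2)
     \<or> (C2 * Y2)\<^sup>2 = (1 - u) * (1 - r) / 4 \<and> (Z2 * Y2)\<^sup>2 = (1 + u) * (1 - r) / 4" "u \<le> 1"
proof -
  define u w where "u = \<bar>C1\<bar>" and "w = \<bar>Z1\<bar>"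
  have Z1: "Z1 \<noteq> 0" using assms by auto
  have ZC: "Z1 * C1 = Z 0 / 2" by (rule half_angle)
  have sign: "X1 = - r \<and> Y1 = - r \<and> C1 = u \<and> Z1 = w \<or> X1 = r \<and> Y1 = r \<and> C1 = - u \<and> Z1 = - w"
    using X1Y1
  proof
    assume a: "X1 = r \<and> Y1 = r"
    then have "Z1 < 0" using assms(2) by (auto simp: mult_less_0_iff)
    moreover then have "C1 \<le> 0" using ZC Z0 by (smt (verit) mult_neg_pos divide_nonneg_pos)
    ultimately show ?thesis using a by (simp add: u_def w_def)
  next
    assume a: "X1 = - r \<and> Y1 = - r"
    then have "Z1 > 0" using assms(2) by (auto simp: zero_less_mult_iff)
    moreover then have "0 \<le> C1" using ZC Z0 by (smt (verit) mult_pos_neg divide_nonneg_pos)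
    ultimately show ?thesis using a by (simp add: u_def w_def)
  qed
  have sq: "u\<^sup>2 = (1 + C 0) / 2" "w\<^sup>2 = (1 - C 0) / 2" unfolding u_def w_def by (simp_all add: half_angle)
  have w_nonneg: "0 \<le> w * (1 + r)" by (simp add: w_def)
  show thesis
  proof (rule that[of u w])
    show "0 \<le> u" "0 < w" "w \<le> 1" "u \<le> 1" using Z1 abs_le_1(1,2)[of "Suc 0"] by (simp_all add: u_def w_def)
    show "u\<^sup>2 + w\<^sup>2 = 1" "C 0 = u\<^sup>2 - w\<^sup>2" using sq by simp_all
    show "Z 0 = 2 * u * w" "Z1 * Y1 = - (r * w)" "C1 * Y1 = - (r * u)" using sign ZC by (auto simp: mult_ac)
    have "(C2 * Y2) * (Z2 * Y2) = (Z2 * C2) * Y2\<^sup>2" by (simp add: power2_eq_square)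
    also have "\<dots> = Z1 / 2 * Y2\<^sup>2" unfolding half_angle ..
    finally show "(C2 * Y2)\<^sup>2 = (1 + u) * (1 + r) / 4 \<and> (Z2 * Y2)\<^sup>2 = (1 - u) * (1 + r) / 4 \<and> 0 \<le> (C2 * Y2) * (Z2 * Y2)
     \<or> (C2 * Y2)\<^sup>2 = (1 - u) * (1 - r) / 4 \<and> (Z2 * Y2)\<^sup>2 = (1 + u) * (1 - r) / 4"
      unfolding power_mult_distrib half_angle using sign w_nonneg by auto
  qed
qed

lemma obtuse_series:
  assumes "C1 * Y1 = - (r * u)" "Z1 * Y1 = - (r * w)"
  shows "\<bar>C 0 - \<gamma> * (r * u) + \<gamma> ^ 2 * (C2 * Y2)\<bar> < \<gamma> ^ 3 / (1 - \<gamma>) + 1 / 10000"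
    "\<bar>Z 0 - \<rho> * (r * w)\<bar> < \<rho> ^ 2 / (1 - \<rho>) + 1 / 10000"
    "\<bar>Z 0 - \<rho> * (r * w) + \<rho> ^ 2 * (Z2 * Y2)\<bar> < \<rho> ^ 3 / (1 - \<rho>) + 1 / 10000"
  using C_series(2) Z_series unfolding assms by simp_all

text \<open>A bootstrap: \<open>z \<le> Z 0\<close> bounds \<open>C 0\<close>, hence w from above
  and u from below, and these bound the \<open>Z\<close> series at levels 1 and 2. \<open>B\<close>
  must cover both alternatives of \<open>obtuse\<close>; 19136 / 50000 lies just above sin (pi / 8),
  the extreme value in the second.\<close>

lemma obtuse_Z0_less:
  assumes "C 0 < 0" "Z1 * Y1 < 0" and z: "0 < z" "z \<le> Z 0" and p: "\<rho> \<le> p" "p < 1"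
    and c0: "0 \<le> c0" "1 - z\<^sup>2 \<le> c0\<^sup>2" and w0: "0 \<le> w0" "(1 + c0) / 2 \<le> w0\<^sup>2" and u0: "0 \<le> u0" "u0\<^sup>2 \<le> (1 - c0) / 2"
    and B: "19136 / 50000 \<le> B" "(1 - u0) * (170711 / 100000) / 4 \<le> B\<^sup>2"
  shows "Z 0 < p * (70711 / 100000 * w0) + p ^ 2 * B + (p ^ 3 / (1 - p) + 1 / 10000)"
proof -
  obtain u w where u: "0 \<le> u" "0 < w" "w \<le> 1" "u\<^sup>2 + w\<^sup>2 = 1" "C 0 = u\<^sup>2 - w\<^sup>2" "Z 0 = 2 * u * w"
    and f1: "Z1 * Y1 = - (r * w)" "C1 * Y1 = - (r * u)"
    and f2: "(C2 * Y2)\<^sup>2 = (1 + u) * (1 + r) / 4 \<and> (Z2 * Y2)\<^sup>2 = (1 - u) * (1 + r) / 4 \<and> 0 \<le> (C2 * Y2) * (Z2 * Y2)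
     \<or> (C2 * Y2)\<^sup>2 = (1 - u) * (1 - r) / 4 \<and> (Z2 * Y2)\<^sup>2 = (1 + u) * (1 - r) / 4" and u1: "u \<le> 1"
    using obtuse[OF assms(1,2)] by blast
  have \<rho>: "0 < \<rho>" using \<gamma> by simp
  have "z\<^sup>2 \<le> (Z 0)\<^sup>2" using z by (intro power_mono) auto
  then have "\<bar>C 0\<bar> \<le> c0" using CZ[of 0] c0 by (intro abs_le_of_square) linarith+
  then have "w\<^sup>2 \<le> w0\<^sup>2" "u0\<^sup>2 \<le> u\<^sup>2" using u(4,5) w0(2) u0(2) by (simp_all add: abs_le_iff)
  then have w: "w \<le> w0" and u0u: "u0 \<le> u" using w0(1) u(1) power2_le_imp_le by blast+
  have "(Z2 * Y2)\<^sup>2 \<le> B\<^sup>2"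
    using f2
  proof
    assume "(C2 * Y2)\<^sup>2 = (1 + u) * (1 + r) / 4 \<and> (Z2 * Y2)\<^sup>2 = (1 - u) * (1 + r) / 4 \<and> 0 \<le> (C2 * Y2) * (Z2 * Y2)"
    moreover have "(1 - u) * (1 + r) \<le> (1 - u0) * (170711 / 100000)" using u0u u1 r by (intro mult_mono) auto
    ultimately show ?thesis using B(2) by linarith
  next
    assume "(C2 * Y2)\<^sup>2 = (1 - u) * (1 - r) / 4 \<and> (Z2 * Y2)\<^sup>2 = (1 + u) * (1 - r) / 4"
    moreover have "(1 + u) * (1 - r) \<le> 2 * (29290 / 100000)" using u(1) u1 r by (intro mult_mono) auto
    moreover have "(19136 / 50000)\<^sup>2 \<le> B\<^sup>2" using B(1) by (intro power_mono) auto
    ultimately show ?thesis by (simp add: power2_eq_square)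
  qed
  then have "\<bar>Z2 * Y2\<bar> \<le> B" using B(1) by (intro abs_le_of_square) auto
  then have "\<bar>\<rho> ^ 2 * (Z2 * Y2)\<bar> \<le> p ^ 2 * B" using \<rho> p by (intro abs_mult_le power_mono) auto
  moreover have "\<rho> * (r * w) \<le> p * (70711 / 100000 * w0)" using \<rho> p r w u by (intro mult_mono) auto
  moreover have "\<rho> ^ 3 / (1 - \<rho>) \<le> p ^ 3 / (1 - p)" by (rule power_tail_mono[OF _ p]) (use \<rho> p in auto)
  ultimately show ?thesis using obtuse_series(3)[OF f1(2,1)] by linarith
qed

lemma Z0_less_golden: "Z 0 < 7071 / 10000"
proof (rule ccontr)
  assume n: "\<not> ?thesis"
  have "Z 0 < 5001 / 10000 \<or> 0 \<le> C 0 \<and> Z 0 * (1 - \<rho> / 2) < 5001 / 10000 \<or> C 0 < 0 \<and> Z1 * Y1 < 0"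
    using \<gamma> by (intro Z0_cases[of "1 / 2"]) (auto simp: power2_eq_square)
  moreover have "Z 0 * (3 / 4) \<le> Z 0 * (1 - \<rho> / 2)" using Z0 \<gamma> by (intro mult_left_mono) auto
  ultimately have s: "C 0 < 0" "Z1 * Y1 < 0" using n by linarith+
  \<comment> \<open>\<open>c0\<close>, \<open>w0\<close> and \<open>u0\<close> round the values at
    \<open>Z 0 = sin (pi / 4)\<close>: the cosines of pi / 4 and pi / 8 and the sine of pi /
    8.\<close>
  have "Z 0 < 1 / 2 * (70711 / 100000 * (9239 / 10000)) + (1 / 2) ^ 2 * (5134 / 10000) + ((1 / 2) ^ 3 / (1 - 1 / 2) + 1 / 10000)"
    by (rule obtuse_Z0_less[OF s, where z = "7071 / 10000" and ?c0.0 = "70712 / 100000" and ?u0.0 = "3826 / 10000"])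
      (use n \<gamma> in \<open>auto simp: power2_eq_square\<close>)
  then show False using n by (simp add: power2_eq_square power3_eq_cube)
qed

lemma Z0_less_sqrt2:
  assumes "\<gamma> \<le> 8091 / 10000"
  shows "Z 0 < 1 / 2"
proof (rule ccontr)
  assume n: "\<not> ?thesis"
  have "Z 0 < 28 / 100 \<or> 0 \<le> C 0 \<and> Z 0 * (1 - \<rho> / 2) < 28 / 100 \<or> C 0 < 0 \<and> Z1 * Y1 < 0"
    using assms by (intro Z0_cases[of "8091 / 20000"]) (auto simp: power2_eq_square)
  moreover have "Z 0 * (3 / 4) \<le> Z 0 * (1 - \<rho> / 2)" using Z0 \<gamma> by (intro mult_left_mono) auto
  ultimately have s: "C 0 < 0" "Z1 * Y1 < 0" using n by linarith+
  \<comment> \<open>The same scheme at \<open>Z 0 = sin (pi / 6)\<close>, with rounded values of cos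
    (pi / 6), cos (pi / 12) and sin (pi / 12).\<close>
  have "Z 0 < 8091 / 20000 * (70711 / 100000 * (966 / 1000)) + (8091 / 20000) ^ 2 * (5626 / 10000) + ((8091 / 20000) ^ 3 / (1 - 8091 / 20000) + 1 / 10000)"
    by (rule obtuse_Z0_less[OF s, where z = "1 / 2" and ?c0.0 = "86603 / 100000" and ?u0.0 = "2588 / 10000"])
      (use n assms in \<open>auto simp: power2_eq_square\<close>)
  then show False using n by (simp add: power2_eq_square power3_eq_cube)
qed

text \<open>The \<open>Z\<close> series forces \<open>Z2 * Y2 < 0\<close>. In the first alternative
  of \<open>obtuse\<close> this makes \<open>C2 * Y2\<close> negative as well and at least 0.653 in
  size, so the terms of the \<open>C\<close> series reinforce each other beyond its tail; in the
  second \<open>Z2 * Y2\<close> is too small.\<close>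

lemma Z0_less_plastic:
  assumes g: "\<gamma> \<le> 442 / 625"
  shows "Z 0 < 1913 / 5000"
proof (rule ccontr)
  assume n: "\<not> ?thesis"
  have "Z 0 < 19353 / 100000 \<or> 0 \<le> C 0 \<and> Z 0 * (1 - \<rho> / 2) < 19353 / 100000 \<or> C 0 < 0 \<and> Z1 * Y1 < 0"
    using g by (intro Z0_cases[of "221 / 625"]) (auto simp: power2_eq_square)
  moreover have "Z 0 * (3 / 4) \<le> Z 0 * (1 - \<rho> / 2)" using Z0 \<gamma> by (intro mult_left_mono) auto
  ultimately have s: "C 0 < 0" "Z1 * Y1 < 0" using n by linarith+
  obtain u w where u: "0 \<le> u" "0 < w" "w \<le> 1" "u\<^sup>2 + w\<^sup>2 = 1" "C 0 = u\<^sup>2 - w\<^sup>2" "Z 0 = 2 * u * w"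
    and f1: "Z1 * Y1 = - (r * w)" "C1 * Y1 = - (r * u)"
    and f2: "(C2 * Y2)\<^sup>2 = (1 + u) * (1 + r) / 4 \<and> (Z2 * Y2)\<^sup>2 = (1 - u) * (1 + r) / 4 \<and> 0 \<le> (C2 * Y2) * (Z2 * Y2)
     \<or> (C2 * Y2)\<^sup>2 = (1 - u) * (1 - r) / 4 \<and> (Z2 * Y2)\<^sup>2 = (1 + u) * (1 - r) / 4" and u1: "u \<le> 1"
    using obtuse[OF s] by blast
  have \<rho>: "0 < \<rho>" "\<rho> \<le> 221 / 625" using \<gamma> g by simp_all
  have t2: "\<rho> ^ 2 / (1 - \<rho>) \<le> 19343 / 100000" by (rule power_tail_mono[of _ "221 / 625"]) (use \<rho> in \<open>simp_all add: power2_eq_square\<close>)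
  have t3: "\<rho> ^ 3 / (1 - \<rho>) \<le> 6840 / 100000" by (rule power_tail_mono[of _ "221 / 625"]) (use \<rho> in \<open>simp_all add: power3_eq_cube\<close>)
  have rw: "\<rho> * (r * w) \<le> 221 / 625 * (70711 / 100000 * 1)" using \<rho> r u by (intro mult_mono) auto
  have \<rho>2: "\<rho> ^ 2 \<le> (221 / 625) ^ 2" using \<rho> by (intro power_mono) auto
  note G2 = obtuse_series(2)[OF f1(2,1)] and G3 = obtuse_series(3)[OF f1(2,1)] and F3 = obtuse_series(1)[OF f1(2,1)]
  have neg: "Z2 * Y2 < 0"
  proof (rule ccontr)
    assume "\<not> Z2 * Y2 < 0"
    then have "0 \<le> \<rho> ^ 2 * (Z2 * Y2)" by simp
    then show False using G3 rw t3 n by linarith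
  qed
  show False using f2
  proof
    assume a: "(C2 * Y2)\<^sup>2 = (1 + u) * (1 + r) / 4 \<and> (Z2 * Y2)\<^sup>2 = (1 - u) * (1 + r) / 4 \<and> 0 \<le> (C2 * Y2) * (Z2 * Y2)"
    have "C2 * Y2 \<le> 0" using a neg by (meson mult_pos_neg not_le)
    moreover have "1 * (17071 / 10000) \<le> (1 + u) * (1 + r)" using u r by (intro mult_mono) auto
    then have "653 / 1000 \<le> \<bar>C2 * Y2\<bar>" using a by (intro abs_ge_if_square_eq[of _ "(1 + u) * (1 + r) / 4"]) (auto simp: power2_eq_square)
    ultimately have "\<gamma>\<^sup>2 * (C2 * Y2) \<le> \<gamma>\<^sup>2 * (- 653 / 1000)" by (intro mult_left_mono) auto
    moreover have "Z 0 \<le> 4436 / 10000" using G2 rw t2 by linarith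
    then have "(Z 0)\<^sup>2 \<le> (4436 / 10000)\<^sup>2" using Z0 by (intro power_mono)
    then have "(896 / 1000)\<^sup>2 \<le> (C 0)\<^sup>2" using CZ[of 0] by (simp add: power2_eq_square)
    then have "896 / 1000 \<le> \<bar>C 0\<bar>" by (rule abs_ge_of_square) simp
    moreover have "0 \<le> \<gamma> * (r * u)" using \<gamma> u by simp
    ultimately have "896 / 1000 + 653 / 1000 * \<gamma>\<^sup>2 < \<gamma> ^ 3 / (1 - \<gamma>) + 1 / 10000" using F3 s by linarith
    moreover have "\<gamma> ^ 3 / (1 - \<gamma>) = \<gamma>\<^sup>2 * (\<gamma> / (1 - \<gamma>))" by (simp add: power2_eq_square power3_eq_cube)
    moreover have "\<gamma>\<^sup>2 * (\<gamma> / (1 - \<gamma>) - 653 / 1000) \<le> (442 / 625)\<^sup>2 * (442 / 625 / (1 - 442 / 625) - 653 / 1000)"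
    proof (intro mult_mono power_mono diff_mono frac_le)
      have "1 \<le> \<gamma> / (1 - \<gamma>)" using \<gamma> by simp
      then show "0 \<le> \<gamma> / (1 - \<gamma>) - 653 / 1000" by linarith
    qed (use \<gamma> g in auto)
    ultimately show False by (simp add: right_diff_distrib power2_eq_square)
  next
    assume b: "(C2 * Y2)\<^sup>2 = (1 - u) * (1 - r) / 4 \<and> (Z2 * Y2)\<^sup>2 = (1 + u) * (1 - r) / 4"
    moreover have "(1 + u) * (1 - r) \<le> 2 * (29290 / 100000)" using u(1) u1 r by (intro mult_mono) auto
    ultimately have "\<bar>Z2 * Y2\<bar> \<le> 3828 / 10000" by (intro abs_le_if_square_eq[of _ "(1 + u) * (1 - r) / 4"]) (auto simp: power2_eq_square)
    then have "\<bar>\<rho> ^ 2 * (Z2 * Y2)\<bar> \<le> (221 / 625) ^ 2 * (3828 / 10000)" using \<rho>2 by (intro abs_mult_le) auto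
    also have "\<dots> \<le> 48 / 1000" by (simp add: power2_eq_square)
    finally show False using G3 rw t3 n by linarith
  qed
qed

text \<open>Here the \<open>C\<close> series decides both alternatives; in the second,
  \<open>Z 0 = 2 * u * w \<ge> 0.306\<close> gives \<open>u \<ge> 0.153\<close>, so the level-1 term
  adds to the size of \<open>C 0\<close>.\<close>

lemma Z0_less_sparse3:
  assumes g: "63 / 100 \<le> \<gamma>" "\<gamma> \<le> 3313 / 5000"
  shows "Z 0 < 306 / 1000"
proof (rule ccontr)
  assume n: "\<not> ?thesis"
  have "Z 0 < 17 / 100 \<or> 0 \<le> C 0 \<and> Z 0 * (1 - \<rho> / 2) < 17 / 100 \<or> C 0 < 0 \<and> Z1 * Y1 < 0"
    using g by (intro Z0_cases[of "3313 / 10000"]) (auto simp: power2_eq_square)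
  moreover have "Z 0 * (3 / 4) \<le> Z 0 * (1 - \<rho> / 2)" using Z0 \<gamma> by (intro mult_left_mono) auto
  ultimately have s: "C 0 < 0" "Z1 * Y1 < 0" using n by linarith+
  obtain u w where u: "0 \<le> u" "0 < w" "w \<le> 1" "u\<^sup>2 + w\<^sup>2 = 1" "C 0 = u\<^sup>2 - w\<^sup>2" "Z 0 = 2 * u * w"
    and f1: "Z1 * Y1 = - (r * w)" "C1 * Y1 = - (r * u)"
    and f2: "(C2 * Y2)\<^sup>2 = (1 + u) * (1 + r) / 4 \<and> (Z2 * Y2)\<^sup>2 = (1 - u) * (1 + r) / 4 \<and> 0 \<le> (C2 * Y2) * (Z2 * Y2)
     \<or> (C2 * Y2)\<^sup>2 = (1 - u) * (1 - r) / 4 \<and> (Z2 * Y2)\<^sup>2 = (1 + u) * (1 - r) / 4" and u1: "u \<le> 1"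
    using obtuse[OF s] by blast
  have \<rho>: "0 < \<rho>" "\<rho> \<le> 3313 / 10000" using \<gamma> g by simp_all
  have t2: "\<rho> ^ 2 / (1 - \<rho>) \<le> 16415 / 100000" by (rule power_tail_mono[of _ "3313 / 10000"]) (use \<rho> in \<open>simp_all add: power2_eq_square\<close>)
  have t3: "\<rho> ^ 3 / (1 - \<rho>) \<le> 5439 / 100000" by (rule power_tail_mono[of _ "3313 / 10000"]) (use \<rho> in \<open>simp_all add: power3_eq_cube\<close>)
  have rw: "\<rho> * (r * w) \<le> 3313 / 10000 * (70711 / 100000 * 1)" using \<rho> r u by (intro mult_mono) auto
  note G2 = obtuse_series(2)[OF f1(2,1)] and G3 = obtuse_series(3)[OF f1(2,1)] and F3 = obtuse_series(1)[OF f1(2,1)]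
  have neg: "Z2 * Y2 < 0"
  proof (rule ccontr)
    assume "\<not> Z2 * Y2 < 0"
    then have "0 \<le> \<rho> ^ 2 * (Z2 * Y2)" by simp
    then show False using G3 rw t3 n by linarith
  qed
  have "Z 0 \<le> 3986 / 10000" using G2 rw t2 by linarith
  then have "(Z 0)\<^sup>2 \<le> (3986 / 10000)\<^sup>2" using Z0 by (intro power_mono)
  then have "(917 / 1000)\<^sup>2 \<le> (C 0)\<^sup>2" using CZ[of 0] by (simp add: power2_eq_square)
  then have "917 / 1000 \<le> \<bar>C 0\<bar>" by (rule abs_ge_of_square) simp
  then have C: "C 0 \<le> - (917 / 1000)" using s by linarith
  have \<gamma>3: "\<gamma> ^ 3 / (1 - \<gamma>) \<le> 8623 / 10000"
    by (rule power_tail_mono[of _ "3313 / 5000"]) (use \<gamma> g in \<open>simp_all add: power3_eq_cube\<close>)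
  have \<gamma>2: "(63 / 100)\<^sup>2 \<le> \<gamma>\<^sup>2" "\<gamma>\<^sup>2 \<le> (3313 / 5000)\<^sup>2" using \<gamma> g by (intro power_mono; simp)+
  show False using f2
  proof
    assume a: "(C2 * Y2)\<^sup>2 = (1 + u) * (1 + r) / 4 \<and> (Z2 * Y2)\<^sup>2 = (1 - u) * (1 + r) / 4 \<and> 0 \<le> (C2 * Y2) * (Z2 * Y2)"
    have "C2 * Y2 \<le> 0" using a neg by (meson mult_pos_neg not_le)
    moreover have "1 * (17071 / 10000) \<le> (1 + u) * (1 + r)" using u r by (intro mult_mono) auto
    then have "653 / 1000 \<le> \<bar>C2 * Y2\<bar>" using a by (intro abs_ge_if_square_eq[of _ "(1 + u) * (1 + r) / 4"]) (auto simp: power2_eq_square)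
    ultimately have "\<gamma>\<^sup>2 * (C2 * Y2) \<le> \<gamma>\<^sup>2 * (- 653 / 1000)" by (intro mult_left_mono) auto
    moreover have "0 \<le> \<gamma> * (r * u)" using \<gamma> u by simp
    ultimately show False using F3 C \<gamma>3 \<gamma>2 by (simp add: power2_eq_square)
  next
    assume b: "(C2 * Y2)\<^sup>2 = (1 - u) * (1 - r) / 4 \<and> (Z2 * Y2)\<^sup>2 = (1 + u) * (1 - r) / 4"
    have "u * w \<le> u * 1" using u by (intro mult_left_mono) auto
    then have u': "153 / 1000 \<le> u" using n u(6) by simp
    have "(1 - u) * (1 - r) \<le> (847 / 1000) * (29290 / 100000)" using u' u1 r by (intro mult_mono) auto
    then have "\<bar>C2 * Y2\<bar> \<le> 2491 / 10000" using b by (intro abs_le_if_square_eq[of _ "(1 - u) * (1 - r) / 4"]) (auto simp: power2_eq_square)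
    then have "\<bar>\<gamma>\<^sup>2 * (C2 * Y2)\<bar> \<le> (3313 / 5000)\<^sup>2 * (2491 / 10000)" using \<gamma>2 by (intro abs_mult_le) auto
    moreover have "63 / 100 * (7071 / 10000 * (153 / 1000)) \<le> \<gamma> * (r * u)" using g r u' by (intro mult_mono) auto
    ultimately show False using F3 C \<gamma>3 by (simp add: power2_eq_square)
  qed
qed

text \<open>Once an obtuse angle is excluded, \<open>C 0\<close> is near 1, so \<open>Z1\<close> has
  about half the size of \<open>Z 0\<close> and \<open>Z1 * Y1\<close> about 0.3536 times it; 0.502
  and 0.355 are these ratios with a margin.\<close>

lemma small_angle:
  assumes g: "\<gamma> \<le> 63 / 100" and p: "\<rho> \<le> p" "p < 1" and t: "p ^ 2 / (1 - p) + 1 / 10000 \<le> t"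
  shows "0 \<le> C 0" "\<bar>\<rho> * (Z1 * Y1)\<bar> \<le> \<rho> * (355 / 1000 * Z 0)" "\<bar>Z1\<bar> \<le> 502 / 1000 * Z 0" "Z 0 * (1 - 355 / 1000 * \<rho>) < t"
proof -
  have \<rho>: "1 / 4 < \<rho>" "\<rho> \<le> 63 / 200" using \<gamma> g by simp_all
  have t2: "\<rho> ^ 2 / (1 - \<rho>) \<le> 14486 / 100000" by (rule power_tail_mono[of _ "63 / 200"]) (use \<rho> in \<open>simp_all add: power2_eq_square\<close>)
  have \<rho>1: "\<rho> / (1 - \<rho>) \<le> 46 / 100" using power_tail_mono[of \<rho> "63 / 200" 1 "46 / 100"] \<rho> by simp
  show C0: "0 \<le> C 0"
  proof (rule ccontr)
    assume "\<not> 0 \<le> C 0"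
    then have neg: "C 0 < 0" by simp
    show False
    proof (cases "Z1 * Y1 < 0")
      case True
      obtain u w where u: "0 \<le> u" "0 < w" "w \<le> 1" "u\<^sup>2 + w\<^sup>2 = 1" "C 0 = u\<^sup>2 - w\<^sup>2" "Z 0 = 2 * u * w"
        and f1: "Z1 * Y1 = - (r * w)" "C1 * Y1 = - (r * u)"
        and f2: "(C2 * Y2)\<^sup>2 = (1 + u) * (1 + r) / 4 \<and> (Z2 * Y2)\<^sup>2 = (1 - u) * (1 + r) / 4 \<and> 0 \<le> (C2 * Y2) * (Z2 * Y2)
         \<or> (C2 * Y2)\<^sup>2 = (1 - u) * (1 - r) / 4 \<and> (Z2 * Y2)\<^sup>2 = (1 + u) * (1 - r) / 4" and u1: "u \<le> 1"
        using obtuse[OF neg True] by blast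
      note G2 = obtuse_series(2)[OF f1(2,1)] and F3 = obtuse_series(1)[OF f1(2,1)]
      have "r\<^sup>2 \<le> w\<^sup>2" using u(4,5) neg by simp
      then have rw: "7071 / 10000 \<le> w" using power2_le_imp_le[of r w] u(2) r(2) by linarith
      have "\<rho> * (r * w) \<le> 63 / 200 * (70711 / 100000 * w)" using \<rho> r u by (intro mult_mono) auto
      then have "2 * u * w \<le> 22275 / 100000 * w + 14496 / 100000" using G2 t2 u(2) unfolding u(6)[symmetric] by linarith
      \<comment> \<open>The bound \<open>w \<ge> 0.7071\<close>, from \<open>C 0 < 0\<close>, turns
        the constant into a multiple of \<open>w\<close>, which then cancels.\<close>
      also have "\<dots> \<le> 22275 / 100000 * w + 20501 / 100000 * w" using rw by simp
      also have "\<dots> = 2 * (21388 / 100000) * w" by simp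
      finally have u': "u \<le> 214 / 1000" using u(2) by simp
      have "(C2 * Y2)\<^sup>2 \<le> (1 + u) * (1 + r) / 4"
        using f2
      proof
        assume b: "(C2 * Y2)\<^sup>2 = (1 - u) * (1 - r) / 4 \<and> (Z2 * Y2)\<^sup>2 = (1 + u) * (1 - r) / 4"
        have "(1 - u) * (1 - r) \<le> (1 + u) * (1 + r)" using u u' r by (intro mult_mono) auto
        then show ?thesis using b by simp
      qed simp
      also have "(1 + u) * (1 + r) \<le> (1 + u) * (170711 / 100000)" using u r by (intro mult_left_mono) auto
      \<comment> \<open>0.65329 rounds the root of (1 + r) / 4 up, and 1 + u / 2 replaces the root
        of 1 + u to keep the estimate linear in \<open>u\<close>.\<close>
      also have "(1 + u) * (170711 / 100000) / 4 \<le> (65329 / 100000 * (1 + u / 2))\<^sup>2"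
      proof -
        have "(65329 / 100000 * (1 + u / 2))\<^sup>2 = (65329 / 100000)\<^sup>2 * (1 + u + u\<^sup>2 / 4)"
          by (simp add: power2_eq_square algebra_simps)
        moreover have "(65329 / 100000)\<^sup>2 * (1 + u) \<le> (65329 / 100000)\<^sup>2 * (1 + u + u\<^sup>2 / 4)" by (intro mult_left_mono) auto
        ultimately show ?thesis using u(1) by (simp add: power2_eq_square)
      qed
      finally have "\<bar>C2 * Y2\<bar> \<le> 65329 / 100000 * (1 + u / 2)" using u by (intro abs_le_of_square) auto
      moreover have "\<gamma>\<^sup>2 \<le> (63 / 100)\<^sup>2" using \<gamma> g by (intro power_mono) auto
      ultimately have "\<bar>\<gamma> ^ 2 * (C2 * Y2)\<bar> \<le> (63 / 100)\<^sup>2 * (65329 / 100000 * (1 + u / 2))" by (intro abs_mult_le[OF zero_le_power2])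
      also have "\<dots> \<le> 2594 / 10000 + 1298 / 10000 * u" using u(1) by (simp add: power2_eq_square algebra_simps)
      finally have q: "\<gamma> ^ 2 * (C2 * Y2) \<le> 2594 / 10000 + 1298 / 10000 * u" by (rule abs_le_D1)
      have a: "1 / 2 * (7071 / 10000 * u) \<le> \<gamma> * (r * u)" using \<gamma> r u by (intro mult_mono) auto
      have T: "\<gamma> ^ 3 / (1 - \<gamma>) \<le> 6759 / 10000" by (rule power_tail_mono[of _ "63 / 100"]) (use \<gamma> g in \<open>simp_all add: power3_eq_cube\<close>)
      have "u * u \<le> 214 / 1000 * u" using u u' by (intro mult_right_mono) auto
      moreover have "C 0 = 2 * (u * u) - 1" using u(4,5) by (simp add: power2_eq_square)
      ultimately have c: "C 0 \<le> 428 / 1000 * u - 1" by simp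
      have "- (C 0 - \<gamma> * (r * u) + \<gamma> ^ 2 * (C2 * Y2)) < \<gamma> ^ 3 / (1 - \<gamma>) + 1 / 10000"
        using F3 by (simp only: abs_less_iff)
      then have "1 - 428 / 1000 * u + 1 / 2 * (7071 / 10000 * u) - (2594 / 10000 + 1298 / 10000 * u) < 676 / 1000"
        using q a T c by simp
      then show False using u' by simp
    next
      \<comment> \<open>Now the level-1 term is at least \<open>\<rho> / 2\<close>, more than the
        tail, which is below \<open>46 / 100 * \<rho>\<close>.\<close>
      case False
      have sq: "(Z1 * Y1)\<^sup>2 = (1 - C 0) / 4" unfolding power_mult_distrib half_angle X0 by simp
      have "(1 / 2)\<^sup>2 \<le> (Z1 * Y1)\<^sup>2" unfolding sq using neg by (simp add: power_divide)
      then have "1 / 2 \<le> \<bar>Z1 * Y1\<bar>" by (rule abs_ge_of_square) simp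
      then have "1 / 2 \<le> Z1 * Y1" using False by simp
      then have "\<rho> * (1 / 2) \<le> \<rho> * (Z1 * Y1)" using \<rho> by (intro mult_left_mono) auto
      moreover have "\<rho> ^ 2 / (1 - \<rho>) = \<rho> * (\<rho> / (1 - \<rho>))" by (simp add: power2_eq_square)
      moreover have "\<rho> * (\<rho> / (1 - \<rho>)) \<le> \<rho> * (46 / 100)" using \<rho>1 \<rho> by (intro mult_left_mono) auto
      ultimately show False using Z_series(1) Z0 \<rho> by linarith
    qed
  qed
  have "Z 0 < 14496 / 100000 \<or> 0 \<le> C 0 \<and> Z 0 * (1 - \<rho> / 2) < 14496 / 100000 \<or> C 0 < 0 \<and> Z1 * Y1 < 0"
    using \<rho> by (intro Z0_cases[of "63 / 200"]) (auto simp: power2_eq_square)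
  moreover have "Z 0 * (337 / 400) \<le> Z 0 * (1 - \<rho> / 2)" using Z0 \<rho> by (intro mult_left_mono) auto
  ultimately have z: "Z 0 \<le> 1721 / 10000" using C0 Z0 by linarith
  then have "(Z 0)\<^sup>2 \<le> (1721 / 10000)\<^sup>2" using Z0 by (intro power_mono)
  then have "(985 / 1000)\<^sup>2 \<le> (C 0)\<^sup>2" using CZ[of 0] by (simp add: power2_eq_square)
  then have C': "985 / 1000 \<le> C 0" using abs_ge_of_square[of "985 / 1000" "C 0"] C0 by simp
  then have "(1 - C 0) * (1985 / 1000) \<le> (1 - C 0) * (1 + C 0)" using abs_le_1(1)[of 0] by (intro mult_left_mono) auto
  also have "\<dots> = (Z 0)\<^sup>2" using CZ[of 0] by (simp add: power2_eq_square algebra_simps)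
  finally have le: "(1 - C 0) / 2 \<le> 252 / 1000 * (Z 0)\<^sup>2" using zero_le_power2[of "Z 0"] by linarith
  show "\<bar>Z1\<bar> \<le> 502 / 1000 * Z 0"
  proof (rule abs_le_if_square_eq[OF half_angle(2)])
    have "(502 / 1000 * Z 0)\<^sup>2 = 252004 / 1000000 * (Z 0)\<^sup>2" by (simp add: power2_eq_square)
    then show "(1 - C 0) / 2 \<le> (502 / 1000 * Z 0)\<^sup>2" using le zero_le_power2[of "Z 0"] by linarith
  qed (use Z0 in simp)
  have g0: "\<bar>Z1 * Y1\<bar> \<le> 355 / 1000 * Z 0"
  proof (rule abs_le_of_square)
    have "(Z1 * Y1)\<^sup>2 = (1 - C 0) / 4" unfolding power_mult_distrib half_angle X0 by simp
    moreover have "(355 / 1000 * Z 0)\<^sup>2 = 126025 / 1000000 * (Z 0)\<^sup>2" by (simp add: power2_eq_square)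
    ultimately show "(Z1 * Y1)\<^sup>2 \<le> (355 / 1000 * Z 0)\<^sup>2" using le zero_le_power2[of "Z 0"] by linarith
  qed (use Z0 in simp)
  show g1: "\<bar>\<rho> * (Z1 * Y1)\<bar> \<le> \<rho> * (355 / 1000 * Z 0)" by (rule abs_mult_le[OF _ order_refl g0]) (use \<rho> in simp)
  have "\<rho> ^ 2 / (1 - \<rho>) \<le> t - 1 / 10000" by (rule power_tail_mono[of _ p]) (use \<rho> p t in auto)
  then have "Z 0 - \<rho> * (355 / 1000 * Z 0) < t" using g1 Z_series(1) by linarith
  then show "Z 0 * (1 - 355 / 1000 * \<rho>) < t" by (simp add: algebra_simps)
qed

lemma Z0_less_sparse4:
  assumes g: "\<gamma> \<le> 63 / 100"
  shows "Z 0 < 164 / 1000"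
proof -
  have "Z 0 * (1 - 355 / 1000 * \<rho>) < 14496 / 100000" using g by (intro small_angle(4)[of "63 / 200"]) (auto simp: power2_eq_square)
  moreover have "Z 0 * (888 / 1000) \<le> Z 0 * (1 - 355 / 1000 * \<rho>)" using g Z0 by (intro mult_left_mono) auto
  ultimately show ?thesis by linarith
qed

lemma abs_C1_Y1_le: "\<bar>C1 * Y1\<bar> \<le> 70711 / 100000"
proof -
  have "\<bar>Y1\<bar> = r" using X1Y1 by auto
  then have "\<bar>Y1\<bar> \<le> 70711 / 100000" using r(3) by linarith
  then have "\<bar>C1\<bar> * \<bar>Y1\<bar> \<le> 1 * (70711 / 100000)" using abs_le_1(1)[of "Suc 0"] by (intro mult_mono) auto
  then show ?thesis by (simp add: abs_mult)
qed

lemmas C_less = C_series[unfolded abs_less_iff, THEN conjunct1]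
lemmas Z_less = Z_series[unfolded abs_less_iff, THEN conjunct1]

text \<open>\<open>C 0\<close> is at least 0.99 and has to be cancelled. The tails after one and
  after two terms are too small for that, which forces the signs at levels 1 and 2. A nonpositive
  \<open>C1\<close> would make \<open>C2\<close> negligible. With \<open>C1\<close> near 1,
  \<open>Z2 * Y2\<close> is a small multiple of \<open>Z 0\<close>, and three terms of the
  \<open>Z\<close> series give the sharp bound.\<close>

lemma near_tangency:
  assumes g: "\<gamma> \<le> 5947 / 10000"
  shows "0 < C1" "X1 = - r" "Y1 = - r" "C2 * Y2 < 0" "Z 0 < 43 / 1000"
proof -
  have \<rho>: "0 < \<rho>" "\<rho> \<le> 5947 / 20000" using \<gamma> g by simp_all
  have p: "\<gamma> \<le> 63 / 100" "5947 / 20000 < (1 :: real)" "(5947 / 20000) ^ 2 / (1 - 5947 / 20000) + 1 / 10000 \<le> (12594 / 100000 :: real)"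
    using g by (simp_all add: power2_eq_square)
  note small = small_angle[OF p(1) \<rho>(2) p(2,3)]
  have "Z 0 * (894 / 1000) \<le> Z 0 * (1 - 355 / 1000 * \<rho>)" using g Z0 by (intro mult_left_mono) auto
  then have "Z 0 \<le> 141 / 1000" using small(4) by linarith
  then have "(Z 0)\<^sup>2 \<le> (141 / 1000)\<^sup>2" using Z0 by (intro power_mono)
  then have "(99 / 100)\<^sup>2 \<le> (C 0)\<^sup>2" using CZ[of 0] by (simp add: power2_eq_square)
  then have C0: "99 / 100 \<le> C 0" using abs_ge_of_square[of "99 / 100" "C 0"] small(1) by simp
  have aC1: "997 / 1000 \<le> \<bar>C1\<bar>" by (rule abs_ge_if_square_eq[OF half_angle(1)]) (use C0 in \<open>simp_all add: power2_eq_square\<close>)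
  have t2: "\<gamma> ^ 2 / (1 - \<gamma>) \<le> 8727 / 10000"
    by (rule power_tail_mono[of _ "5947 / 10000"]) (use \<gamma> g in \<open>simp_all add: power2_eq_square\<close>)
  have t3: "\<gamma> ^ 3 / (1 - \<gamma>) \<le> 519 / 1000"
    by (rule power_tail_mono[of _ "5947 / 10000"]) (use \<gamma> g in \<open>simp_all add: power3_eq_cube\<close>)
  have \<gamma>2: "\<gamma>\<^sup>2 \<le> (5947 / 10000)\<^sup>2" using \<gamma> g by (intro power_mono) auto
  have f1: "- (5947 / 10000 * (70711 / 100000)) \<le> \<gamma> * (C1 * Y1)" by (rule abs_mult_ge) (use \<gamma> g abs_C1_Y1_le in auto)
  have n1: "C1 * Y1 < 0"
  proof (rule ccontr)
    assume "\<not> C1 * Y1 < 0"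
    then have "0 \<le> \<gamma> * (C1 * Y1)" using \<gamma> by simp
    then show False using C_less(1) t2 C0 by linarith
  qed
  show n2: "C2 * Y2 < 0"
  proof (rule ccontr)
    assume "\<not> C2 * Y2 < 0"
    then have "0 \<le> \<gamma> ^ 2 * (C2 * Y2)" by simp
    then show False using C_less(2) t3 C0 f1 by linarith
  qed
  show C1: "0 < C1"
  proof (rule ccontr)
    assume "\<not> 0 < C1"
    then have "C1 \<le> - (997 / 1000)" using aC1 by simp
    then have "C2\<^sup>2 \<le> (39 / 1000)\<^sup>2" unfolding half_angle by (simp add: power2_eq_square)
    then have "\<bar>C2\<bar> \<le> 39 / 1000" by (rule abs_le_of_square) simp
    then have "\<bar>C2 * Y2\<bar> \<le> 39 / 1000 * 1" unfolding abs_mult using abs_le_1(4)[of "Suc (Suc 0)"] by (intro mult_mono) auto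
    from abs_mult_ge[OF zero_le_power2 \<gamma>2 this] have "- (2 / 100) \<le> \<gamma> ^ 2 * (C2 * Y2)" by (simp add: power2_eq_square)
    then show False using C_less(2) t3 C0 f1 by linarith
  qed
  have Y1: "Y1 < 0" using n1 C1 by (simp add: mult_less_0_iff)
  then show X1: "X1 = - r" "Y1 = - r" using X1Y1 r by auto
  have "(1 - C1) * (1997 / 1000) \<le> (1 - C1) * (1 + C1)" using abs_le_1(1)[of "Suc 0"] aC1 C1 by (intro mult_left_mono) auto
  also have "\<dots> = Z1\<^sup>2" using CZ[of "Suc 0"] by (simp add: power2_eq_square algebra_simps)
  also have "\<dots> \<le> (502 / 1000 * Z 0)\<^sup>2" using power_mono[OF small(3), of 2] by simp
  also have "(502 / 1000 * Z 0)\<^sup>2 = 252004 / 1000000 * (Z 0)\<^sup>2" by (simp add: power2_eq_square)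
  finally have "1 - C1 \<le> 252004 / 1997000 * (Z 0)\<^sup>2" by simp
  also have "\<dots> \<le> 1262 / 10000 * (Z 0)\<^sup>2" by (intro mult_right_mono) auto
  finally have le: "1 - C1 \<le> 1262 / 10000 * (Z 0)\<^sup>2" .
  have "(Z2 * Y2)\<^sup>2 = (1 - C1) * (1 + r) / 4" unfolding power_mult_distrib half_angle X1 by simp
  also have "(1 - C1) * (1 + r) \<le> 1262 / 10000 * (Z 0)\<^sup>2 * (170711 / 100000)" using le r by (intro mult_mono) auto
  finally have "(Z2 * Y2)\<^sup>2 \<le> 1262 / 10000 * (Z 0)\<^sup>2 * (170711 / 100000) / 4" by simp
  moreover have "(2353 / 10000 * Z 0)\<^sup>2 = 5536609 / 100000000 * (Z 0)\<^sup>2" by (simp add: power2_eq_square)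
  ultimately have "(Z2 * Y2)\<^sup>2 \<le> (2353 / 10000 * Z 0)\<^sup>2" using zero_le_power2[of "Z 0"] by linarith
  then have g2: "\<bar>Z2 * Y2\<bar> \<le> 2353 / 10000 * Z 0" using Z0 by (intro abs_le_of_square) auto
  have "\<rho> ^ 2 \<le> (5947 / 20000)\<^sup>2" using \<rho> by (intro power_mono) auto
  from abs_mult_ge[OF zero_le_power2 this g2] have "- (885 / 10000 * (2353 / 10000 * Z 0)) \<le> \<rho> ^ 2 * (Z2 * Y2)"
    using Z0 by (simp add: power2_eq_square)
  moreover have "- (\<rho> * (355 / 1000 * Z 0)) \<le> \<rho> * (Z1 * Y1)" using small(2) by (simp only: abs_le_iff minus_le_iff)
  moreover have "\<rho> ^ 3 / (1 - \<rho>) \<le> 37418 / 1000000"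
    by (rule power_tail_mono[of _ "5947 / 20000"]) (use \<rho> in \<open>simp_all add: power3_eq_cube\<close>)
  moreover have "\<rho> * (355 / 1000 * Z 0) \<le> 5947 / 20000 * (355 / 1000 * Z 0)" using \<rho> Z0 by (intro mult_right_mono) auto
  ultimately show "Z 0 < 43 / 1000" using Z_less(2) by linarith
qed

text \<open>The sign argument is carried to level 4. From \<open>C 0 \<ge> 0.999\<close> levels 1 to
  4 can remove at most about 0.397, 0.291, 0.099 and 0.029, and the tail 0.127, which is not
  enough.\<close>

lemma no_tangency:
  assumes g: "\<gamma> \<le> 5613 / 10000"
  shows False
proof -
  have g': "\<gamma> \<le> 5947 / 10000" using g by simp
  note C1 = near_tangency(1)[OF g'] and X1 = near_tangency(2)[OF g'] and Y1 = near_tangency(3)[OF g']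
    and n2 = near_tangency(4)[OF g'] and z = near_tangency(5)[OF g']
  have "0 \<le> C 0" by (rule small_angle(1)[of "63 / 200" 1]) (use g in \<open>simp_all add: power2_eq_square\<close>)
  moreover have "(Z 0)\<^sup>2 \<le> (43 / 1000)\<^sup>2" using Z0 z by (intro power_mono) auto
  then have "(99907 / 100000)\<^sup>2 \<le> (C 0)\<^sup>2" using CZ[of 0] by (simp add: power2_eq_square)
  ultimately have C0: "99907 / 100000 \<le> C 0" using abs_ge_of_square[of "99907 / 100000" "C 0"] by simp
  have "9997 / 10000 \<le> \<bar>C1\<bar>" by (rule abs_ge_if_square_eq[OF half_angle(1)]) (use C0 in \<open>simp_all add: power2_eq_square\<close>)
  then have "(9999 / 10000)\<^sup>2 \<le> C2\<^sup>2" unfolding half_angle using C1 by (simp add: power2_eq_square)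
  then have aC2: "9999 / 10000 \<le> \<bar>C2\<bar>" by (rule abs_ge_of_square) simp
  have \<gamma>p: "\<gamma>\<^sup>2 \<le> (5613 / 10000)\<^sup>2" "\<gamma> ^ 3 \<le> (5613 / 10000) ^ 3" "\<gamma> ^ 4 \<le> (5613 / 10000) ^ 4"
    using \<gamma> g by (intro power_mono; simp)+
  have \<gamma>0: "0 \<le> \<gamma> ^ n" for n using \<gamma> by simp
  have f1: "- (5613 / 10000 * (70711 / 100000)) \<le> \<gamma> * (C1 * Y1)" by (rule abs_mult_ge) (use \<gamma> g abs_C1_Y1_le in auto)
  have "\<bar>Y2\<bar> \<le> 92389 / 100000" by (rule abs_le_if_square_eq[OF half_angle(5)]) (use X1 r in \<open>simp_all add: power2_eq_square\<close>)
  then have "\<bar>C2 * Y2\<bar> \<le> 1 * (92389 / 100000)" unfolding abs_mult using abs_le_1(1)[of "Suc (Suc 0)"] by (intro mult_mono) auto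
  from abs_mult_ge[OF zero_le_power2 \<gamma>p(1) this]
  have S: "311 / 1000 \<le> C 0 + \<gamma> * (C1 * Y1) + \<gamma> ^ 2 * (C2 * Y2)" using C0 f1 by (simp add: power2_eq_square)
  have t4: "\<gamma> ^ 4 / (1 - \<gamma>) \<le> 2263 / 10000"
    by (rule power_tail_mono[of _ "5613 / 10000"]) (use \<gamma> g in \<open>simp_all add: eval_nat_numeral\<close>)
  have t5: "\<gamma> ^ 5 / (1 - \<gamma>) \<le> 1271 / 10000"
    by (rule power_tail_mono[of _ "5613 / 10000"]) (use \<gamma> g in \<open>simp_all add: eval_nat_numeral\<close>)
  have n3: "C3 * Y3 < 0"
  proof (rule ccontr)
    assume "\<not> C3 * Y3 < 0"
    then have "0 \<le> \<gamma> ^ 3 * (C3 * Y3)" using \<gamma>0[of 3] by simp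
    then show False using C_less(3) t4 S by linarith
  qed
  have aX2: "38267 / 100000 \<le> \<bar>X2\<bar>" by (rule abs_ge_if_square_eq[OF half_angle(4)]) (use X1 r in \<open>simp_all add: power2_eq_square\<close>)
  have "Y2 * X2 < 0" using half_angle(6)[of "Suc 0"] Y1 r by simp
  then have same2: "C2 > 0 \<and> X2 > 0 \<and> Y2 < 0 \<or> C2 < 0" using n2 by (auto simp: mult_less_0_iff)
  \<comment> \<open>A negative \<open>C2\<close> would be close to -1, hence \<open>C3\<close> and
    the term at level 3 negligible.\<close>
  have C2: "0 < C2 \<and> 0 < X2 \<and> Y2 < 0"
  proof (rule ccontr)
    assume "\<not> ?thesis"
    then have "C2 \<le> - (9999 / 10000)" using same2 aC2 by auto
    then have "C3\<^sup>2 \<le> (72 / 10000)\<^sup>2" unfolding half_angle by (simp add: power2_eq_square)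
    then have "\<bar>C3\<bar> \<le> 72 / 10000" by (rule abs_le_of_square) simp
    then have "\<bar>C3 * Y3\<bar> \<le> 72 / 10000 * 1" unfolding abs_mult using abs_le_1(4)[of "Suc (Suc (Suc 0))"] by (intro mult_mono) auto
    from abs_mult_ge[OF \<gamma>0 \<gamma>p(2) this] have "- (2 / 1000) \<le> \<gamma> ^ 3 * (C3 * Y3)" by (simp add: power3_eq_cube)
    then show False using C_less(3) t4 S by linarith
  qed
  have "\<bar>Y3\<bar> \<le> 5556 / 10000" by (rule abs_le_if_square_eq[OF half_angle(5)]) (use C2 aX2 in \<open>simp_all add: power2_eq_square\<close>)
  then have "\<bar>C3 * Y3\<bar> \<le> 1 * (5556 / 10000)" unfolding abs_mult using abs_le_1(1)[of "Suc (Suc (Suc 0))"] by (intro mult_mono) auto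
  from abs_mult_ge[OF \<gamma>0 \<gamma>p(2) this] have f3: "- (99 / 1000) \<le> \<gamma> ^ 3 * (C3 * Y3)" by (simp add: power3_eq_cube)
  have aC3: "9999 / 10000 \<le> \<bar>C3\<bar>" by (rule abs_ge_if_square_eq[OF half_angle(1)]) (use C2 aC2 in \<open>simp_all add: power2_eq_square\<close>)
  have aX3: "8314 / 10000 \<le> \<bar>X3\<bar>" by (rule abs_ge_if_square_eq[OF half_angle(4)]) (use C2 aX2 in \<open>simp_all add: power2_eq_square\<close>)
  have "Y3 * X3 < 0" using half_angle(6)[of "Suc (Suc 0)"] C2 by simp
  \<comment> \<open>Either way the term at level 4 is small: \<open>X3 > 0\<close> makes
    \<open>Y4\<close> small, \<open>C3 < 0\<close> makes \<open>C4\<close> small.\<close>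
  then have same3: "C3 < 0 \<or> X3 > 0" using n3 by (auto simp: mult_less_0_iff)
  have le1: "0 \<le> (1 + C3) / 2" "(1 + C3) / 2 \<le> 1" "0 \<le> (1 - X3) / 2" "(1 - X3) / 2 \<le> 1"
    using abs_le_1(1,3)[of "Suc (Suc (Suc 0))"] by auto
  have "(C4 * Y4)\<^sup>2 = (1 + C3) / 2 * ((1 - X3) / 2)" unfolding power_mult_distrib half_angle ..
  also have "\<dots> \<le> 843 / 10000"
  proof (cases "X3 > 0")
    case True
    have "(1 + C3) / 2 * ((1 - X3) / 2) \<le> 1 * (843 / 10000)" using True aX3 le1 by (intro mult_mono) auto
    then show ?thesis by simp
  next
    case False
    have "(1 + C3) / 2 * ((1 - X3) / 2) \<le> 843 / 10000 * 1" using False same3 aC3 le1 by (intro mult_mono) auto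
    then show ?thesis by simp
  qed
  finally have "\<bar>C4 * Y4\<bar> \<le> 2904 / 10000" by (intro abs_le_of_square) (auto simp: power2_eq_square)
  from abs_mult_ge[OF \<gamma>0 \<gamma>p(3) this] have "- (29 / 1000) \<le> \<gamma> ^ 4 * (C4 * Y4)" by (simp add: eval_nat_numeral)
  then show False using C_less(4) t5 S f3 by linarith
qed

end

text \<open>The tangency inequalities involve absolute values only, so each family of sines may be
  multiplied by a global sign \<open>s\<close> or \<open>t\<close>. The difference of an even and an
  odd number makes \<open>cos (H 0) = 0\<close>.\<close>

lemma doubling_if_not_separated:
  assumes ns: "\<not> separated 2 \<gamma> (1 / 10000) 5 x 0 1" and \<gamma>: "1 / 2 < \<gamma>" "\<gamma> < 1"
  obtains C Z X Y where "doubling C Z X Y \<gamma>" "Z 0 = \<bar>sin (pi * (x - 1 / 2))\<bar>"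
proof -
  have \<gamma>0: "0 < \<gamma>" using \<gamma> by simp
  obtain j j' where j: "j mod 2 = 0" "j' mod 2 = 1"
    and F: "\<And>m. m \<le> 5 \<Longrightarrow> \<bar>sine_diff 2 \<gamma> m x j j'\<bar> < \<gamma> ^ m / (1 - \<gamma>) + 1 / 10000"
    and G: "\<And>m. m \<le> 5 \<Longrightarrow> \<bar>cosine_diff 2 \<gamma> m x j j'\<bar> < (\<gamma> / 2) ^ m / (1 - \<gamma> / 2) + 1 / 10000"
    using not_separatedE[OF ns _ \<gamma>0 \<gamma>(2)] by auto
  define M H where "M n = pi * (2 * x + real j + real j') / 2 ^ Suc n" and "H n = pi * (real j - real j') / 2 ^ Suc n" for n
  have double: "M n = 2 * M (Suc n)" "H n = 2 * H (Suc n)" for n by (simp_all add: M_def H_def)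
  obtain p q where pq: "j = 2 * p" "j' = 2 * q + 1" using j by (metis mod_0_imp_dvd dvdE odd_iff_mod_2_eq_one oddE)
  have "H 0 = pi * of_int (int p - int q) - pi / 2" by (simp add: H_def pq field_simps)
  then have cosH: "cos (H 0) = 0" using sin_npi_int[of "int p - int q"] by (simp only: cos_diff cos_pi_half sin_pi_half)
  have "M 0 = pi * x + pi * real (p + q) + pi / 2" by (simp add: M_def pq field_simps)
  then have "sin (M 0) = cos (pi * x) * cos (pi * real (p + q))"
    using sin_npi2[of "p + q"] by (simp add: sin_add cos_add)
  moreover have "\<bar>cos (pi * real (p + q))\<bar> = 1" using cos_npi2[of "p + q"] by (simp add: power_abs)
  moreover have "sin (pi * (x - 1 / 2)) = - cos (pi * x)" by (simp add: right_diff_distrib sin_diff)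
  ultimately have sinM: "\<bar>sin (M 0)\<bar> = \<bar>sin (pi * (x - 1 / 2))\<bar>" by (simp add: abs_mult)
  define s t where "s = (if 0 \<le> sin (M 0) then 1 else - 1 :: real)" and "t = sin (H 0)"
  have "t\<^sup>2 = 1" using sin_cos_squared_add[of "H 0"] cosH by (simp add: t_def)
  then have t: "t * t = 1" "\<bar>t\<bar> = 1" by (auto simp: power2_eq_square abs_square_eq_1[symmetric])
  have s: "s * s = 1" "\<bar>s\<bar> = 1" by (simp_all add: s_def)
  have S: "(\<Sum>n<m. \<gamma> ^ n * (cos (M n) * (t * sin (H n)))) = t * sine_diff 2 \<gamma> m x j j'" for m
    by (simp add: sine_diff_def sum_distrib_left M_def H_def mult_ac)
  have S': "(\<Sum>n<m. (\<gamma> / 2) ^ n * (s * sin (M n) * (t * sin (H n)))) = s * t * cosine_diff 2 \<gamma> m x j j'" for m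
    by (simp add: cosine_diff_def sum_distrib_left M_def H_def mult_ac)
  have "doubling (\<lambda>n. cos (M n)) (\<lambda>n. s * sin (M n)) (\<lambda>n. cos (H n)) (\<lambda>n. t * sin (H n)) \<gamma>"
  proof
    show "cos (M n) = 2 * (cos (M (Suc n)))\<^sup>2 - 1" "cos (H n) = 2 * (cos (H (Suc n)))\<^sup>2 - 1" for n
      unfolding double[of n] by (rule cos_double_cos)+
    show "s * sin (M n) = 2 * (s * sin (M (Suc n))) * cos (M (Suc n))" "t * sin (H n) = 2 * (t * sin (H (Suc n))) * cos (H (Suc n))" for n
      unfolding double[of n] sin_double by simp_all
    show "(cos (M n))\<^sup>2 + (s * sin (M n))\<^sup>2 = 1" "(cos (H n))\<^sup>2 + (t * sin (H n))\<^sup>2 = 1" for n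
      using s(1) t(1) by (simp_all add: power_mult_distrib power2_eq_square[of s] power2_eq_square[of t])
    show "t * sin (H 0) = 1" using t by (simp add: t_def)
    show "0 \<le> s * sin (M 0)" by (simp add: s_def)
    show "\<bar>\<Sum>n<m. \<gamma> ^ n * (cos (M n) * (t * sin (H n)))\<bar> < \<gamma> ^ m / (1 - \<gamma>) + 1 / 10000" if "m \<le> 5" for m
      unfolding S abs_mult t using F[OF that] by simp
    show "\<bar>\<Sum>n<m. (\<gamma> / 2) ^ n * (s * sin (M n) * (t * sin (H n)))\<bar> < (\<gamma> / 2) ^ m / (1 - \<gamma> / 2) + 1 / 10000" if "m \<le> 5" for m
      unfolding S' abs_mult s t using G[OF that] by simp
  qed (use \<gamma> cosH in auto)
  moreover have "s * sin (M 0) = \<bar>sin (pi * (x - 1 / 2))\<bar>" unfolding sinM[symmetric] by (simp add: s_def)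
  ultimately show thesis by (rule that)
qed

lemma binary_separationI:
  assumes \<gamma>: "1 / 2 < \<gamma>" "\<gamma> < 1" and \<delta>: "0 < \<delta>" and z: "z \<le> sin (pi * \<delta>)"
    and less: "\<And>C Z X Y. doubling C Z X Y \<gamma> \<Longrightarrow> Z 0 < z"
  shows "binary_separation \<gamma> \<delta> (1 / 10000) 5"
proof
  fix x :: real assume x: "0 \<le> x" "x < 1" "\<delta> \<le> \<bar>x - 1 / 2\<bar>"
  show "separated 2 \<gamma> (1 / 10000) 5 x 0 1"
  proof (rule ccontr)
    assume "\<not> separated 2 \<gamma> (1 / 10000) 5 x 0 1"
    then obtain C Z X Y where d: "doubling C Z X Y \<gamma>" and Z: "Z 0 = \<bar>sin (pi * (x - 1 / 2))\<bar>"
      using doubling_if_not_separated[OF _ \<gamma>] by metis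
    have "\<bar>x - 1 / 2\<bar> \<le> 1 / 2" using x by linarith
    then have "pi * \<bar>x - 1 / 2\<bar> \<le> pi * (1 / 2)" by (intro mult_left_mono) auto
    moreover have "pi * \<delta> \<le> pi * \<bar>x - 1 / 2\<bar>" using x by (intro mult_left_mono) auto
    moreover have "0 \<le> pi * \<delta>" using \<delta> by simp
    then have "- (pi / 2) \<le> pi * \<delta>" using pi_ge_zero by linarith
    ultimately have "sin (pi * \<delta>) \<le> sin (pi * \<bar>x - 1 / 2\<bar>)" by (intro sin_monotone_2pi_le) auto
    also have "\<dots> \<le> \<bar>sin (pi * (x - 1 / 2))\<bar>"
    proof (cases "0 \<le> x - 1 / 2")
      case False
      then have "pi * \<bar>x - 1 / 2\<bar> = - (pi * (x - 1 / 2))" by (simp add: algebra_simps)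
      then have "sin (pi * \<bar>x - 1 / 2\<bar>) = - sin (pi * (x - 1 / 2))" by (simp only: sin_minus)
      then show ?thesis by linarith
    qed simp
    finally show False using z less[OF d] Z by linarith
  qed
qed (use \<gamma> \<delta> in auto)

section \<open>Base two: the case distinction in \<gamma>\<close>

lemma sin_pi_over_8_ge: "1913 / 5000 \<le> sin (pi / 8)"
proof (rule power2_le_imp_le)
  have "cos (2 * (pi / 8)) = 1 - 2 * (sin (pi / 8))\<^sup>2" by (rule cos_double_sin)
  moreover have "2 * (pi / 8) = pi / 4" by simp
  ultimately have "sqrt 2 / 2 = 1 - 2 * (sin (pi / 8))\<^sup>2" by (simp only: cos_45)
  moreover have "sqrt 2 < 14143 / 10000" by (rule real_less_lsqrt) (simp_all add: power2_eq_square)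
  ultimately have "29285 / 200000 \<le> (sin (pi / 8))\<^sup>2" by linarith
  then show "(1913 / 5000)\<^sup>2 \<le> (sin (pi / 8))\<^sup>2" by (simp add: power2_eq_square)
  show "0 \<le> sin (pi / 8)" by (intro sin_ge_zero) auto
qed

text \<open>The break points are halves, rounded up, of the golden ratio, sqrt 2, the plastic number
  and the third, fourth and sixth roots of 2. \<open>L2_bounded_binary_sparse\<close> is applied
  with \<delta> = 1 / (2^n + 2) for n = 2, 3, 4, 6; n = 5 is passed over because
  \<open>near_tangency\<close> reaches 1 / 66 at once.\<close>

lemma L2_bounded_2:
  assumes \<gamma>: "1 < \<gamma> * 2" "\<gamma> < 1"
  shows "L2_bounded 2 \<gamma>"
proof -
  have g: "1 / 2 < \<gamma>" using \<gamma> by simp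
  note sepI = binary_separationI[OF g \<gamma>(2)]
  consider "8091 / 10000 \<le> \<gamma>" | "442 / 625 < \<gamma>" "\<gamma> \<le> 8091 / 10000" | "3313 / 5000 < \<gamma>" "\<gamma> \<le> 442 / 625"
    | "63 / 100 < \<gamma>" "\<gamma> \<le> 3313 / 5000" | "5947 / 10000 < \<gamma>" "\<gamma> \<le> 63 / 100"
    | "5613 / 10000 < \<gamma>" "\<gamma> \<le> 5947 / 10000" | "\<gamma> \<le> 5613 / 10000"
    by linarith
  then show ?thesis
  proof cases
    case 1
    have z: "7071 / 10000 \<le> sin (pi * (1 / 4))"
    proof -
      have "14142 / 10000 < sqrt 2" by (rule real_less_rsqrt) (simp add: power2_eq_square)
      then show ?thesis by (simp add: sin_45)
    qed
    interpret binary_separation \<gamma> "1 / 4" "1 / 10000" 5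
      by (rule sepI[OF _ z]) (use doubling.Z0_less_golden in auto)
    show ?thesis by (rule L2_bounded_binary_golden) (use 1 in auto)
  next
    case 2
    interpret binary_separation \<gamma> "1 / 6" "1 / 10000" 5
      by (rule sepI[of _ "1 / 2"]) (use doubling.Z0_less_sqrt2 2 in \<open>auto simp: sin_30\<close>)
    show ?thesis by (rule L2_bounded_binary_sparse[of 2 "14143 / 10000"]) (use 2 in \<open>auto simp: power2_eq_square\<close>)
  next
    case 3
    interpret binary_separation \<gamma> "1 / 8" "1 / 10000" 5
      by (rule sepI[of _ "1913 / 5000"]) (use doubling.Z0_less_plastic 3 sin_pi_over_8_ge in auto)
    show ?thesis by (rule L2_bounded_binary_plastic) (use 3 in auto)
  next
    case 4
    have "4 / 5 * sin (pi / 8) \<le> sin (4 / 5 * (pi / 8))" by (rule sin_scaled_ge) auto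
    then have z: "306 / 1000 \<le> sin (pi * (1 / 10))" using sin_pi_over_8_ge by simp
    interpret binary_separation \<gamma> "1 / 10" "1 / 10000" 5
      by (rule sepI[OF _ z]) (use doubling.Z0_less_sparse3 4 in auto)
    show ?thesis by (rule L2_bounded_binary_sparse[of 3 "126 / 100"]) (use 4 in \<open>auto simp: eval_nat_numeral\<close>)
  next
    case 5
    have "1 / 3 * sin (pi / 6) \<le> sin (1 / 3 * (pi / 6))" by (rule sin_scaled_ge) auto
    then have z: "164 / 1000 \<le> sin (pi * (1 / 18))" by (simp add: sin_30)
    interpret binary_separation \<gamma> "1 / 18" "1 / 10000" 5
      by (rule sepI[OF _ z]) (use doubling.Z0_less_sparse4 5 in auto)
    show ?thesis by (rule L2_bounded_binary_sparse[of 4 "11893 / 10000"]) (use 5 in \<open>auto simp: eval_nat_numeral\<close>)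
  next
    case 6
    have "1 / 11 * sin (pi / 6) \<le> sin (1 / 11 * (pi / 6))" by (rule sin_scaled_ge) auto
    then have z: "43 / 1000 \<le> sin (pi * (1 / 66))" by (simp add: sin_30)
    interpret binary_separation \<gamma> "1 / 66" "1 / 10000" 5
      by (rule sepI[OF _ z]) (use doubling.near_tangency(5) 6 in auto)
    show ?thesis by (rule L2_bounded_binary_sparse[of 6 "11225 / 10000"]) (use 6 in \<open>auto simp: eval_nat_numeral\<close>)
  next
    case 7
    have sep01: "separated 2 \<gamma> (1 / 10000) 5 x 0 1" for x
      using doubling_if_not_separated[OF _ g \<gamma>(2)] doubling.no_tangency[OF _ 7] by metis
    show ?thesis
    proof (rule L2_bounded_if_separated)
      fix x :: real and k l :: nat assume "k < 2" "l < 2" "k \<noteq> l"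
      then have "k = 0 \<and> l = 1 \<or> k = 1 \<and> l = 0" by linarith
      then show "separated 2 \<gamma> (1 / 10000) 5 x k l" using sep01 separated_commute by auto
    qed (use g \<gamma> in auto)
  qed
qed

theorem theorem1p3:
  fixes b :: nat and \<gamma> :: real
  assumes "b \<ge> 2" and "1 / real b < \<gamma>" and "\<gamma> < 1"
  shows "(\<exists>f :: real \<times> real \<Rightarrow> real.
            f \<in> borel_measurable borel \<and> (\<forall>z. 0 \<le> f z) \<and>
            (\<forall>x y. x \<notin> {0..<1} \<longrightarrow> f (x, y) = 0) \<and>
            integrable lborel (\<lambda>z. (f z)\<^sup>2) \<and>
            srb b \<gamma> psi = density lborel (\<lambda>z. ennreal (f z)))
       \<and> (AE x in lborel. \<exists>g :: real \<Rightarrow> real.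
            g \<in> borel_measurable borel \<and> (\<forall>y. 0 \<le> g y) \<and>
            integrable lborel (\<lambda>y. (g y)\<^sup>2) \<and>
            mfib b \<gamma> psi x = density lborel (\<lambda>y. ennreal (g y)))"
proof (rule L2_density_of_bounded)
  have b: "0 < real b" using assms(1) by simp
  show \<gamma>: "0 < \<gamma>" using assms(2) b by (meson divide_pos_pos less_trans zero_less_one)
  have g: "1 < \<gamma> * real b" using assms(2) b by (simp add: divide_less_eq)
  consider "b = 2" | "b = 3" | "4 \<le> b" using assms(1) by linarith
  then show "L2_bounded b \<gamma>"
    using L2_bounded_2[of \<gamma>] L2_bounded_3[of \<gamma>] L2_bounded_ge4[of b \<gamma>] \<gamma> g assms(3) by cases auto
qed (use assms in auto)

end
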